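(* Let $(X,\varphi)$ be a Cantor minimal system. The following are equivalent: (i) $(X,\varphi)$ is (conjugate to) a minimal subshift and $K^0(X,\varphi)\otimes\mathbb{Z}_2$ is a finite group; (ii) $[[\varphi]]_0$ is finitely generated; (iii) $[[\varphi]]$ is finitely generated.
   Context: A Cantor minimal system $(X,\varphi)$ is a Cantor set $X$ (compact, metrizable, perfect, totally disconnected, nonempty) with a homeomorphism $\varphi$ of $X$ that is minimal: the only closed $\varphi$-invariant subsets are $\emptyset$ and $X$. The topological full group $[[\varphi]]$ is the group of all homeomorphisms $\gamma$ of $X$ for which there is a continuous map $n_\gamma:X\to\mathbb{Z}$ with $\gamma(x)=\varphi^{n_\gamma(x)}(x)$ for all $x\in X$. The index map $I:[[\varphi]]\to\mathbb{Z}$ is $I(\gamma)=\int n_\gamma\,d\mu$, where $\mu$ is a $\varphi$-invariant probability measure; it is known that $I(\gamma)$ is an integer independent of $\mu$ and that $I$ is a surjective homomorphism. $[[\varphi]]_0$ is the kernel of $I$. $K^0(X,\varphi)=C(X,\mathbb{Z})/\{f-f\circ\varphi^{-1}:f\in C(X,\mathbb{Z})\}$, and $\mathbb{Z}_2=\mathbb{Z}/2\mathbb{Z}$, so $K^0(X,\varphi)\otimes\mathbb{Z}_2\cong K^0(X,\varphi)/2K^0(X,\varphi)$. A subshift is a closed shift-invariant subset of $A^{\mathbb{Z}}$ ($A$ a finite set, product topology) together with the restriction of the two-sided shift; it is minimal if that restriction is a minimal homeomorphism. Conjugate means topologically conjugate via a homeomorphism intertwining the two maps. *)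

theory Defs
  imports
    "HOL-Algebra.Bij"
    "HOL-Algebra.Free_Abelian_Groups"
    "HOL-Analysis.Analysis"
    "HOL-Probability.Probability_Measure"
begin

section \<open>Cantor minimal systems and subshifts\<close>

definition Cantor_set :: "'a topology \<Rightarrow> bool" where
  "Cantor_set X \<longleftrightarrow>
     topspace X \<noteq> {} \<and> compact_space X \<and> metrizable_space X \<and>
     X derived_set_of (topspace X) = topspace X \<and>
     (\<forall>C. connectedin X C \<longrightarrow> (\<exists>a. C \<subseteq> {a}))"

definition minimal_homeomorphism :: "'a topology \<Rightarrow> ('a \<Rightarrow> 'a) \<Rightarrow> bool" where
  "minimal_homeomorphism X \<phi> \<longleftrightarrow>
     homeomorphic_map X X \<phi> \<and>
     (\<forall>C. closedin X C \<and> \<phi> ` C = C \<longrightarrow> C = {} \<or> C = topspace X)"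

definition Cantor_minimal_system :: "'a topology \<Rightarrow> ('a \<Rightarrow> 'a) \<Rightarrow> bool" where
  "Cantor_minimal_system X \<phi> \<longleftrightarrow> Cantor_set X \<and> minimal_homeomorphism X \<phi>"

definition conjugate_systems ::
  "'a topology \<Rightarrow> ('a \<Rightarrow> 'a) \<Rightarrow> 'b topology \<Rightarrow> ('b \<Rightarrow> 'b) \<Rightarrow> bool" where
  "conjugate_systems X \<phi> Y \<psi> \<longleftrightarrow>
     (\<exists>h. homeomorphic_map X Y h \<and> (\<forall>x\<in>topspace X. h (\<phi> x) = \<psi> (h x)))"

definition shift :: "(int \<Rightarrow> 'b) \<Rightarrow> int \<Rightarrow> 'b" where
  "shift x = (\<lambda>i. x (i + 1))"

definition full_shift :: "'b set \<Rightarrow> (int \<Rightarrow> 'b) topology" where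
  "full_shift A = product_topology (\<lambda>_. discrete_topology A) UNIV"

definition subshift :: "'b set \<Rightarrow> (int \<Rightarrow> 'b) set \<Rightarrow> bool" where
  "subshift A Y \<longleftrightarrow> finite A \<and> closedin (full_shift A) Y \<and> shift ` Y = Y"

text \<open>Up to renaming of symbols every finite alphabet is a finite set of natural numbers,
  which avoids an existential quantification over types.\<close>

definition conjugate_to_minimal_subshift :: "'a topology \<Rightarrow> ('a \<Rightarrow> 'a) \<Rightarrow> bool" where
  "conjugate_to_minimal_subshift X \<phi> \<longleftrightarrow>
     (\<exists>(A :: nat set) Y. subshift A Y \<and>
        minimal_homeomorphism (subtopology (full_shift A) Y) shift \<and>
        conjugate_systems X \<phi> (subtopology (full_shift A) Y) shift)"


section \<open>The topological full group\<close>

text \<open>\<^const>\<open>BijGroup\<close> consists of functions that are \<open>undefined\<close> off the space, so \<open>\<phi>\<close> has to be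
  restricted before its integer powers are taken there.\<close>

definition iterate :: "'a topology \<Rightarrow> ('a \<Rightarrow> 'a) \<Rightarrow> int \<Rightarrow> 'a \<Rightarrow> 'a" where
  "iterate X \<phi> k = restrict \<phi> (topspace X) [^]\<^bsub>BijGroup (topspace X)\<^esub> k"

definition orbit_cocycle ::
  "'a topology \<Rightarrow> ('a \<Rightarrow> 'a) \<Rightarrow> ('a \<Rightarrow> 'a) \<Rightarrow> ('a \<Rightarrow> int) \<Rightarrow> bool" where
  "orbit_cocycle X \<phi> \<gamma> n \<longleftrightarrow>
     continuous_map X (discrete_topology UNIV) n \<and>
     (\<forall>x\<in>topspace X. \<gamma> x = iterate X \<phi> (n x) x)"

definition topological_full_group :: "'a topology \<Rightarrow> ('a \<Rightarrow> 'a) \<Rightarrow> ('a \<Rightarrow> 'a) monoid" where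
  "topological_full_group X \<phi> = (BijGroup (topspace X))
     \<lparr>carrier := {\<gamma> \<in> carrier (BijGroup (topspace X)).
                   homeomorphic_map X X \<gamma> \<and> (\<exists>n. orbit_cocycle X \<phi> \<gamma> n)}\<rparr>"

definition invariant_prob_measure ::
  "'a topology \<Rightarrow> ('a \<Rightarrow> 'a) \<Rightarrow> 'a measure \<Rightarrow> bool" where
  "invariant_prob_measure X \<phi> \<mu> \<longleftrightarrow>
     prob_space \<mu> \<and> space \<mu> = topspace X \<and>
     sets \<mu> = sigma_sets (topspace X) {U. openin X U} \<and>
     distr \<mu> \<mu> \<phi> = \<mu>"

text \<open>The integral does not depend on the invariant measure and is an integer, and the cocycle
  of \<open>\<gamma>\<close> is unique on the space because a minimal homeomorphism of an infinite space has no
  periodic points; hence the description below determines a unique integer.\<close>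

definition index_map :: "'a topology \<Rightarrow> ('a \<Rightarrow> 'a) \<Rightarrow> ('a \<Rightarrow> 'a) \<Rightarrow> int" where
  "index_map X \<phi> \<gamma> =
     (THE k. \<forall>n \<mu>. orbit_cocycle X \<phi> \<gamma> n \<and> invariant_prob_measure X \<phi> \<mu> \<longrightarrow>
        real_of_int k = (\<integral>x. real_of_int (n x) \<partial>\<mu>))"

definition topological_full_group_0 :: "'a topology \<Rightarrow> ('a \<Rightarrow> 'a) \<Rightarrow> ('a \<Rightarrow> 'a) monoid" where
  "topological_full_group_0 X \<phi> = (topological_full_group X \<phi>)
     \<lparr>carrier := kernel (topological_full_group X \<phi>) integer_group (index_map X \<phi>)\<rparr>"

definition finitely_generated_group :: "('a, 'b) monoid_scheme \<Rightarrow> bool" where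
  "finitely_generated_group G \<longleftrightarrow>
     (\<exists>S. finite S \<and> S \<subseteq> carrier G \<and> generate G S = carrier G)"


section \<open>The group \<open>K\<^sup>0(X, \<phi>)\<close> and tensor products\<close>

definition continuous_int_functions :: "'a topology \<Rightarrow> ('a \<Rightarrow> int) monoid" where
  "continuous_int_functions X =
     \<lparr>carrier = {f \<in> extensional (topspace X). continuous_map X (discrete_topology UNIV) f},
      monoid.mult = (\<lambda>f g. \<lambda>x\<in>topspace X. f x + g x),
      one = (\<lambda>x\<in>topspace X. 0)\<rparr>"

definition coboundaries :: "'a topology \<Rightarrow> ('a \<Rightarrow> 'a) \<Rightarrow> ('a \<Rightarrow> int) set" where
  "coboundaries X \<phi> =
     (\<lambda>f. \<lambda>x\<in>topspace X. f x - f (inv_into (topspace X) \<phi> x)) `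
       carrier (continuous_int_functions X)"

definition K0_group :: "'a topology \<Rightarrow> ('a \<Rightarrow> 'a) \<Rightarrow> ('a \<Rightarrow> int) set monoid" where
  "K0_group X \<phi> = continuous_int_functions X Mod coboundaries X \<phi>"

text \<open>Tensor product over the integers of two abelian groups (written multiplicatively): the free
  abelian group on pairs modulo the bilinearity relations. Compatibility with integer scalars
  follows from biadditivity.\<close>

definition tensor_relations ::
  "('a, 'm) monoid_scheme \<Rightarrow> ('b, 'n) monoid_scheme \<Rightarrow> ('a \<times> 'b \<Rightarrow>\<^sub>0 int) set" where
  "tensor_relations G H =
     {frag_of (a \<otimes>\<^bsub>G\<^esub> a', b) - frag_of (a, b) - frag_of (a', b) | a a' b.
        a \<in> carrier G \<and> a' \<in> carrier G \<and> b \<in> carrier H} \<union>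
     {frag_of (a, b \<otimes>\<^bsub>H\<^esub> b') - frag_of (a, b) - frag_of (a, b') | a b b'.
        a \<in> carrier G \<and> b \<in> carrier H \<and> b' \<in> carrier H}"

definition tensor_product ::
  "('a, 'm) monoid_scheme \<Rightarrow> ('b, 'n) monoid_scheme \<Rightarrow> ('a \<times> 'b \<Rightarrow>\<^sub>0 int) set monoid" where
  "tensor_product G H =
     (let F = free_Abelian_group (carrier G \<times> carrier H)
      in F Mod generate F (tensor_relations G H))"

end

theory Submission
  imports Defs
begin

text \<open>Elements of the full group are bijections that agree piecewise, on clopen sets, with powers
  \<open>T k\<close> of the system. The index of \<open>g\<close> is its net flow across a cut of an orbit, that is, the number of
  points that \<open>g\<close> carries from the past of a point into its future minus the number carried back. An
  element of index zero can be corrected on a small clopen set so that nothing crosses the cut there,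
  and what remains permutes the levels of finitely many towers. Hence the kernel of the index is
  generated by the transpositions \<open>swap A f\<close>.

  Modulo the subgroup generated by the products of two transpositions with a common base \<open>A\<close>, the class of
  \<open>swap A f\<close> depends only on the class of \<open>A\<close> in \<open>K\<^sup>0\<close> modulo two, so this subgroup has finite
  index if \<open>K\<^sup>0 \<otimes> \<int>\<^sub>2\<close> is finite. For a subshift it is generated by finitely many three-cycles:
  commutators turn the three-cycles over \<open>U\<close> and \<open>V\<close> into one over \<open>U \<inter> V\<close>, and in this way all
  cylinder sets are reached.

  Conversely, the cocycles of a finite generating set form a locally constant labelling that separates
  the points of the system, since otherwise two points with the same labels could not be told apart by
  any element of the group; such a labelling is a conjugacy to a subshift. The class modulo two of the set of
  left end points of pairs inverted by \<open>g\<close> (counted with parity) is additive in \<open>g\<close> and takes the value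
  \<open>D\<close> on the transposition of \<open>D\<close> and \<open>T 1 ` D\<close>, so a finite generating set leaves only finitely many
  classes.\<close>

text \<open>Why K^0 modulo two appears: modulo \<open>alt_group\<close> a transposition may be
  compared with one whose image lies elsewhere, so only its base matters; a base may be transported
  by the group, so coboundaries vanish; a transposition is an involution, so doubles vanish. For an
  element of index zero the crossings of a cut are equally many in both directions, but they have to
  be cancelled simultaneously at all cuts of a clopen set. This is done one pair of positions at a
  time, inside windows that do not overlap. The converse asks for an invariant of the whole group
  with values in K^0 modulo two. Inversions extend the sign of a finite permutation; an orbit may
  contain infinitely many, so they are counted per left end point and only up to coboundaries. The
  group theory uses permutations of the whole type over an abstract Boolean algebra. A measure
  enters only to identify the index with the flow; it has to be constructed, as otherwise the
  description in \<open>index_map\<close> is not determined.\<close>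

unbundle no m_inv_syntax

text \<open>Generation by composition and \<open>inv\<close> of total functions. The groups of the
  statement consist of functions that are undefined off the space; they are compared with these
  through \<open>rst\<close>.\<close>

inductive_set generated :: "('a \<Rightarrow> 'a) set \<Rightarrow> ('a \<Rightarrow> 'a) set" for A where
  generated_id: "id \<in> generated A"
| generated_incl: "g \<in> A \<Longrightarrow> g \<in> generated A"
| generated_comp: "g \<in> generated A \<Longrightarrow> h \<in> generated A \<Longrightarrow> g \<circ> h \<in> generated A"
| generated_inv: "g \<in> generated A \<Longrightarrow> inv g \<in> generated A"

lemma generated_subset: "A \<subseteq> generated B \<Longrightarrow> generated A \<subseteq> generated B"
proof
  fix x assume A: "A \<subseteq> generated B" and "x \<in> generated A"
  from this(2) show "x \<in> generated B"
    by induction (use A in \<open>blast intro: generated.intros\<close>)+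
qed

lemma generated_mono: "A \<subseteq> B \<Longrightarrow> generated A \<subseteq> generated B"
  by (rule generated_subset) (auto intro: generated.intros)

text \<open>Addition of Z/2-valued functions, written on their supports: classes of K^0 modulo two
  are handled as clopen sets under this operation.\<close>

definition sym_diff :: "'a set \<Rightarrow> 'a set \<Rightarrow> 'a set" (infixl "\<triangle>" 65) where
  "A \<triangle> B = (A - B) \<union> (B - A)"

lemma mem_sym_diff [simp]: "x \<in> A \<triangle> B \<longleftrightarrow> (x \<in> A) \<noteq> (x \<in> B)"
  by (auto simp: sym_diff_def)

lemma sym_diff_self [simp]: "A \<triangle> A = {}" and sym_diff_empty [simp]: "A \<triangle> {} = A" "{} \<triangle> A = A"
  by (auto simp: sym_diff_def)

lemma sym_diff_assoc: "(A \<triangle> B) \<triangle> C = A \<triangle> (B \<triangle> C)" and sym_diff_commute: "A \<triangle> B = B \<triangle> A"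
  by auto

text \<open>What is used of a Cantor minimal system: a free action of the integers, compactness and
  separation by clopen sets, and minimality in the form \<open>orbit_meets\<close>.
  \<open>T_outside\<close> makes every \<open>T a\<close> a permutation of the whole type, so that
  composition and \<open>inv\<close> serve as group operations.\<close>

locale clopen_system =
  fixes S :: "'a set" and \<C> :: "'a set set" and T :: "int \<Rightarrow> 'a \<Rightarrow> 'a"
  assumes T_0: "T 0 x = x"
    and T_add: "T (a + b) x = T a (T b x)"
    and T_mem: "x \<in> S \<Longrightarrow> T a x \<in> S"
    and T_outside: "x \<notin> S \<Longrightarrow> T a x = x"
    and T_free: "x \<in> S \<Longrightarrow> T a x = x \<Longrightarrow> a = 0"
    and space_nonempty: "S \<noteq> {}"
    and clopen_subset: "A \<in> \<C> \<Longrightarrow> A \<subseteq> S"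
    and clopen_space: "S \<in> \<C>"
    and clopen_compl: "A \<in> \<C> \<Longrightarrow> S - A \<in> \<C>"
    and clopen_Un: "A \<in> \<C> \<Longrightarrow> B \<in> \<C> \<Longrightarrow> A \<union> B \<in> \<C>"
    and clopen_T: "A \<in> \<C> \<Longrightarrow> T a ` A \<in> \<C>"
    and clopen_compact: "\<U> \<subseteq> \<C> \<Longrightarrow> S \<subseteq> \<Union>\<U> \<Longrightarrow> \<exists>\<V>\<subseteq>\<U>. finite \<V> \<and> S \<subseteq> \<Union>\<V>"
    and clopen_separates: "x \<in> S \<Longrightarrow> y \<in> S \<Longrightarrow> x \<noteq> y \<Longrightarrow> \<exists>A\<in>\<C>. x \<in> A \<and> y \<notin> A"
    and orbit_meets: "A \<in> \<C> \<Longrightarrow> A \<noteq> {} \<Longrightarrow> x \<in> S \<Longrightarrow> \<exists>k. T k x \<in> A"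
begin

lemma T_uminus [simp]: "T (- a) (T a x) = x" "T a (T (- a) x) = x"
  using T_add[of "-a" a x] T_add[of a "-a" x] T_0 by auto

lemma T_T: "T a (T b x) = T (a + b) x"
  by (simp add: T_add)

lemma bij_T: "bij (T a)"
  by (rule o_bij[of "T (-a)"]) (auto simp: fun_eq_iff)

lemma inj_T: "inj (T a)"
  using bij_T bij_is_inj by blast

lemma T_eq_iff [simp]: "T a x = T a y \<longleftrightarrow> x = y"
  using inj_T[of a] by (auto dest: injD)

lemma inv_T: "inv (T a) = T (- a)"
  by (rule inv_unique_comp) (auto simp: fun_eq_iff)

lemma T_mem_iff [simp]: "T a x \<in> S \<longleftrightarrow> x \<in> S"
  using T_mem[of x a] T_mem[of "T a x" "-a"] by auto

lemma T_cancel: "x \<in> S \<Longrightarrow> T a x = T b x \<longleftrightarrow> a = b"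
proof
  assume x: "x \<in> S" and "T a x = T b x"
  then have "T (- b) (T a x) = x" by simp
  then have "T (a - b) x = x" by (simp add: T_T)
  then show "a = b" using T_free[OF x, of "a - b"] by auto
qed auto

lemma T_eqD: "T a x = T b y \<Longrightarrow> y = T (a - b) x"
  by (metis T_add T_uminus(1) diff_conv_add_uminus add.commute)

lemma mem_T_image: "x \<in> T a ` A \<longleftrightarrow> T (- a) x \<in> A"
  by (metis T_uminus image_iff)

lemma T_image_T_image: "T a ` T b ` A = T (a + b) ` A"
  by (auto simp: image_image T_T)

lemma T_0_image [simp]: "T 0 ` A = A"
  by (simp add: T_0)

lemma clopen_empty: "{} \<in> \<C>"
  using clopen_compl[OF clopen_space] by simp

lemma clopen_Int: "A \<in> \<C> \<Longrightarrow> B \<in> \<C> \<Longrightarrow> A \<inter> B \<in> \<C>"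
proof -
  assume A: "A \<in> \<C>" and B: "B \<in> \<C>"
  have "A \<inter> B = S - ((S - A) \<union> (S - B))" using clopen_subset[OF A] by auto
  then show ?thesis using A B by (simp add: clopen_compl clopen_Un)
qed

lemma clopen_Diff: "A \<in> \<C> \<Longrightarrow> B \<in> \<C> \<Longrightarrow> A - B \<in> \<C>"
proof -
  assume A: "A \<in> \<C>" and B: "B \<in> \<C>"
  have "A - B = A \<inter> (S - B)" using clopen_subset[OF A] by auto
  then show ?thesis using A B by (simp add: clopen_compl clopen_Int)
qed

lemma clopen_sym_diff: "A \<in> \<C> \<Longrightarrow> B \<in> \<C> \<Longrightarrow> A \<triangle> B \<in> \<C>"
  by (simp add: sym_diff_def clopen_Un clopen_Diff)

lemma clopen_Union: "finite \<U> \<Longrightarrow> \<U> \<subseteq> \<C> \<Longrightarrow> \<Union>\<U> \<in> \<C>"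
  by (induction rule: finite_induct) (auto simp: clopen_empty clopen_Un)

lemma clopen_UN: "finite I \<Longrightarrow> (\<And>i. i \<in> I \<Longrightarrow> A i \<in> \<C>) \<Longrightarrow> (\<Union>i\<in>I. A i) \<in> \<C>"
  by (rule clopen_Union) auto

text \<open>Compactness as an induction principle, by which claims about elements of the full group
  are reduced to sets where their cocycles are constant. A finite cover is made disjoint by cutting
  away what is already treated, which is why \<open>local\<close> must speak of every clopen subset
  of the neighbourhood.\<close>

lemma clopen_induct [consumes 1, case_names local Un]:
  assumes A: "A \<in> \<C>"
    and loc: "\<And>x. x \<in> S \<Longrightarrow> \<exists>B\<in>\<C>. x \<in> B \<and> (\<forall>D\<in>\<C>. D \<subseteq> B \<longrightarrow> Q D)"
    and join: "\<And>D E. D \<in> \<C> \<Longrightarrow> E \<in> \<C> \<Longrightarrow> D \<inter> E = {} \<Longrightarrow> Q D \<Longrightarrow> Q E \<Longrightarrow> Q (D \<union> E)"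
  shows "Q A"
proof -
  define \<U> where "\<U> = {B\<in>\<C>. \<forall>D\<in>\<C>. D \<subseteq> B \<longrightarrow> Q D}"
  obtain \<V> where V: "\<V> \<subseteq> \<U>" "finite \<V>" "S \<subseteq> \<Union>\<V>"
    using clopen_compact[of \<U>] loc unfolding \<U>_def by (smt (verit) UnionI mem_Collect_eq subsetI)
  have "Q (A \<inter> \<Union>\<V>)" using V(2,1)
  proof (induction rule: finite_induct)
    case empty
    \<comment> \<open>\<open>Q {}\<close> is not among the assumptions; it comes from the
      neighbourhood of an arbitrary point.\<close>
    obtain x where "x \<in> S" using space_nonempty by auto
    then show ?case using loc clopen_empty by (metis Int_empty_right Union_empty empty_subsetI)
  next
    case (insert B \<V>)
    have B: "B \<in> \<C>" "\<forall>D\<in>\<C>. D \<subseteq> B \<longrightarrow> Q D" and VC: "\<Union>\<V> \<in> \<C>"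
      using insert by (auto simp: \<U>_def intro!: clopen_Union)
    have "A \<inter> \<Union>(insert B \<V>) = (A \<inter> \<Union>\<V>) \<union> (A \<inter> B - \<Union>\<V>)" by auto
    moreover have "Q ((A \<inter> \<Union>\<V>) \<union> (A \<inter> B - \<Union>\<V>))"
      using insert A B VC by (intro join) (auto intro!: B(2)[rule_format] clopen_Int clopen_Diff)
    ultimately show ?case by simp
  qed
  moreover have "A \<inter> \<Union>\<V> = A" using V clopen_subset[OF A] by auto
  ultimately show ?thesis by simp
qed

lemma clopen_partition:
  assumes loc: "\<And>x. x \<in> S \<Longrightarrow> \<exists>B\<in>\<C>. x \<in> B \<and> Q B"
    and mono: "\<And>B D. Q B \<Longrightarrow> D \<subseteq> B \<Longrightarrow> Q D"
  obtains m and P :: "nat \<Rightarrow> 'a set" where "\<And>i. P i \<in> \<C>" "\<And>i. i < m \<Longrightarrow> Q (P i)"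
    "\<And>i j. i \<noteq> j \<Longrightarrow> P i \<inter> P j = {}" "S = (\<Union>i<m. P i)"
proof -
  obtain \<V> where V: "\<V> \<subseteq> {B\<in>\<C>. Q B}" "finite \<V>" "S \<subseteq> \<Union>\<V>"
    using clopen_compact[of "{B\<in>\<C>. Q B}"] loc by (smt (verit) UnionI mem_Collect_eq subsetI)
  obtain f m where f: "\<V> = f ` {i::nat. i < m}" using V(2) finite_imp_nat_seg_image_inj_on by metis
  \<comment> \<open>Empty beyond \<open>m\<close>, so that disjointness can hold for all
    indices.\<close>
  define B where "B i = (if i < m then f i else {})" for i
  have B: "B i \<in> \<C>" "i < m \<Longrightarrow> Q (B i)" for i
    using V(1) f by (auto simp: B_def clopen_empty)
  define P where "P i = B i - (\<Union>j<i. B j)" for i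
  show ?thesis
  proof (rule that[of P m])
    show "P i \<in> \<C>" for i unfolding P_def by (intro clopen_Diff clopen_UN B) auto
    show "Q (P i)" if "i < m" for i using mono[OF B(2)[OF that]] by (auto simp: P_def)
    show "P i \<inter> P j = {}" if "i \<noteq> j" for i j
      using that by (cases i j rule: linorder_cases) (auto simp: P_def)
    show "S = (\<Union>i<m. P i)"
    proof
      show "(\<Union>i<m. P i) \<subseteq> S" using clopen_subset[OF B(1)] unfolding P_def by blast
      show "S \<subseteq> (\<Union>i<m. P i)"
      proof
        fix x assume "x \<in> S"
        then obtain i where "i < m" "x \<in> f i" using V(3) f by auto
        then have ex: "\<exists>i. x \<in> B i" by (metis B_def)
        define i where "i = (LEAST i. x \<in> B i)"
        have "x \<in> B i" using ex unfolding i_def by (rule LeastI_ex)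
        moreover have "x \<notin> B j" if "j < i" for j using not_less_Least that unfolding i_def by blast
        moreover have "i < m" using \<open>x \<in> B i\<close> by (auto simp: B_def split: if_splits)
        ultimately show "x \<in> (\<Union>i<m. P i)" by (auto simp: P_def)
      qed
    qed
  qed
qed

section \<open>Locally constant functions\<close>

definition loc_const :: "('a \<Rightarrow> 'b) \<Rightarrow> bool" where
  "loc_const f \<longleftrightarrow> (\<forall>x\<in>S. \<exists>B\<in>\<C>. x \<in> B \<and> (\<forall>y\<in>B. f y = f x))"

lemma loc_constI:
  "(\<And>x. x \<in> S \<Longrightarrow> \<exists>B\<in>\<C>. x \<in> B \<and> (\<forall>y\<in>B. f y = f x)) \<Longrightarrow> loc_const f"
  by (auto simp: loc_const_def)

lemma loc_constE:
  assumes "loc_const f" "x \<in> S"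
  obtains B v where "B \<in> \<C>" "x \<in> B" "\<And>y. y \<in> B \<Longrightarrow> f y = v"
  using assms unfolding loc_const_def by metis

lemma loc_const_clopen: "loc_const f \<Longrightarrow> {x\<in>S. p (f x)} \<in> \<C>"
proof -
  assume f: "loc_const f"
  have "{x\<in>S. p (f x)} \<inter> A \<in> \<C>" if "A \<in> \<C>" for A
    using that
  proof (induction rule: clopen_induct)
    case (local x)
    then obtain B v where B: "B \<in> \<C>" "x \<in> B" "\<And>y. y \<in> B \<Longrightarrow> f y = v" using loc_constE[OF f] by metis
    have "{x\<in>S. p (f x)} \<inter> D \<in> \<C>" if "D \<in> \<C>" "D \<subseteq> B" for D
    proof -
      have "{x\<in>S. p (f x)} \<inter> D = (if p v then D else {})"
        using that B clopen_subset[OF that(1)] by auto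
      then show ?thesis using that clopen_empty by simp
    qed
    then show ?case using B by auto
  next
    case (Un D E)
    then show ?case using clopen_Un by (metis Int_Un_distrib)
  qed
  from this[OF clopen_space] show ?thesis by (simp add: Int_absorb2)
qed

lemma loc_const_finite: "loc_const f \<Longrightarrow> finite (f ` S)"
proof -
  assume f: "loc_const f"
  have "finite (f ` A)" if "A \<in> \<C>" for A
    using that
  proof (induction rule: clopen_induct)
    case (local x)
    then obtain B v where B: "B \<in> \<C>" "x \<in> B" "\<And>y. y \<in> B \<Longrightarrow> f y = v" using loc_constE[OF f] by metis
    have "finite (f ` D)" if "D \<subseteq> B" for D
      using B that by (intro finite_subset[of "f ` D" "{v}"]) auto
    then show ?case using B by auto
  qed (simp add: image_Un)
  from this[OF clopen_space] show ?thesis .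
qed

lemma loc_const_pair: "loc_const f \<Longrightarrow> loc_const g \<Longrightarrow> loc_const (\<lambda>x. (f x, g x))"
proof (rule loc_constI)
  fix x assume "loc_const f" "loc_const g" "x \<in> S"
  then obtain A v B w where "A \<in> \<C>" "x \<in> A" "\<And>y. y \<in> A \<Longrightarrow> f y = v"
      "B \<in> \<C>" "x \<in> B" "\<And>y. y \<in> B \<Longrightarrow> g y = w"
    using loc_constE by metis
  then show "\<exists>B\<in>\<C>. x \<in> B \<and> (\<forall>y\<in>B. (f y, g y) = (f x, g x))"
    by (intro bexI[of _ "A \<inter> B"]) (auto intro: clopen_Int)
qed

lemma loc_const_const: "loc_const (\<lambda>x. c)"
  by (rule loc_constI) (use clopen_space in auto)

lemma loc_const_apply: "loc_const f \<Longrightarrow> loc_const (\<lambda>x. F (f x))"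
  unfolding loc_const_def by metis

lemma loc_const_apply2: "loc_const f \<Longrightarrow> loc_const g \<Longrightarrow> loc_const (\<lambda>x. F (f x) (g x))"
  using loc_const_apply[OF loc_const_pair, of f g "\<lambda>p. F (fst p) (snd p)"] by simp

lemma loc_const_if: "loc_const p \<Longrightarrow> loc_const f \<Longrightarrow> loc_const g \<Longrightarrow> loc_const (\<lambda>x. if p x then f x else g x)"
  using loc_const_apply2[OF loc_const_pair, of p f g "\<lambda>p y. if fst p then snd p else y"]
  by (simp cong: if_cong)

lemma loc_const_mem: "A \<in> \<C> \<Longrightarrow> loc_const (\<lambda>x. x \<in> A)"
proof (rule loc_constI)
  fix x assume "x \<in> S" "A \<in> \<C>"
  then show "\<exists>B\<in>\<C>. x \<in> B \<and> (\<forall>y\<in>B. (y \<in> A) = (x \<in> A))"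
    by (intro bexI[of _ "if x \<in> A then A else S - A"]) (auto intro: clopen_compl)
qed

lemma loc_const_cong: "(\<And>x. x \<in> S \<Longrightarrow> f x = g x) \<Longrightarrow> loc_const f \<longleftrightarrow> loc_const g"
  unfolding loc_const_def by (metis clopen_subset subsetD)

lemma loc_const_T: "loc_const f \<Longrightarrow> loc_const (\<lambda>x. f (T a x))"
proof (rule loc_constI)
  fix x assume "loc_const f" "x \<in> S"
  then obtain B v where "B \<in> \<C>" "T a x \<in> B" "\<And>y. y \<in> B \<Longrightarrow> f y = v"
    using T_mem_iff loc_constE by metis
  then show "\<exists>B\<in>\<C>. x \<in> B \<and> (\<forall>y\<in>B. f (T a y) = f (T a x))"
    by (intro bexI[of _ "T (-a) ` B"]) (auto simp: mem_T_image clopen_T)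
qed

lemma loc_const_Ball: "finite I \<Longrightarrow> (\<And>i. i \<in> I \<Longrightarrow> loc_const (\<lambda>x. p i x)) \<Longrightarrow> loc_const (\<lambda>x. \<forall>i\<in>I. p i x)"
proof (induction rule: finite_induct)
  case (insert i I)
  then show ?case using loc_const_apply2[of "\<lambda>x. p i x" "\<lambda>x. \<forall>i\<in>I. p i x" "(\<and>)"] by simp
qed (simp add: loc_const_const)

lemma loc_const_Collect:
  "finite I \<Longrightarrow> (\<And>i. i \<in> I \<Longrightarrow> loc_const (\<lambda>x. p i x)) \<Longrightarrow> loc_const (\<lambda>x. {i\<in>I. p i x})"
proof (induction rule: finite_induct)
  case (insert i I)
  have "{j \<in> insert i I. p j x} = (if p i x then insert i {j\<in>I. p j x} else {j\<in>I. p j x})" for x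
    by auto
  then show ?case
    using insert loc_const_apply2[of "\<lambda>x. p i x" "\<lambda>x. {i\<in>I. p i x}" "\<lambda>b J. if b then insert i J else J"]
    by simp
qed (simp add: loc_const_const)

text \<open>Freeness in its working form. For each \<open>k\<close>, separate \<open>x\<close> from
  \<open>T k x\<close> by a clopen set and keep only those of its points that \<open>T k\<close>
  moves out of it.\<close>

lemma small_neighbourhood:
  assumes x: "x \<in> S" and K: "finite K" "0 \<notin> K"
  obtains B where "B \<in> \<C>" "x \<in> B" "\<And>k. k \<in> K \<Longrightarrow> T k ` B \<inter> B = {}"
proof -
  have "\<exists>B\<in>\<C>. x \<in> B \<and> (\<forall>k\<in>K. T k ` B \<inter> B = {})" using K
  proof (induction rule: finite_induct)
    case empty
    then show ?case using x clopen_space by auto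
  next
    case (insert k K)
    then obtain B where B: "B \<in> \<C>" "x \<in> B" "\<forall>k\<in>K. T k ` B \<inter> B = {}" by auto
    have "x \<noteq> T k x" using insert.prems T_free[OF x, of k] by auto
    then obtain A where A: "A \<in> \<C>" "x \<in> A" "T k x \<notin> A" using clopen_separates[of x "T k x"] x by auto
    show ?case
      using A B by (intro bexI[of _ "B \<inter> (A - T (-k) ` A)"])
        (auto simp: mem_T_image clopen_Int clopen_Diff clopen_T)
  qed
  then show ?thesis using that by auto
qed

subsection \<open>The full group\<close>

definition full :: "('a \<Rightarrow> 'a) set" where
  "full = {g. bij g \<and> (\<forall>x. x \<notin> S \<longrightarrow> g x = x) \<and> (\<exists>n. loc_const n \<and> (\<forall>x\<in>S. g x = T (n x) x))}"

text \<open>Unique on \<open>S\<close> by freeness; off \<open>S\<close> every power fixes the point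
  and the description has no meaning.\<close>

definition cocycle :: "('a \<Rightarrow> 'a) \<Rightarrow> 'a \<Rightarrow> int" where
  "cocycle g x = (THE k. g x = T k x)"

lemma cocycle_eqI: "x \<in> S \<Longrightarrow> g x = T k x \<Longrightarrow> cocycle g x = k"
  unfolding cocycle_def by (rule the_equality) (auto simp: T_cancel)

lemma fullI:
  "bij g \<Longrightarrow> (\<And>x. x \<notin> S \<Longrightarrow> g x = x) \<Longrightarrow> loc_const n \<Longrightarrow> (\<And>x. x \<in> S \<Longrightarrow> g x = T (n x) x) \<Longrightarrow> g \<in> full"
  unfolding full_def by auto

lemma full_bij: "g \<in> full \<Longrightarrow> bij g" and full_outside: "g \<in> full \<Longrightarrow> x \<notin> S \<Longrightarrow> g x = x"
  by (auto simp: full_def)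

lemma full_cocycle:
  assumes "g \<in> full"
  shows loc_const_cocycle: "loc_const (cocycle g)" and full_apply: "x \<in> S \<Longrightarrow> g x = T (cocycle g x) x"
proof -
  obtain n where n: "loc_const n" "\<And>x. x \<in> S \<Longrightarrow> g x = T (n x) x" using assms by (auto simp: full_def)
  then have "cocycle g x = n x" if "x \<in> S" for x using that by (simp add: cocycle_eqI)
  then show "loc_const (cocycle g)" "x \<in> S \<Longrightarrow> g x = T (cocycle g x) x"
    using n loc_const_cong[of "cocycle g" n] by auto
qed

lemma full_inj: "g \<in> full \<Longrightarrow> g x = g y \<longleftrightarrow> x = y"
  using full_bij bij_is_inj by (metis injD)

lemma full_inv [simp]: "g \<in> full \<Longrightarrow> inv g (g x) = x" "g \<in> full \<Longrightarrow> g (inv g x) = x"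
  by (simp_all add: bij_is_inj bij_is_surj full_bij surj_f_inv_f)

lemma full_mem_iff [simp]: "g \<in> full \<Longrightarrow> g x \<in> S \<longleftrightarrow> x \<in> S"
  using full_apply full_outside by (metis T_mem_iff)

lemma full_inv_mem_iff [simp]: "g \<in> full \<Longrightarrow> inv g x \<in> S \<longleftrightarrow> x \<in> S"
  using full_mem_iff[of g "inv g x"] by simp

lemma mem_full_image: "g \<in> full \<Longrightarrow> x \<in> g ` A \<longleftrightarrow> inv g x \<in> A"
  using full_inv by (metis image_iff)

lemma loc_const_full: "loc_const f \<Longrightarrow> g \<in> full \<Longrightarrow> loc_const (\<lambda>x. f (g x))"
proof (rule loc_constI)
  fix x assume f: "loc_const f" and g: "g \<in> full" and x: "x \<in> S"
  obtain A k where A: "A \<in> \<C>" "x \<in> A" "\<And>y. y \<in> A \<Longrightarrow> cocycle g y = k"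
    using loc_constE[OF loc_const_cocycle[OF g] x] by metis
  obtain B v where B: "B \<in> \<C>" "x \<in> B" "\<And>y. y \<in> B \<Longrightarrow> f (T k y) = v"
    using loc_constE[OF loc_const_T[OF f, of k] x] by metis
  have "f (g y) = f (g x)" if "y \<in> A \<inter> B" for y
  proof -
    have "y \<in> S" using that A clopen_subset[OF A(1)] by auto
    then show ?thesis using that A B full_apply[OF g] x by simp
  qed
  then show "\<exists>B\<in>\<C>. x \<in> B \<and> (\<forall>y\<in>B. f (g y) = f (g x))"
    using A(1,2) B(1,2) by (intro bexI[of _ "A \<inter> B"]) (blast intro: clopen_Int)+
qed

lemma id_full: "id \<in> full"
  by (rule fullI[of _ "\<lambda>x. 0"]) (auto simp: loc_const_const T_0)

lemma T_full: "T a \<in> full"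
  by (rule fullI[of _ "\<lambda>x. a"]) (auto simp: loc_const_const bij_T T_outside)

lemma comp_full: "g \<in> full \<Longrightarrow> h \<in> full \<Longrightarrow> g \<circ> h \<in> full"
proof (rule fullI[of _ "\<lambda>x. cocycle g (h x) + cocycle h x"])
  assume g: "g \<in> full" and h: "h \<in> full"
  show "bij (g \<circ> h)" using g h by (simp add: bij_comp full_bij)
  show "(g \<circ> h) x = x" if "x \<notin> S" for x using that full_outside[OF g] full_outside[OF h] by simp
  show "loc_const (\<lambda>x. cocycle g (h x) + cocycle h x)"
    using loc_const_apply2[OF loc_const_full[OF loc_const_cocycle[OF g] h] loc_const_cocycle[OF h]] .
  show "(g \<circ> h) x = T (cocycle g (h x) + cocycle h x) x" if "x \<in> S" for x
  proof -
    have "g (h x) = T (cocycle g (h x)) (h x)" using full_apply[OF g] that h by simp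
    also have "h x = T (cocycle h x) x" using full_apply[OF h that] .
    finally show ?thesis by (metis T_add \<open>h x = T (cocycle h x) x\<close> comp_apply)
  qed
qed

lemma cocycle_comp:
  "g \<in> full \<Longrightarrow> h \<in> full \<Longrightarrow> x \<in> S \<Longrightarrow> cocycle (g \<circ> h) x = cocycle g (h x) + cocycle h x"
  by (rule cocycle_eqI) (auto simp: T_add full_apply[symmetric])

lemma inv_full: "g \<in> full \<Longrightarrow> inv g \<in> full"
proof (rule fullI[of _ "\<lambda>x. - cocycle g (inv g x)"])
  assume g: "g \<in> full"
  show "bij (inv g)" using g by (simp add: full_bij bij_imp_bij_inv)
  show "inv g x = x" if "x \<notin> S" for x using that g by (metis full_inv(1) full_outside)
  show eq: "inv g x = T (- cocycle g (inv g x)) x" if "x \<in> S" for x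
    using full_apply[OF g, of "inv g x"] that g by (metis T_uminus(1) full_inv(2) full_inv_mem_iff)
  show "loc_const (\<lambda>x. - cocycle g (inv g x))"
  proof (rule loc_constI)
    fix x assume x: "x \<in> S"
    define k where "k = cocycle g (inv g x)"
    \<comment> \<open>On a piece \<open>A\<close> where \<open>g\<close> is \<open>T k\<close>, the
      inverse is \<open>T (- k)\<close> on the image of \<open>A\<close> under \<open>T k\<close>;
      this image is the neighbourhood sought.\<close>
    obtain A where A: "A \<in> \<C>" "inv g x \<in> A" "\<And>y. y \<in> A \<Longrightarrow> cocycle g y = k"
      using loc_constE[OF loc_const_cocycle[OF g], of "inv g x"] x g unfolding k_def
      by (metis full_inv_mem_iff)
    have "cocycle g (inv g y) = k" if "T (-k) y \<in> A" for y
    proof -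
      have "T (-k) y \<in> S" using that A clopen_subset[OF A(1)] by auto
      then have "g (T (-k) y) = y" using full_apply[OF g, of "T (-k) y"] A that by simp
      then show ?thesis using that A g by (metis full_inv(1))
    qed
    moreover have "T (-k) x \<in> A" using A(2) eq[OF x] unfolding k_def by simp
    ultimately have "x \<in> T k ` A \<and> (\<forall>y\<in>T k ` A. - cocycle g (inv g y) = - k)"
      unfolding mem_T_image by simp
    then show "\<exists>B\<in>\<C>. x \<in> B \<and> (\<forall>y\<in>B. - cocycle g (inv g y) = - cocycle g (inv g x))"
      using clopen_T[OF A(1)] unfolding k_def[symmetric] by blast
  qed
qed

lemma clopen_full_image: "g \<in> full \<Longrightarrow> A \<in> \<C> \<Longrightarrow> g ` A \<in> \<C>"
proof -
  assume g: "g \<in> full" and A: "A \<in> \<C>"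
  have "{x\<in>S. inv g x \<in> A} \<in> \<C>"
    using loc_const_clopen[OF loc_const_full[OF loc_const_mem[OF A] inv_full[OF g]], of id] by simp
  moreover have "{x\<in>S. inv g x \<in> A} = g ` A"
    using g full_inv_mem_iff[OF g] clopen_subset[OF A] unfolding set_eq_iff mem_full_image[OF g] by blast
  ultimately show ?thesis by simp
qed

lemma generated_full: "A \<subseteq> full \<Longrightarrow> generated A \<subseteq> full"
proof
  fix x assume A: "A \<subseteq> full" and "x \<in> generated A"
  from this(2) show "x \<in> full"
    by induction (use A in \<open>blast intro: id_full comp_full inv_full\<close>)+
qed

lemma cocycle_bound:
  assumes "g \<in> full"
  obtains N where "N \<ge> 0" "\<And>x. x \<in> S \<Longrightarrow> \<bar>cocycle g x\<bar> \<le> N"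
proof -
  have "finite ((\<lambda>x. \<bar>cocycle g x\<bar>) ` S)"
    using loc_const_finite[OF loc_const_apply[OF loc_const_cocycle[OF assms]]] .
  then show ?thesis using that[of "Max (insert 0 ((\<lambda>x. \<bar>cocycle g x\<bar>) ` S))"] by simp
qed

section \<open>Transpositions of clopen sets along elements of the full group\<close>

definition swap :: "'a set \<Rightarrow> ('a \<Rightarrow> 'a) \<Rightarrow> 'a \<Rightarrow> 'a" where
  "swap A f x = (if x \<in> A then f x else if x \<in> f ` A then inv f x else x)"

lemma swap_apply:
  assumes "f \<in> full" "A \<inter> f ` A = {}"
  shows "x \<in> A \<Longrightarrow> swap A f x = f x" "x \<in> A \<Longrightarrow> swap A f (f x) = x"
    "x \<notin> A \<Longrightarrow> x \<notin> f ` A \<Longrightarrow> swap A f x = x"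
  using assms by (auto simp: swap_def)

lemma swap_swap [simp]:
  assumes "f \<in> full" "A \<inter> f ` A = {}"
  shows "swap A f (swap A f x) = x"
  using swap_apply[OF assms] by (cases "x \<in> A"; cases "x \<in> f ` A") auto

lemma swap_comp_swap: "f \<in> full \<Longrightarrow> A \<inter> f ` A = {} \<Longrightarrow> swap A f \<circ> swap A f = id"
  by (auto simp: fun_eq_iff)

lemma swap_full:
  assumes A: "A \<in> \<C>" and f: "f \<in> full" and disj: "A \<inter> f ` A = {}"
  shows "swap A f \<in> full"
proof (rule fullI[of _ "\<lambda>x. if x \<in> A then cocycle f x else if x \<in> f ` A then cocycle (inv f) x else 0"])
  show "bij (swap A f)" using swap_comp_swap[OF f disj] o_bij by blast
  show "swap A f x = x" if "x \<notin> S" for x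
    using that clopen_subset[OF A] clopen_subset[OF clopen_full_image[OF f A]] by (auto simp: swap_def)
  show "loc_const (\<lambda>x. if x \<in> A then cocycle f x else if x \<in> f ` A then cocycle (inv f) x else 0)"
    using f A by (intro loc_const_if loc_const_mem loc_const_cocycle loc_const_const)
      (auto simp: clopen_full_image inv_full)
  show "swap A f x = T (if x \<in> A then cocycle f x else if x \<in> f ` A then cocycle (inv f) x else 0) x"
    if "x \<in> S" for x
    using that full_apply[OF f] full_apply[OF inv_full[OF f]] by (simp add: swap_def T_0)
qed

text \<open>Conjugation carries two transpositions with a common base to two with a common base.
  This makes \<open>alt_group\<close> normal and, later, the quotient commutative.\<close>

lemma swap_conj:
  assumes g: "g \<in> full" and f: "f \<in> full" and disj: "A \<inter> f ` A = {}"
  shows "g \<circ> swap A f \<circ> inv g = swap (g ` A) (g \<circ> f \<circ> inv g)" (is "?l = swap ?A ?f")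
    and "g ` A \<inter> (g \<circ> f \<circ> inv g) ` (g ` A) = {}"
proof -
  have im: "?f ` ?A = g ` f ` A" using g by (auto simp: image_image)
  show dj: "?A \<inter> ?f ` ?A = {}" unfolding im using disj full_inj[OF g] by auto
  have fg: "?f \<in> full" using f g by (intro comp_full inv_full)
  show "?l = swap ?A ?f"
  proof
    fix x
    obtain y where y: "x = g y" using full_inv(2)[OF g] by metis
    consider "y \<in> A" | z where "z \<in> A" "y = f z" | "y \<notin> A" "y \<notin> f ` A" by blast
    then show "?l x = swap ?A ?f x"
    proof cases
      case 1
      then show ?thesis using y g swap_apply(1)[OF f disj] swap_apply(1)[OF fg dj, of x] by auto
    next
      case 2
      then have "x = ?f (g z)" using y g by simp
      then show ?thesis
        using 2 y g swap_apply(2)[OF f disj, of z] swap_apply(2)[OF fg dj, of "g z"] by auto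
    next
      case 3
      then have "x \<notin> ?A" "x \<notin> ?f ` ?A" unfolding im y using full_inj[OF g] by auto
      then show ?thesis using 3 y g swap_apply(3)[OF f disj, of y] swap_apply(3)[OF fg dj, of x] by auto
    qed
  qed
qed

text \<open>The same involution seen from its other half, so that a base can be moved to its
  image.\<close>

lemma swap_inverse:
  assumes f: "f \<in> full" and disj: "A \<inter> f ` A = {}"
  shows "swap (f ` A) (inv f) = swap A f" "f ` A \<inter> inv f ` f ` A = {}"
proof -
  have im: "inv f ` f ` A = A" using f by (auto simp: image_image)
  then show "f ` A \<inter> inv f ` f ` A = {}" using disj by auto
  show "swap (f ` A) (inv f) = swap A f"
    unfolding fun_eq_iff swap_def im using disj full_bij[OF f] by (auto simp: inv_inv_eq)
qed

lemma swap_Un: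
  assumes f: "f \<in> full" and disj: "(D \<union> E) \<inter> f ` (D \<union> E) = {}" and DE: "D \<inter> E = {}"
  shows "swap (D \<union> E) f = swap D f \<circ> swap E f"
proof
  fix x
  have D: "D \<inter> f ` D = {}" and E: "E \<inter> f ` E = {}" and DfE: "D \<inter> f ` E = {}" and EfD: "E \<inter> f ` D = {}"
    and fDE: "f ` D \<inter> f ` E = {}"
    using disj DE full_inj[OF f] by auto
  consider "x \<in> D" | "x \<in> E" | y where "y \<in> D" "x = f y" | y where "y \<in> E" "x = f y"
    | "x \<notin> D \<union> E" "x \<notin> f ` (D \<union> E)"
    by blast
  then show "swap (D \<union> E) f x = (swap D f \<circ> swap E f) x"
  proof cases
    case 1
    then have "swap E f x = x" using DE DfE by (intro swap_apply(3)[OF f E]) auto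
    then show ?thesis using 1 by (simp add: swap_def)
  next
    case 2
    then have "swap D f (f x) = f x" using EfD fDE DfE by (intro swap_apply(3)[OF f D]) auto
    then show ?thesis using 2 by (simp add: swap_def)
  next
    case 3
    then have "swap E f x = x" using EfD fDE by (intro swap_apply(3)[OF f E]) auto
    then show ?thesis using 3 swap_apply(2)[OF f disj, of y] swap_apply(2)[OF f D, of y] by simp
  next
    case 4
    then have "swap D f y = y" using DE EfD by (intro swap_apply(3)[OF f D]) auto
    then show ?thesis using 4 swap_apply(2)[OF f disj, of y] swap_apply(2)[OF f E, of y] by simp
  next
    case 5
    then show ?thesis
      using swap_apply(3)[OF f disj, of x] swap_apply(3)[OF f D, of x] swap_apply(3)[OF f E, of x]
      by (simp add: image_Un)
  qed
qed

lemma swap_empty [simp]: "swap {} f = id"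
  by (auto simp: swap_def)

lemma swap_cong:
  assumes eq: "\<And>x. x \<in> A \<Longrightarrow> f x = g x" and f: "f \<in> full" and g: "g \<in> full"
  shows "swap A f = swap A g"
proof
  fix x
  have im: "f ` A = g ` A" using eq by (auto intro!: image_cong)
  have "inv f x = inv g x" if "x \<in> f ` A"
  proof -
    from that obtain a where a: "a \<in> A" "x = f a" by auto
    have "inv f (f a) = a" "inv g (g a) = a" using f g by auto
    then show ?thesis using a eq[OF a(1)] by simp
  qed
  then show "swap A f x = swap A g x" using eq by (auto simp: swap_def im)
qed


subsection \<open>Transpositions modulo products of two\<close>

definition swap_group :: "('a \<Rightarrow> 'a) set" where
  "swap_group = generated {swap A f |A f. A \<in> \<C> \<and> f \<in> full \<and> A \<inter> f ` A = {}}"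

text \<open>Each generator is a three-cycle of \<open>A\<close>, its image under \<open>h\<close>
  and its image under \<open>f\<close>, in this order; the group is an analogue of an alternating
  group inside the group of transpositions.\<close>

definition alt_group :: "('a \<Rightarrow> 'a) set" where
  "alt_group = generated {swap A f \<circ> swap A h |A f h. A \<in> \<C> \<and> f \<in> full \<and> h \<in> full \<and>
     A \<inter> f ` A = {} \<and> A \<inter> h ` A = {} \<and> f ` A \<inter> h ` A = {}}"

lemma swap_in_swap_group: "A \<in> \<C> \<Longrightarrow> f \<in> full \<Longrightarrow> A \<inter> f ` A = {} \<Longrightarrow> swap A f \<in> swap_group"
  unfolding swap_group_def by (rule generated_incl) auto

lemma double_swap_in_alt_group:
  "A \<in> \<C> \<Longrightarrow> f \<in> full \<Longrightarrow> h \<in> full \<Longrightarrow> A \<inter> f ` A = {} \<Longrightarrow> A \<inter> h ` A = {} \<Longrightarrow> f ` A \<inter> h ` A = {} \<Longrightarrow>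
   swap A f \<circ> swap A h \<in> alt_group"
  unfolding alt_group_def by (rule generated_incl) blast

lemma swap_group_full: "swap_group \<subseteq> full"
  unfolding swap_group_def by (rule generated_full) (auto intro: swap_full)

lemma swap_group_comp: "g \<in> swap_group \<Longrightarrow> h \<in> swap_group \<Longrightarrow> g \<circ> h \<in> swap_group"
  and swap_group_inv: "g \<in> swap_group \<Longrightarrow> inv g \<in> swap_group"
  and swap_group_id: "id \<in> swap_group"
  unfolding swap_group_def by (rule generated.intros; assumption)+

lemma alt_group_comp: "g \<in> alt_group \<Longrightarrow> h \<in> alt_group \<Longrightarrow> g \<circ> h \<in> alt_group"
  and alt_group_inv: "g \<in> alt_group \<Longrightarrow> inv g \<in> alt_group"
  and alt_group_id: "id \<in> alt_group"
  unfolding alt_group_def by (rule generated.intros; assumption)+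

lemma alt_subset_swap_group: "alt_group \<subseteq> swap_group"
proof -
  have "{swap A f \<circ> swap A h |A f h. A \<in> \<C> \<and> f \<in> full \<and> h \<in> full \<and>
     A \<inter> f ` A = {} \<and> A \<inter> h ` A = {} \<and> f ` A \<inter> h ` A = {}} \<subseteq> swap_group"
    by (clarify, intro swap_group_comp swap_in_swap_group)
  from generated_subset[OF this[unfolded swap_group_def]] show ?thesis
    unfolding alt_group_def swap_group_def .
qed

lemma alt_group_full: "alt_group \<subseteq> full"
  using alt_subset_swap_group swap_group_full by blast

lemma alt_group_normal:
  assumes g: "g \<in> full" and "x \<in> alt_group"
  shows "g \<circ> x \<circ> inv g \<in> alt_group"
  using assms(2) unfolding alt_group_def
proof induction
  case generated_id
  have "g \<circ> id \<circ> inv g = id" using g by (simp add: fun_eq_iff)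
  then show ?case by (simp only: generated.generated_id)
next
  case (generated_incl x)
  then obtain A f h where x: "x = swap A f \<circ> swap A h" and A: "A \<in> \<C>" and f: "f \<in> full" and h: "h \<in> full"
    and d: "A \<inter> f ` A = {}" "A \<inter> h ` A = {}" "f ` A \<inter> h ` A = {}" by auto
  have eq: "g \<circ> x \<circ> inv g = (g \<circ> swap A f \<circ> inv g) \<circ> (g \<circ> swap A h \<circ> inv g)"
    unfolding x using g by (simp add: fun_eq_iff)
  have im: "(g \<circ> k \<circ> inv g) ` g ` A = g ` k ` A" for k using g by (auto simp: image_image)
  have "swap (g ` A) (g \<circ> f \<circ> inv g) \<circ> swap (g ` A) (g \<circ> h \<circ> inv g) \<in> alt_group"
  proof (rule double_swap_in_alt_group)
    show "(g \<circ> f \<circ> inv g) ` g ` A \<inter> (g \<circ> h \<circ> inv g) ` g ` A = {}"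
      unfolding im using d(3) full_inj[OF g] by auto
  qed (use swap_conj(2)[OF g f d(1)] swap_conj(2)[OF g h d(2)] f g h A
       in \<open>auto intro: comp_full inv_full clopen_full_image\<close>)
  then show ?case unfolding eq swap_conj(1)[OF g f d(1)] swap_conj(1)[OF g h d(2)] alt_group_def .
next
  case (generated_comp x y)
  have "g \<circ> (x \<circ> y) \<circ> inv g = (g \<circ> x \<circ> inv g) \<circ> (g \<circ> y \<circ> inv g)"
    using g by (simp add: fun_eq_iff)
  then show ?case using generated.generated_comp[OF generated_comp.IH] by (simp only:)
next
  case (generated_inv x)
  have x: "x \<in> full" using generated_inv.hyps alt_group_full unfolding alt_group_def by blast
  have "inv (g \<circ> x \<circ> inv g) = g \<circ> inv x \<circ> inv g"
    by (rule inv_unique_comp) (use g x in \<open>auto simp: fun_eq_iff\<close>)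
  then show ?case using generated.generated_inv[OF generated_inv.IH] by (simp only:)
qed

text \<open>Equality in the quotient of \<open>full\<close> by the normal subgroup
  \<open>alt_group\<close>. Membership in \<open>full\<close> is built in so that chains of
  equivalences carry it along.\<close>

definition alt_equiv :: "('a \<Rightarrow> 'a) \<Rightarrow> ('a \<Rightarrow> 'a) \<Rightarrow> bool" (infix "\<doteq>" 50) where
  "x \<doteq> y \<longleftrightarrow> x \<in> full \<and> y \<in> full \<and> (\<exists>n\<in>alt_group. x = n \<circ> y)"

lemma alt_equiv_refl: "x \<in> full \<Longrightarrow> x \<doteq> x"
  unfolding alt_equiv_def using alt_group_id by (auto intro!: bexI[of _ id])

lemma alt_equiv_sym: "x \<doteq> y \<Longrightarrow> y \<doteq> x"
proof -
  assume "x \<doteq> y"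
  then obtain n where n: "x \<in> full" "y \<in> full" "n \<in> alt_group" "x = n \<circ> y" by (auto simp: alt_equiv_def)
  have "n \<in> full" using n(3) alt_group_full by blast
  then have "y = inv n \<circ> x" unfolding n(4) by (simp add: fun_eq_iff)
  then show ?thesis using n alt_group_inv by (auto simp: alt_equiv_def)
qed

lemma alt_equiv_trans [trans]: "x \<doteq> y \<Longrightarrow> y \<doteq> z \<Longrightarrow> x \<doteq> z"
  unfolding alt_equiv_def by (metis alt_group_comp comp_assoc)

lemma alt_equiv_comp:
  assumes "x \<doteq> y" "u \<doteq> v"
  shows "x \<circ> u \<doteq> y \<circ> v"
proof -
  obtain n m where n: "n \<in> alt_group" "x = n \<circ> y" and m: "m \<in> alt_group" "u = m \<circ> v"
    and full: "x \<in> full" "y \<in> full" "u \<in> full" "v \<in> full"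
    using assms by (auto simp: alt_equiv_def)
  have "x \<circ> u = (n \<circ> (y \<circ> m \<circ> inv y)) \<circ> (y \<circ> v)"
    unfolding n(2) m(2) using full(2) by (simp add: fun_eq_iff)
  moreover have "n \<circ> (y \<circ> m \<circ> inv y) \<in> alt_group"
    using alt_group_comp[OF n(1) alt_group_normal[OF full(2) m(1)]] .
  ultimately show ?thesis unfolding alt_equiv_def using comp_full full by blast
qed

lemma alt_equiv_full: "x \<doteq> y \<Longrightarrow> x \<in> full" "x \<doteq> y \<Longrightarrow> y \<in> full"
  by (auto simp: alt_equiv_def)

lemma swap_equiv_disjoint:
  assumes "A \<in> \<C>" "f \<in> full" "h \<in> full" "A \<inter> f ` A = {}" "A \<inter> h ` A = {}" "f ` A \<inter> h ` A = {}"
  shows "swap A f \<doteq> swap A h"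
proof -
  have "swap A f = (swap A f \<circ> swap A h) \<circ> swap A h"
    using swap_swap[of h A] assms by (simp add: fun_eq_iff)
  then show ?thesis unfolding alt_equiv_def
    using double_swap_in_alt_group[OF assms] swap_full assms by blast
qed

text \<open>The images of \<open>A\<close> under \<open>f\<close> and \<open>h\<close> may overlap,
  so the two are not comparable by a single generator. Over a small piece, where \<open>f\<close>
  and \<open>h\<close> are powers, both are compared with a power that carries the piece away from
  all three sets.\<close>

lemma swap_equiv:
  assumes A: "A \<in> \<C>" and f: "f \<in> full" and h: "h \<in> full"
    and df: "A \<inter> f ` A = {}" and dh: "A \<inter> h ` A = {}"
  shows "swap A f \<doteq> swap A h"
proof -
  have "D \<subseteq> A \<longrightarrow> swap D f \<doteq> swap D h" if "D \<in> \<C>" for D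
    using that
  proof (induction rule: clopen_induct)
    case (local x)
    show ?case
    proof (cases "x \<in> A")
      case False
      have "swap D f \<doteq> swap D h" if "D \<subseteq> S - A" "D \<subseteq> A" for D
      proof -
        have "D = {}" using that by auto
        then show ?thesis by (simp only: swap_empty alt_equiv_refl[OF id_full])
      qed
      then show ?thesis using False local clopen_compl[OF A] by blast
    next
      case True
      obtain B1 a where B1: "B1 \<in> \<C>" "x \<in> B1" "\<And>y. y \<in> B1 \<Longrightarrow> cocycle f y = a"
        using loc_constE[OF loc_const_cocycle[OF f] local] by metis
      obtain B2 b where B2: "B2 \<in> \<C>" "x \<in> B2" "\<And>y. y \<in> B2 \<Longrightarrow> cocycle h y = b"
        using loc_constE[OF loc_const_cocycle[OF h] local] by metis
      \<comment> \<open>Large enough that \<open>k\<close>, \<open>k - a\<close> and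
        \<open>k - b\<close> are all nonzero.\<close>
      define k where "k = 1 + \<bar>a\<bar> + \<bar>b\<bar>"
      obtain B3 where B3: "B3 \<in> \<C>" "x \<in> B3" "\<And>j. j \<in> {k, k - a, k - b} \<Longrightarrow> T j ` B3 \<inter> B3 = {}"
        by (rule small_neighbourhood[OF local, of "{k, k - a, k - b}"]) (auto simp: k_def)
      have main: "swap D f \<doteq> swap D h" if D: "D \<in> \<C>" "D \<subseteq> B1 \<inter> B2 \<inter> B3" "D \<subseteq> A" for D
      proof -
        have DS: "D \<subseteq> S" using clopen_subset[OF D(1)] .
        have fD: "f y = T a y" and hD: "h y = T b y" if "y \<in> D" for y
          using that D(2) DS full_apply[OF f, of y] full_apply[OF h, of y] B1(3)[of y] B2(3)[of y] by auto
        have fim: "f ` D = T a ` D" and him: "h ` D = T b ` D" using fD hD by (auto intro!: image_cong)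
        have dk: "T j ` D \<inter> D = {}" if "j \<in> {k, k - a, k - b}" for j
          using B3(3)[OF that] D(2) by blast
        have 1: "D \<inter> T k ` D = {}" using dk[of k] by auto
        have shift: "T i ` D \<inter> T k ` D = {}" if "T (k - i) ` D \<inter> D = {}" for i
        proof (rule ccontr)
          assume "T i ` D \<inter> T k ` D \<noteq> {}"
          then obtain y z where "y \<in> D" "z \<in> D" "T i y = T k z" by blast
          then show False using that T_eqD[of k z i y] by auto
        qed
        have 2: "T a ` D \<inter> T k ` D = {}" "T b ` D \<inter> T k ` D = {}"
          using shift dk[of "k - a"] dk[of "k - b"] by auto
        have dD: "D \<inter> f ` D = {}" "D \<inter> h ` D = {}" using D(3) df dh by blast+
        have "swap D f \<doteq> swap D (T k)"
          by (rule swap_equiv_disjoint[OF D(1) f T_full dD(1) 1 2(1)[folded fim]])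
        moreover have "swap D h \<doteq> swap D (T k)"
          by (rule swap_equiv_disjoint[OF D(1) h T_full dD(2) 1 2(2)[folded him]])
        ultimately show ?thesis using alt_equiv_trans alt_equiv_sym by blast
      qed
      show ?thesis
      proof (intro bexI[of _ "B1 \<inter> B2 \<inter> B3"] conjI ballI impI)
        show "x \<in> B1 \<inter> B2 \<inter> B3" using B1(2) B2(2) B3(2) by simp
        show "B1 \<inter> B2 \<inter> B3 \<in> \<C>" using B1(1) B2(1) B3(1) by (intro clopen_Int)
      qed (rule main)
    qed
  next
    case (Un D E)
    show ?case
    proof
      assume sub: "D \<union> E \<subseteq> A"
      have "swap (D \<union> E) f = swap D f \<circ> swap E f" "swap (D \<union> E) h = swap D h \<circ> swap E h"
        using Un sub df dh by (intro swap_Un[OF f] swap_Un[OF h]; blast)+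
      then show "swap (D \<union> E) f \<doteq> swap (D \<union> E) h" using Un sub alt_equiv_comp by simp
    qed
  qed
  then show ?thesis using A by simp
qed

text \<open>Where \<open>g\<close> is a nonzero power, a small \<open>D\<close> is disjoint from its
  image under \<open>g\<close>. The transposition along \<open>g\<close> has both sets as bases by
  \<open>swap_inverse\<close>, and \<open>swap_equiv\<close> changes the function on either
  side.\<close>

lemma swap_equiv_image:
  assumes A: "A \<in> \<C>" and f: "f \<in> full" and h: "h \<in> full" and g: "g \<in> full"
    and df: "A \<inter> f ` A = {}" and dh: "g ` A \<inter> h ` g ` A = {}"
  shows "swap A f \<doteq> swap (g ` A) h"
proof -
  have "D \<subseteq> A \<longrightarrow> swap D f \<doteq> swap (g ` D) h" if "D \<in> \<C>" for D
    using that
  proof (induction rule: clopen_induct)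
    case (local x)
    obtain B1 a where B1: "B1 \<in> \<C>" "x \<in> B1" "\<And>y. y \<in> B1 \<Longrightarrow> cocycle g y = a"
      using loc_constE[OF loc_const_cocycle[OF g] local] by metis
    obtain B2 where B2: "B2 \<in> \<C>" "x \<in> B2" "\<And>j. j \<in> {a} - {0} \<Longrightarrow> T j ` B2 \<inter> B2 = {}"
      by (rule small_neighbourhood[OF local, of "{a} - {0}"]) auto
    have main: "swap D f \<doteq> swap (g ` D) h" if D: "D \<in> \<C>" "D \<subseteq> B1 \<inter> B2" "D \<subseteq> A" for D
    proof -
      have "g y = T a y" if "y \<in> D" for y
        using that D(2) clopen_subset[OF D(1)] full_apply[OF g, of y] B1(3)[of y] by auto
      then have gD: "g ` D = T a ` D" by (auto intro!: image_cong)
      have dfD: "D \<inter> f ` D = {}" and dhD: "g ` D \<inter> h ` g ` D = {}" using D df dh by blast+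
      show ?thesis
      proof (cases "a = 0")
        case True
        then have "g ` D = D" using gD by simp
        then show ?thesis using swap_equiv[of D f h] D(1) f h dfD dhD by simp
      next
        case False
        then have dg: "D \<inter> g ` D = {}" using B2(3)[of a] D(2) unfolding gD by blast
        have 1: "swap D f \<doteq> swap D g" using swap_equiv[OF D(1) f g dfD dg] .
        have "swap (g ` D) (inv g) \<doteq> swap (g ` D) h"
          using swap_equiv[OF clopen_full_image[OF g D(1)] inv_full[OF g] h swap_inverse(2)[OF g dg] dhD] .
        then show ?thesis using alt_equiv_trans[OF 1] by (simp only: swap_inverse(1)[OF g dg])
      qed
    qed
    show ?case
    proof (intro bexI[of _ "B1 \<inter> B2"] conjI ballI impI)
      show "x \<in> B1 \<inter> B2" using B1(2) B2(2) by simp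
      show "B1 \<inter> B2 \<in> \<C>" using B1(1) B2(1) by (rule clopen_Int)
    qed (rule main)
  next
    case (Un D E)
    show ?case
    proof
      assume sub: "D \<union> E \<subseteq> A"
      have "swap (D \<union> E) f = swap D f \<circ> swap E f"
        using Un sub df by (intro swap_Un[OF f]) blast+
      moreover have "swap (g ` D \<union> g ` E) h = swap (g ` D) h \<circ> swap (g ` E) h"
      proof (rule swap_Un[OF h])
        show "(g ` D \<union> g ` E) \<inter> h ` (g ` D \<union> g ` E) = {}" using sub dh by blast
        show "g ` D \<inter> g ` E = {}" using Un full_inj[OF g] by auto
      qed
      ultimately show "swap (D \<union> E) f \<doteq> swap (g ` (D \<union> E)) h" using Un sub alt_equiv_comp
        by (simp add: image_Un)
    qed
  qed
  then show ?thesis using A by simp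
qed

text \<open>Conjugating one transposition by the other only transports its base, which does not
  change the class. Hence the quotient is commutative.\<close>

lemma swap_equiv_commute:
  assumes A: "A \<in> \<C>" "f \<in> full" "A \<inter> f ` A = {}" and B: "B \<in> \<C>" "h \<in> full" "B \<inter> h ` B = {}"
  shows "swap A f \<circ> swap B h \<doteq> swap B h \<circ> swap A f"
proof -
  define t where "t = swap A f"
  have t: "t \<in> full" using swap_full A by (simp add: t_def)
  have u: "swap B h \<in> full" using swap_full B by simp
  have "t \<circ> swap B h = (t \<circ> swap B h \<circ> inv t) \<circ> t" using t by (simp add: fun_eq_iff)
  then have eq: "t \<circ> swap B h = swap (t ` B) (t \<circ> h \<circ> inv t) \<circ> t" by (simp only: swap_conj(1)[OF t B(2,3)])
  have "swap (t ` B) (t \<circ> h \<circ> inv t) \<circ> t \<doteq> swap B h \<circ> t"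
    by (intro alt_equiv_comp alt_equiv_refl t alt_equiv_sym[OF swap_equiv_image])
      (use swap_conj(2)[OF t B(2,3)] B t in \<open>auto intro!: comp_full inv_full\<close>)
  then show ?thesis unfolding t_def[symmetric] eq .
qed

text \<open>\<open>U\<close> may meet its translate, and then there is no transposition of
  \<open>U\<close> along \<open>T 1\<close>; its class is represented by a product over the pieces
  of a partition into sets disjoint from their translates.\<close>

fun swap_prod :: "(nat \<Rightarrow> 'a set) \<Rightarrow> nat \<Rightarrow> 'a set \<Rightarrow> 'a \<Rightarrow> 'a" where
  "swap_prod P 0 U = id"
| "swap_prod P (Suc m) U = swap (U \<inter> P m) (T 1) \<circ> swap_prod P m U"

definition small_pieces :: "(nat \<Rightarrow> 'a set) \<Rightarrow> bool" where
  "small_pieces P \<longleftrightarrow> (\<forall>i. P i \<in> \<C> \<and> P i \<inter> T 1 ` P i = {}) \<and> (\<forall>i j. i \<noteq> j \<longrightarrow> P i \<inter> P j = {})"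

lemma small_partition: obtains P m where "small_pieces P" "S = (\<Union>i<m. P i)"
proof -
  have loc: "\<exists>B\<in>\<C>. x \<in> B \<and> B \<inter> T 1 ` B = {}" if x: "x \<in> S" for x
    by (rule small_neighbourhood[OF x, of "{1}"]) auto
  have mono: "B \<inter> T 1 ` B = {} \<Longrightarrow> D \<subseteq> B \<Longrightarrow> D \<inter> T 1 ` D = {}" for B D by blast
  obtain m and P :: "nat \<Rightarrow> 'a set" where P: "\<And>i. P i \<in> \<C>" "\<And>i. i < m \<Longrightarrow> P i \<inter> T 1 ` P i = {}"
    "\<And>i j. i \<noteq> j \<Longrightarrow> P i \<inter> P j = {}" "S = (\<Union>i<m. P i)"
    by (rule clopen_partition[where Q="\<lambda>B. B \<inter> T 1 ` B = {}", OF loc mono]) (assumption+, rule that)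
  show ?thesis
  \<comment> \<open>The pieces beyond \<open>m\<close> are emptied because
    \<open>small_pieces\<close> speaks of every index, whereas smallness is known only below
    \<open>m\<close>.\<close>
  proof (rule that[of "\<lambda>i. if i < m then P i else {}" m])
    show "small_pieces (\<lambda>i. if i < m then P i else {})"
      using P unfolding small_pieces_def by (simp add: clopen_empty)
  qed (use P in auto)
qed

context
  fixes P assumes P: "small_pieces P"
begin

lemma piece_swap: "U \<in> \<C> \<Longrightarrow> U \<inter> P i \<in> \<C>" "(U \<inter> P i) \<inter> T 1 ` (U \<inter> P i) = {}"
proof -
  from P have P': "P i \<in> \<C>" "P i \<inter> T 1 ` P i = {}" unfolding small_pieces_def by blast+
  show "U \<inter> P i \<in> \<C>" if "U \<in> \<C>" by (rule clopen_Int[OF that P'(1)])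
  show "(U \<inter> P i) \<inter> T 1 ` (U \<inter> P i) = {}" using P'(2) by auto
qed

lemma piece_disjoint: "i \<noteq> j \<Longrightarrow> P i \<inter> P j = {}"
  using P by (simp add: small_pieces_def)

lemma piece_small: "D \<subseteq> P i \<Longrightarrow> D \<inter> T 1 ` D = {}"
proof -
  have "P i \<inter> T 1 ` P i = {}" using P by (simp add: small_pieces_def)
  then show "D \<subseteq> P i \<Longrightarrow> D \<inter> T 1 ` D = {}" by blast
qed

lemma piece_swap_full: "U \<in> \<C> \<Longrightarrow> swap (U \<inter> P i) (T 1) \<in> full"
  by (rule swap_full[OF piece_swap(1) T_full piece_swap(2)])

lemma swap_prod_swap_group: "U \<in> \<C> \<Longrightarrow> swap_prod P m U \<in> swap_group"
proof (induction m)
  case 0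
  then show ?case by (simp only: swap_prod.simps swap_group_id)
next
  case (Suc m)
  then show ?case
    unfolding swap_prod.simps by (intro swap_group_comp swap_in_swap_group piece_swap T_full)
qed

lemma swap_prod_full: "U \<in> \<C> \<Longrightarrow> swap_prod P m U \<in> full"
  using swap_prod_swap_group swap_group_full by blast

lemma swap_prod_commute:
  assumes "A \<in> \<C>" "f \<in> full" "A \<inter> f ` A = {}" "U \<in> \<C>"
  shows "swap A f \<circ> swap_prod P m U \<doteq> swap_prod P m U \<circ> swap A f"
proof (induction m)
  case 0
  then show ?case using alt_equiv_refl[OF swap_full[OF assms(1-3)]] by (simp only: swap_prod.simps comp_id id_comp)
next
  case (Suc m)
  let ?s = "swap (U \<inter> P m) (T 1)"
  have s: "?s \<in> full" using assms(4) by (rule piece_swap_full)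
  have 1: "(swap A f \<circ> ?s) \<circ> swap_prod P m U \<doteq> (?s \<circ> swap A f) \<circ> swap_prod P m U"
    by (rule alt_equiv_comp[OF swap_equiv_commute[OF assms(1-3) piece_swap(1)[OF assms(4)] T_full piece_swap(2)]
          alt_equiv_refl[OF swap_prod_full[OF assms(4)]]])
  have 2: "?s \<circ> (swap A f \<circ> swap_prod P m U) \<doteq> ?s \<circ> (swap_prod P m U \<circ> swap A f)"
    by (rule alt_equiv_comp[OF alt_equiv_refl[OF s] Suc.IH])
  show ?case using alt_equiv_trans[OF 1[unfolded comp_assoc] 2] by (simp only: swap_prod.simps comp_assoc)
qed

text \<open>Inside one piece the transpositions along \<open>T 1\<close> act on disjoint pairs of
  points, so where \<open>U\<close> and \<open>V\<close> overlap they cancel. Here equality is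
  exact; over several pieces it holds only modulo \<open>alt_group\<close>.\<close>

lemma piece_swap_sym_diff:
  assumes U: "U \<in> \<C>" and V: "V \<in> \<C>"
  shows "swap ((U \<triangle> V) \<inter> P i) (T 1) = swap (U \<inter> P i) (T 1) \<circ> swap (V \<inter> P i) (T 1)"
proof
  fix x
  have d: "P i \<inter> T 1 ` P i = {}" using P by (auto simp: small_pieces_def)
  have *: "T 1 y \<notin> P i" if "y \<in> P i" for y using d that by auto
  have **: "T (-1) y \<notin> P i" if "y \<in> P i" for y using *[of "T (-1) y"] that by auto
  consider "x \<in> P i" | "T (-1) x \<in> P i" "x \<notin> P i" | "x \<notin> P i" "T (-1) x \<notin> P i" by blast
  then show "swap ((U \<triangle> V) \<inter> P i) (T 1) x = (swap (U \<inter> P i) (T 1) \<circ> swap (V \<inter> P i) (T 1)) x"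
  proof cases
    case 1
    then show ?thesis using *[of x] **[of x] by (simp add: swap_def inv_T mem_T_image)
  next
    case 2
    then show ?thesis using **[of "T (-1) x"] by (simp add: swap_def inv_T mem_T_image)
  next
    case 3
    then show ?thesis by (simp add: swap_def inv_T mem_T_image)
  qed
qed

text \<open>Makes the class of \<open>swap_prod\<close> additive from clopen sets modulo two to the
  quotient; commutativity of the quotient reorders the factors piece by piece.\<close>

lemma swap_prod_sym_diff:
  assumes U: "U \<in> \<C>" and V: "V \<in> \<C>"
  shows "swap_prod P m (U \<triangle> V) \<doteq> swap_prod P m U \<circ> swap_prod P m V"
proof (induction m)
  case 0
  then show ?case using alt_equiv_refl[OF id_full] by (simp only: swap_prod.simps comp_id)
next
  case (Suc m)
  let ?u = "swap (U \<inter> P m) (T 1)" and ?v = "swap (V \<inter> P m) (T 1)"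
  let ?su = "swap_prod P m U" and ?sv = "swap_prod P m V"
  have f: "?u \<in> full" "?v \<in> full" "?su \<in> full" "?sv \<in> full"
    by (rule piece_swap_full[OF U] piece_swap_full[OF V] swap_prod_full[OF U] swap_prod_full[OF V])+
  have 1: "(?u \<circ> ?v) \<circ> swap_prod P m (U \<triangle> V) \<doteq> (?u \<circ> ?v) \<circ> (?su \<circ> ?sv)"
    by (rule alt_equiv_comp[OF alt_equiv_refl[OF comp_full[OF f(1,2)]] Suc.IH])
  have 2: "?u \<circ> (?v \<circ> ?su) \<circ> ?sv \<doteq> ?u \<circ> (?su \<circ> ?v) \<circ> ?sv"
    by (rule alt_equiv_comp[OF alt_equiv_comp[OF alt_equiv_refl[OF f(1)]
          swap_prod_commute[OF piece_swap(1)[OF V] T_full piece_swap(2) U]] alt_equiv_refl[OF f(4)]])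
  show ?case using alt_equiv_trans[OF 1[unfolded comp_assoc] 2[unfolded comp_assoc]]
    by (simp only: swap_prod.simps comp_assoc piece_swap_sym_diff[OF U V])
qed

lemma swap_prod_empty: "swap_prod P m {} = id"
  by (induction m) simp_all

lemma swap_prod_piece:
  assumes "D \<subseteq> P i" "i < m"
  shows "swap_prod P m D = swap D (T 1)"
  using assms(2)
proof (induction m)
  case (Suc m)
  show ?case
  proof (cases "i = m")
    case True
    have "swap_prod P j D = id" if "j \<le> m" for j
      using that
    proof (induction j)
      case (Suc j)
      then have "D \<inter> P j = {}" using assms(1) piece_disjoint[of i j] True by auto
      then show ?case using Suc by simp
    qed simp
    then show ?thesis using True assms by (simp add: Int_absorb2)
  next
    case False
    then have "D \<inter> P m = {}" using assms(1) piece_disjoint[of i m] by auto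
    then show ?thesis using Suc False by simp
  qed
qed simp

context
  fixes m assumes cover: "S = (\<Union>i<m. P i)"
begin

lemma piece_obtain:
  assumes "x \<in> S" obtains i where "i < m" "x \<in> P i" "P i \<in> \<C>"
proof -
  from assms cover obtain i where "i < m" "x \<in> P i" by auto
  moreover have "P i \<in> \<C>" using P by (simp add: small_pieces_def)
  ultimately show ?thesis using that by blast
qed

lemma swap_prod_Un:
  assumes "D \<in> \<C>" "E \<in> \<C>" "D \<inter> E = {}"
  shows "swap_prod P m (D \<union> E) \<doteq> swap_prod P m D \<circ> swap_prod P m E"
proof -
  have "D \<union> E = D \<triangle> E" using assms(3) by auto
  then show ?thesis using swap_prod_sym_diff assms by simp
qed

text \<open>Additivity in the base reduces the claim to subsets of one piece. There the product is
  the single transposition along \<open>T 1\<close>, and only the function has to be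
  exchanged.\<close>

lemma swap_equiv_swap_prod:
  assumes A: "A \<in> \<C>" and f: "f \<in> full" and df: "A \<inter> f ` A = {}"
  shows "swap A f \<doteq> swap_prod P m A"
proof -
  have "D \<subseteq> A \<longrightarrow> swap D f \<doteq> swap_prod P m D" if "D \<in> \<C>" for D
    using that
  proof (induction rule: clopen_induct)
    case (local x)
    obtain i where i: "i < m" "x \<in> P i" "P i \<in> \<C>" using piece_obtain[OF local] .
    have "swap D f \<doteq> swap_prod P m D" if D: "D \<in> \<C>" "D \<subseteq> P i" "D \<subseteq> A" for D
    proof -
      have "D \<inter> T 1 ` D = {}" using D(2) by (rule piece_small)
      moreover have "D \<inter> f ` D = {}" using D df by blast
      ultimately show ?thesis
        unfolding swap_prod_piece[OF D(2) i(1)] using D f T_full by (intro swap_equiv)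
    qed
    then show ?case using i by blast
  next
    case (Un D E)
    show ?case
    proof
      assume sub: "D \<union> E \<subseteq> A"
      have eq: "swap (D \<union> E) f = swap D f \<circ> swap E f"
        using Un sub df by (intro swap_Un[OF f]) blast+
      have "swap D f \<circ> swap E f \<doteq> swap_prod P m D \<circ> swap_prod P m E" using Un sub alt_equiv_comp by simp
      also have "\<dots> \<doteq> swap_prod P m (D \<union> E)" using Un by (intro alt_equiv_sym[OF swap_prod_Un])
      finally show "swap (D \<union> E) f \<doteq> swap_prod P m (D \<union> E)" unfolding eq .
    qed
  qed
  then show ?thesis using A by simp
qed

text \<open>This is where coboundaries die. On a piece both sides are single transpositions up to
  equivalence, and the base is transported by \<open>T 1\<close>.\<close>

lemma swap_prod_T:
  assumes "A \<in> \<C>"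
  shows "swap_prod P m (T 1 ` A) \<doteq> swap_prod P m A"
  using assms
proof (induction rule: clopen_induct)
  case (local x)
  obtain i where i: "i < m" "x \<in> P i" "P i \<in> \<C>" using piece_obtain[OF local] .
  have "swap_prod P m (T 1 ` D) \<doteq> swap_prod P m D" if D: "D \<in> \<C>" "D \<subseteq> P i" for D
  proof -
    have d: "D \<inter> T 1 ` D = {}" using D(2) by (rule piece_small)
    then have dT: "T 1 ` D \<inter> T 1 ` T 1 ` D = {}" by auto
    have "swap_prod P m (T 1 ` D) \<doteq> swap (T 1 ` D) (T 1)"
      by (intro alt_equiv_sym[OF swap_equiv_swap_prod] clopen_T D T_full dT)
    also have "\<dots> \<doteq> swap D (T 1)"
      by (intro alt_equiv_sym[OF swap_equiv_image] D T_full dT d)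
    finally show ?thesis by (simp only: swap_prod_piece[OF D(2) i(1)])
  qed
  then show ?case using i by blast
next
  case (Un D E)
  have "T 1 ` D \<inter> T 1 ` E = {}" using Un by auto
  then have "swap_prod P m (T 1 ` D \<union> T 1 ` E) \<doteq> swap_prod P m (T 1 ` D) \<circ> swap_prod P m (T 1 ` E)"
    using Un clopen_T by (intro swap_prod_Un)
  also have "\<dots> \<doteq> swap_prod P m D \<circ> swap_prod P m E" using Un by (intro alt_equiv_comp)
  also have "\<dots> \<doteq> swap_prod P m (D \<union> E)" using Un by (intro alt_equiv_sym[OF swap_prod_Un])
  finally show ?case by (simp only: image_Un)
qed

lemma swap_prod_self_inverse:
  assumes "U \<in> \<C>" shows "swap_prod P m U \<circ> swap_prod P m U \<doteq> id"
  using alt_equiv_sym[OF swap_prod_sym_diff[OF assms assms, of m]] by (simp only: sym_diff_self swap_prod_empty)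

lemma swap_group_equiv_swap_prod:
  assumes "t \<in> swap_group" shows "\<exists>U\<in>\<C>. t \<doteq> swap_prod P m U"
  using assms unfolding swap_group_def
proof induction
  case generated_id
  show ?case using clopen_empty alt_equiv_refl[OF id_full] by (intro bexI[of _ "{}"]) (simp_all only: swap_prod_empty)
next
  case (generated_incl g)
  then show ?case using swap_equiv_swap_prod by blast
next
  case (generated_comp g h)
  then obtain U V where U: "U \<in> \<C>" "g \<doteq> swap_prod P m U" and V: "V \<in> \<C>" "h \<doteq> swap_prod P m V" by blast
  have "g \<circ> h \<doteq> swap_prod P m U \<circ> swap_prod P m V" using U V by (intro alt_equiv_comp)
  also have "\<dots> \<doteq> swap_prod P m (U \<triangle> V)" using U V by (intro alt_equiv_sym[OF swap_prod_sym_diff])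
  finally show ?case using clopen_sym_diff[OF U(1) V(1)] by blast
next
  case (generated_inv g)
  then obtain U where U: "U \<in> \<C>" "g \<doteq> swap_prod P m U" by blast
  let ?s = "swap_prod P m U"
  have g: "g \<in> full" and s: "?s \<in> full" using U alt_equiv_full by blast+
  \<comment> \<open>Squares of the products are trivial in the quotient, so the set \<open>U\<close>
    that serves for \<open>g\<close> also serves for its inverse.\<close>
  have 1: "inv g \<circ> id \<doteq> inv g \<circ> (?s \<circ> ?s)"
    by (rule alt_equiv_comp[OF alt_equiv_refl[OF inv_full[OF g]] alt_equiv_sym[OF swap_prod_self_inverse[OF U(1)]]])
  have 2: "(inv g \<circ> ?s) \<circ> ?s \<doteq> (inv g \<circ> g) \<circ> ?s"
    by (rule alt_equiv_comp[OF alt_equiv_comp[OF alt_equiv_refl[OF inv_full[OF g]] alt_equiv_sym[OF U(2)]] alt_equiv_refl[OF s]])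
  have 3: "inv g \<circ> g = id" using g by (simp add: fun_eq_iff)
  have "inv g \<doteq> ?s" using alt_equiv_trans[OF 1[unfolded comp_assoc comp_id] 2[unfolded 3 id_comp comp_assoc]] .
  then show ?case using U by blast
qed

end

end

text \<open>Equality of the indicator functions of \<open>U\<close> and \<open>V\<close> in K^0
  modulo two: signs vanish, and the coboundary of the indicator of \<open>W\<close> becomes the
  symmetric difference of \<open>W\<close> and its translate.\<close>

definition cohomologous :: "'a set \<Rightarrow> 'a set \<Rightarrow> bool" where
  "cohomologous U V \<longleftrightarrow> (\<exists>W\<in>\<C>. U \<triangle> V = W \<triangle> T 1 ` W)"

definition finite_classes :: bool where
  "finite_classes \<longleftrightarrow> (\<exists>\<U>\<subseteq>\<C>. finite \<U> \<and> (\<forall>U\<in>\<C>. \<exists>V\<in>\<U>. cohomologous U V))"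

text \<open>A coboundary contributes the square of the product for \<open>W\<close>, which is
  trivial, so one product for each of finitely many representatives suffices.\<close>

lemma swap_group_finite_extension:
  assumes "finite_classes"
  obtains F where "finite F" "F \<subseteq> swap_group" "swap_group = generated (alt_group \<union> F)"
proof -
  obtain \<U> where \<U>: "\<U> \<subseteq> \<C>" "finite \<U>" "\<And>U. U \<in> \<C> \<Longrightarrow> \<exists>V\<in>\<U>. cohomologous U V"
    using assms by (auto simp: finite_classes_def)
  obtain P m where P: "small_pieces P" and cover: "S = (\<Union>i<m. P i)" using small_partition .
  let ?s = "swap_prod P m"
  have F: "?s ` \<U> \<subseteq> swap_group" using swap_prod_swap_group[OF P] \<U> by blast
  have "t \<in> generated (alt_group \<union> ?s ` \<U>)" if t: "t \<in> swap_group" for t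
  proof -
    obtain U where U: "U \<in> \<C>" "t \<doteq> ?s U" using swap_group_equiv_swap_prod[OF P cover t] by blast
    obtain V W where V: "V \<in> \<U>" "V \<in> \<C>" and W: "W \<in> \<C>" "U \<triangle> V = W \<triangle> T 1 ` W"
      using \<U>(3)[OF U(1)] \<U>(1) unfolding cohomologous_def by blast
    have UV: "U = (W \<triangle> T 1 ` W) \<triangle> V" unfolding W(2)[symmetric] by auto
    have TW: "T 1 ` W \<in> \<C>" using clopen_T[OF W(1)] .
    note U(2)
    also have "?s U \<doteq> ?s (W \<triangle> T 1 ` W) \<circ> ?s V"
      by (subst UV) (rule swap_prod_sym_diff[OF P clopen_sym_diff[OF W(1) TW] V(2)])
    also have "\<dots> \<doteq> (?s W \<circ> ?s (T 1 ` W)) \<circ> ?s V"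
      by (rule alt_equiv_comp[OF swap_prod_sym_diff[OF P W(1) TW] alt_equiv_refl[OF swap_prod_full[OF P V(2)]]])
    also have "\<dots> \<doteq> (?s W \<circ> ?s W) \<circ> ?s V"
      by (rule alt_equiv_comp[OF alt_equiv_comp[OF alt_equiv_refl[OF swap_prod_full[OF P W(1)]]
            swap_prod_T[OF P cover W(1)]] alt_equiv_refl[OF swap_prod_full[OF P V(2)]]])
    also have "\<dots> \<doteq> id \<circ> ?s V"
      by (rule alt_equiv_comp[OF swap_prod_self_inverse[OF P cover W(1)] alt_equiv_refl[OF swap_prod_full[OF P V(2)]]])
    finally obtain n where "n \<in> alt_group" "t = n \<circ> ?s V" by (auto simp: alt_equiv_def)
    then show ?thesis using V by (auto intro!: generated.generated_comp intro: generated.generated_incl)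
  qed
  moreover have "generated (alt_group \<union> ?s ` \<U>) \<subseteq> swap_group"
    unfolding swap_group_def
    by (rule generated_subset, fold swap_group_def) (use F alt_subset_swap_group in auto)
  ultimately show ?thesis using that[of "?s ` \<U>"] F \<U>(2) by blast
qed


subsection \<open>Finite generation of the alternating part\<close>

text \<open>The indices name levels of a tower with base \<open>W\<close>; the formula is meant for
  pairwise disjoint levels, as \<open>levels3\<close> demands.\<close>

definition cyc :: "'a set \<Rightarrow> int \<Rightarrow> int \<Rightarrow> int \<Rightarrow> 'a \<Rightarrow> 'a" where
  "cyc W i j k x = (if x \<in> T i ` W then T (j - i) x else if x \<in> T j ` W then T (k - j) x
     else if x \<in> T k ` W then T (i - k) x else x)"

definition levels3 :: "'a set \<Rightarrow> int \<Rightarrow> int \<Rightarrow> int \<Rightarrow> bool" where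
  "levels3 W i j k \<longleftrightarrow> T i ` W \<inter> T j ` W = {} \<and> T j ` W \<inter> T k ` W = {} \<and> T k ` W \<inter> T i ` W = {}"

lemma levels3_rotate: "levels3 W i j k \<Longrightarrow> levels3 W j k i"
  and levels3_rev: "levels3 W i j k \<Longrightarrow> levels3 W k j i"
  by (auto simp: levels3_def)

lemma levels3_subset: "levels3 W i j k \<Longrightarrow> D \<subseteq> W \<Longrightarrow> levels3 D i j k"
  unfolding levels3_def by blast

lemma levels3_notin: "levels3 W i j k \<Longrightarrow> w \<in> W \<Longrightarrow> T i w \<notin> T j ` W \<and> T i w \<notin> T k ` W"
  unfolding levels3_def disjoint_iff by (metis imageI)

lemma cyc_apply:
  assumes "levels3 W i j k" "w \<in> W"
  shows "cyc W i j k (T i w) = T j w" "cyc W i j k (T j w) = T k w" "cyc W i j k (T k w) = T i w"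
proof -
  have "T j w \<notin> T i ` W" "T k w \<notin> T i ` W" "T k w \<notin> T j ` W"
    using assms unfolding levels3_def by blast+
  then show "cyc W i j k (T i w) = T j w" "cyc W i j k (T j w) = T k w" "cyc W i j k (T k w) = T i w"
    using assms(2) by (simp_all add: cyc_def T_T)
qed

lemma cyc_fix: "x \<notin> T i ` W \<Longrightarrow> x \<notin> T j ` W \<Longrightarrow> x \<notin> T k ` W \<Longrightarrow> cyc W i j k x = x"
  by (simp add: cyc_def)

lemma cyc_unique:
  assumes l: "levels3 W i j k"
    and g: "\<And>w. w \<in> W \<Longrightarrow> g (T i w) = T j w" "\<And>w. w \<in> W \<Longrightarrow> g (T j w) = T k w" "\<And>w. w \<in> W \<Longrightarrow> g (T k w) = T i w"
    and fixed: "\<And>x. x \<notin> T i ` W \<Longrightarrow> x \<notin> T j ` W \<Longrightarrow> x \<notin> T k ` W \<Longrightarrow> g x = x"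
  shows "g = cyc W i j k"
proof
  fix x
  consider w where "w \<in> W" "x = T i w" | w where "w \<in> W" "x = T j w" | w where "w \<in> W" "x = T k w"
    | "x \<notin> T i ` W" "x \<notin> T j ` W" "x \<notin> T k ` W" by blast
  then show "g x = cyc W i j k x"
    by cases (simp_all add: g cyc_apply[OF l] fixed cyc_fix)
qed

lemma cyc_rotate: "levels3 W i j k \<Longrightarrow> cyc W j k i = cyc W i j k"
  by (rule cyc_unique) (simp_all add: cyc_apply[OF levels3_rotate] cyc_fix)

lemma cyc_comp_rev: "levels3 W i j k \<Longrightarrow> cyc W k j i (cyc W i j k x) = x"
proof -
  assume l: "levels3 W i j k"
  consider w where "w \<in> W" "x = T i w" | w where "w \<in> W" "x = T j w" | w where "w \<in> W" "x = T k w"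
    | "x \<notin> T i ` W" "x \<notin> T j ` W" "x \<notin> T k ` W" by blast
  then show ?thesis
    by cases (simp_all add: cyc_apply[OF l] cyc_apply[OF levels3_rev[OF l]] cyc_fix)
qed

lemma cyc_rev_comp: "levels3 W i j k \<Longrightarrow> cyc W i j k (cyc W k j i x) = x"
  using cyc_comp_rev[OF levels3_rev] by simp

lemma bij_cyc: "levels3 W i j k \<Longrightarrow> bij (cyc W i j k)"
  by (rule o_bij[of "cyc W k j i"]) (simp_all add: fun_eq_iff cyc_comp_rev cyc_rev_comp)

lemma inv_cyc: "levels3 W i j k \<Longrightarrow> inv (cyc W i j k) = cyc W k j i"
  by (rule inv_unique_comp) (simp_all add: fun_eq_iff cyc_comp_rev cyc_rev_comp)

text \<open>Conjugation renames levels. Only the action of \<open>g\<close> on the three levels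
  matters, so a cycle over a large base can conjugate a cycle over any subset of that base.\<close>

lemma cyc_conj:
  assumes g: "bij g" and l: "levels3 W i j k"
    and gi: "\<And>w. w \<in> W \<Longrightarrow> g (T i w) = T i' w" and gj: "\<And>w. w \<in> W \<Longrightarrow> g (T j w) = T j' w"
    and gk: "\<And>w. w \<in> W \<Longrightarrow> g (T k w) = T k' w"
  shows "g \<circ> cyc W i j k \<circ> inv g = cyc W i' j' k'"
proof (rule cyc_unique)
  have inj: "g x = g y \<longleftrightarrow> x = y" for x y using g bij_is_inj injD by metis
  have ginv: "inv g (g x) = x" "g (inv g x) = x" for x
    using g by (simp_all add: bij_is_inj bij_is_surj surj_f_inv_f)
  have im: "T i' ` W = g ` T i ` W" "T j' ` W = g ` T j ` W" "T k' ` W = g ` T k ` W"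
    unfolding image_image using gi gj gk by (auto intro!: image_cong)
  show "levels3 W i' j' k'"
    using l bij_is_inj[OF g] unfolding levels3_def im by (simp add: image_Int[symmetric])
  show "(g \<circ> cyc W i j k \<circ> inv g) (T i' w) = T j' w" if "w \<in> W" for w
    unfolding gi[OF that, symmetric] using that by (simp add: ginv cyc_apply[OF l] gj)
  show "(g \<circ> cyc W i j k \<circ> inv g) (T j' w) = T k' w" if "w \<in> W" for w
    unfolding gj[OF that, symmetric] using that by (simp add: ginv cyc_apply[OF l] gk)
  show "(g \<circ> cyc W i j k \<circ> inv g) (T k' w) = T i' w" if "w \<in> W" for w
    unfolding gk[OF that, symmetric] using that by (simp add: ginv cyc_apply[OF l] gi)
  show "(g \<circ> cyc W i j k \<circ> inv g) x = x" if x: "x \<notin> T i' ` W" "x \<notin> T j' ` W" "x \<notin> T k' ` W" for x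
  proof -
    have "inv g x \<notin> T i ` W" "inv g x \<notin> T j ` W" "inv g x \<notin> T k ` W"
      using x unfolding im by (metis ginv(2) imageI)+
    then show ?thesis by (simp add: cyc_fix ginv)
  qed
qed

lemma cyc_T: "cyc (T a ` W) i j k = cyc W (i + a) (j + a) (k + a)"
  unfolding fun_eq_iff cyc_def T_image_T_image by simp

lemma levels3_T: "levels3 (T a ` W) i j k \<longleftrightarrow> levels3 W (i + a) (j + a) (k + a)"
  unfolding levels3_def T_image_T_image ..

lemma cyc_Un:
  assumes l: "levels3 (D \<union> E) i j k" and DE: "D \<inter> E = {}"
  shows "cyc (D \<union> E) i j k = cyc D i j k \<circ> cyc E i j k"
proof (rule sym, rule cyc_unique[OF l])
  have lD: "levels3 D i j k" and lE: "levels3 E i j k" using levels3_subset[OF l] by auto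
  have "T a ` D \<inter> T a ` E = {}" for a using DE by auto
  moreover have "T a ` D \<inter> T b ` E = {}" if "a \<in> {i, j, k}" "b \<in> {i, j, k}" "a \<noteq> b" for a b
    using that l unfolding levels3_def by blast
  ultimately have dj: "T a ` D \<inter> T b ` E = {}" if "a \<in> {i, j, k}" "b \<in> {i, j, k}" for a b
    using that by (cases "a = b") simp_all
  have D: "cyc E i j k (T a w) = T a w" if "a \<in> {i, j, k}" "w \<in> D" for a w
    using dj[OF that(1), of i] dj[OF that(1), of j] dj[OF that(1), of k] that(2)
    by (intro cyc_fix) blast+
  have E: "cyc D i j k (T a w) = T a w" if "a \<in> {i, j, k}" "w \<in> E" for a w
    using dj[OF _ that(1), of i] dj[OF _ that(1), of j] dj[OF _ that(1), of k] that(2)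
    by (intro cyc_fix) blast+
  show "(cyc D i j k \<circ> cyc E i j k) (T i w) = T j w" if "w \<in> D \<union> E" for w
    using that by (auto simp: D E cyc_apply[OF lD] cyc_apply[OF lE])
  show "(cyc D i j k \<circ> cyc E i j k) (T j w) = T k w" if "w \<in> D \<union> E" for w
    using that by (auto simp: D E cyc_apply[OF lD] cyc_apply[OF lE])
  show "(cyc D i j k \<circ> cyc E i j k) (T k w) = T i w" if "w \<in> D \<union> E" for w
    using that by (auto simp: D E cyc_apply[OF lD] cyc_apply[OF lE])
  show "(cyc D i j k \<circ> cyc E i j k) x = x"
    if "x \<notin> T i ` (D \<union> E)" "x \<notin> T j ` (D \<union> E)" "x \<notin> T k ` (D \<union> E)" for x
    using that by (simp add: image_Un cyc_fix)
qed

text \<open>The right factor acts first: it exchanges levels \<open>i\<close> and \<open>j\<close>,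
  and the left one sends what has arrived at level \<open>i\<close> on to level \<open>k\<close>.
  This links cycles with the generators of \<open>alt_group\<close>.\<close>

lemma cyc_eq_double_swap:
  assumes l: "levels3 W i j k"
  shows "cyc W i j k = swap (T i ` W) (T (k - i)) \<circ> swap (T i ` W) (T (j - i))"
proof -
  have im: "T (k - i) ` T i ` W = T k ` W" "T (j - i) ` T i ` W = T j ` W" by (simp_all add: T_image_T_image)
  have dk: "T i ` W \<inter> T (k - i) ` T i ` W = {}" and dj: "T i ` W \<inter> T (j - i) ` T i ` W = {}"
    unfolding im using l unfolding levels3_def by blast+
  have Tk: "T k w = T (k - i) (T i w)" "T j w = T (j - i) (T i w)" for w by (simp_all add: T_T)
  note sk = swap_apply[OF T_full dk] and sj = swap_apply[OF T_full dj]
  have lw: "T j w \<notin> T i ` W" "T j w \<notin> T k ` W" "T k w \<notin> T i ` W" "T k w \<notin> T j ` W" if "w \<in> W" for w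
    using that l unfolding levels3_def by blast+
  show ?thesis
  proof (rule sym, rule cyc_unique[OF l])
    fix w assume w: "w \<in> W"
    have 1: "swap (T i ` W) (T (j - i)) (T i w) = T j w" "swap (T i ` W) (T (j - i)) (T j w) = T i w"
      "swap (T i ` W) (T (k - i)) (T i w) = T k w" "swap (T i ` W) (T (k - i)) (T k w) = T i w"
      using sj(1,2)[of "T i w"] sk(1,2)[of "T i w"] w by (simp_all add: T_T)
    have 2: "swap (T i ` W) (T (k - i)) (T j w) = T j w" "swap (T i ` W) (T (j - i)) (T k w) = T k w"
      using sk(3)[of "T j w"] sj(3)[of "T k w"] lw[OF w] unfolding im by auto
    show "(swap (T i ` W) (T (k - i)) \<circ> swap (T i ` W) (T (j - i))) (T i w) = T j w"
      "(swap (T i ` W) (T (k - i)) \<circ> swap (T i ` W) (T (j - i))) (T j w) = T k w"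
      "(swap (T i ` W) (T (k - i)) \<circ> swap (T i ` W) (T (j - i))) (T k w) = T i w"
      by (simp_all add: 1 2)
  next
    fix x assume "x \<notin> T i ` W" "x \<notin> T j ` W" "x \<notin> T k ` W"
    then show "(swap (T i ` W) (T (k - i)) \<circ> swap (T i ` W) (T (j - i))) x = x"
      using sk(3)[of x] sj(3)[of x] unfolding im by simp
  qed
qed

lemma cyc_alt_group:
  assumes W: "W \<in> \<C>" and l: "levels3 W i j k"
  shows "cyc W i j k \<in> alt_group"
  unfolding cyc_eq_double_swap[OF l]
proof (rule double_swap_in_alt_group)
  have im: "T (k - i) ` T i ` W = T k ` W" "T (j - i) ` T i ` W = T j ` W" by (simp_all add: T_image_T_image)
  show "T i ` W \<inter> T (k - i) ` T i ` W = {}" "T i ` W \<inter> T (j - i) ` T i ` W = {}"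
    "T (k - i) ` T i ` W \<inter> T (j - i) ` T i ` W = {}"
    unfolding im using l unfolding levels3_def by blast+
qed (rule clopen_T[OF W] T_full)+

text \<open>The cycle on \<open>j\<close>, \<open>k\<close>, \<open>l\<close> fixes level
  \<open>i\<close>, so conjugation by it or by its inverse renames only the other two levels of the
  given cycle.\<close>

lemma cyc_generate_step:
  assumes H: "cyc D i j k \<in> generated F" "cyc D j k l \<in> generated F"
    and d: "levels3 D i j k" "levels3 D j k l" "levels3 D i l j"
  shows "cyc D i k l \<in> generated F" "cyc D i l j \<in> generated F"
proof -
  let ?g = "cyc D j k l"
  note g = bij_cyc[OF d(2)] and g' = bij_cyc[OF levels3_rev[OF d(2)]]
  have inv: "inv (cyc D l k j) = ?g" using inv_cyc[OF levels3_rev[OF d(2)]] .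
  have fixed: "cyc D j k l (T i w) = T i w" "cyc D l k j (T i w) = T i w" if "w \<in> D" for w
  proof -
    have "T i w \<notin> T j ` D" "T i w \<notin> T k ` D" "T i w \<notin> T l ` D"
      using levels3_notin[OF d(1) that] levels3_notin[OF d(3) that] by auto
    then show "cyc D j k l (T i w) = T i w" "cyc D l k j (T i w) = T i w" by (simp_all add: cyc_fix)
  qed
  have "?g \<circ> cyc D i j k \<circ> inv ?g = cyc D i k l"
    by (rule cyc_conj[OF g d(1)]) (simp_all add: fixed cyc_apply[OF d(2)])
  then show "cyc D i k l \<in> generated F"
    using generated_comp[OF generated_comp[OF H(2,1)] generated_inv[OF H(2)]] by simp
  have "cyc D l k j \<circ> cyc D i j k \<circ> inv (cyc D l k j) = cyc D i l j"
    by (rule cyc_conj[OF g' d(1)]) (simp_all add: fixed cyc_apply[OF levels3_rev[OF d(2)]])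
  then show "cyc D i l j \<in> generated F"
    using generated_comp[OF generated_comp[OF generated_inv[OF H(2)] H(1)] H(2)] inv_cyc[OF d(2)]
    by (simp add: inv)
qed

text \<open>The generation of a finite alternating group by three-cycles of consecutive letters,
  carried out on the levels of a tower.\<close>

lemma cyc_generate_consecutive:
  assumes lev: "\<And>i j. a \<le> i \<Longrightarrow> i < j \<Longrightarrow> j \<le> b \<Longrightarrow> T i ` D \<inter> T j ` D = {}"
    and H: "\<And>i. a \<le> i \<Longrightarrow> i + 2 \<le> b \<Longrightarrow> cyc D i (i + 1) (i + 2) \<in> generated F"
    and i: "a \<le> i" "i \<le> b" and j: "a \<le> j" "j \<le> b" and k: "a \<le> k" "k \<le> b"
    and ne: "i \<noteq> j" "j \<noteq> k" "k \<noteq> i"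
  shows "cyc D i j k \<in> generated F"
proof -
  have lev': "T i ` D \<inter> T j ` D = {}" if "i \<noteq> j" "a \<le> i" "i \<le> b" "a \<le> j" "j \<le> b" for i j
    using that lev[of i j] lev[of j i] by (cases i j rule: linorder_cases) auto
  have l3: "levels3 D i j k"
    if "i \<noteq> j" "j \<noteq> k" "k \<noteq> i" "a \<le> i" "i \<le> b" "a \<le> j" "j \<le> b" "a \<le> k" "k \<le> b" for i j k
    unfolding levels3_def using that by (intro conjI lev') auto
  have rot: "cyc D j k i \<in> generated F" if "cyc D i j k \<in> generated F" "levels3 D i j k" for i j k
    using that cyc_rotate by simp
  have rev: "cyc D k j i \<in> generated F" if "cyc D i j k \<in> generated F" "levels3 D i j k" for i j k
    using generated_inv[OF that(1)] inv_cyc[OF that(2)] by simp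
  \<comment> \<open>Here the first level stays and the adjacent pair climbs; in \<open>B\<close> the
    last level then moves away from the second.\<close>
  have A: "i + 1 \<le> k \<Longrightarrow> k + 1 \<le> b \<longrightarrow> cyc D i k (k + 1) \<in> generated F" if "a \<le> i" for i k
  proof (induction k rule: int_ge_induct)
    case base
    then show ?case using H[OF that] by (simp add: add.assoc)
  next
    case (step k)
    show ?case
    proof
      assume b: "k + 1 + 1 \<le> b"
      have 1: "cyc D k (k + 1) (k + 2) \<in> generated F" using H[of k] step.hyps that b by simp
      have 2: "cyc D i k (k + 1) \<in> generated F" using step.IH b by simp
      have "cyc D i (k + 1) (k + 2) \<in> generated F"
        by (rule cyc_generate_step(1)[OF 2 1 l3 l3 l3]) (use step.hyps b that in auto)
      then show "cyc D i (k + 1) (k + 1 + 1) \<in> generated F" by (simp add: add.assoc)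
    qed
  qed
  have B: "j + 1 \<le> k \<Longrightarrow> k \<le> b \<longrightarrow> cyc D i j k \<in> generated F" if "a \<le> i" "i < j" for i j k
  proof (induction k rule: int_ge_induct)
    case base
    then show ?case using A[of i j] that by simp
  next
    case (step k)
    show ?case
    proof
      assume b: "k + 1 \<le> b"
      have 1: "cyc D i j k \<in> generated F" using step.IH b by simp
      have 2: "cyc D i k (k + 1) \<in> generated F" using A[of i k] step.hyps b that by simp
      have 3: "cyc D j i k \<in> generated F"
        by (rule rot[OF rev[OF 1 l3] l3]) (use that step.hyps b in auto)
      have 4: "cyc D j (k + 1) i \<in> generated F"
        by (rule cyc_generate_step(2)[OF 3 2 l3 l3 l3]) (use that step.hyps b in auto)
      show "cyc D i j (k + 1) \<in> generated F"
        by (rule rot[OF rot[OF 4 l3] l3]) (use that step.hyps b in auto)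
    qed
  qed
  have C: "cyc D i j k \<in> generated F" if "a \<le> i" "i < j" "j < k" "k \<le> b" for i j k
    using B[of i j k] that by simp
  \<comment> \<open>Each ordering is a rotation of the increasing one or of its reversal.\<close>
  consider "i < j" "j < k" | "j < k" "k < i" | "k < i" "i < j" | "k < j" "j < i" | "j < i" "i < k" | "i < k" "k < j"
    using ne by linarith
  then show ?thesis
  proof cases
    case 1 then show ?thesis using C i k by simp
  next
    case 2
    then have X: "cyc D j k i \<in> generated F" using C i j by simp
    show ?thesis by (rule rot[OF rot[OF X l3] l3]) (use ne i j k in auto)
  next
    case 3
    then have X: "cyc D k i j \<in> generated F" using C k j by simp
    show ?thesis by (rule rot[OF X l3]) (use ne i j k in auto)
  next
    case 4
    then have X: "cyc D k j i \<in> generated F" using C k i by simp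
    show ?thesis by (rule rev[OF X l3]) (use ne i j k in auto)
  next
    case 5
    then have X: "cyc D j i k \<in> generated F" using C k j by simp
    show ?thesis by (rule rot[OF rev[OF X l3] l3]) (use ne i j k in auto)
  next
    case 6
    then have X: "cyc D i k j \<in> generated F" using C i j by simp
    show ?thesis by (rule rot[OF rot[OF rev[OF X l3] l3] l3]) (use ne i j k in auto)
  qed
qed

text \<open>The computations below use the levels -1 to 3, -3 to 1 or -2 to 2 over one base, hence
  differences up to 4.\<close>

definition small :: "'a set \<Rightarrow> bool" where
  "small E \<longleftrightarrow> (\<forall>k. k \<noteq> 0 \<and> \<bar>k\<bar> \<le> 4 \<longrightarrow> T k ` E \<inter> E = {})"

lemma small_disjoint:
  assumes "small E" "V \<subseteq> E" "W \<subseteq> E" "a \<noteq> b" "\<bar>a - b\<bar> \<le> 4"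
  shows "T a ` V \<inter> T b ` W = {}"
proof (rule ccontr)
  assume "T a ` V \<inter> T b ` W \<noteq> {}"
  then obtain v w where "v \<in> E" "w \<in> E" "T a v = T b w" using assms by blast
  then have "T (a - b) v \<in> E" using T_eqD[of a v b w] by simp
  moreover have "T (a - b) ` E \<inter> E = {}" using assms unfolding small_def by simp
  ultimately show False using \<open>v \<in> E\<close> by blast
qed

lemma small_notin:
  "small E \<Longrightarrow> V \<subseteq> E \<Longrightarrow> w \<in> E \<Longrightarrow> a \<noteq> b \<Longrightarrow> \<bar>a - b\<bar> \<le> 4 \<Longrightarrow> T a w \<notin> T b ` V"
  using small_disjoint[of E "{w}" V a b] by auto

lemma small_levels3:
  "small E \<Longrightarrow> W \<subseteq> E \<Longrightarrow> i \<noteq> j \<Longrightarrow> j \<noteq> k \<Longrightarrow> k \<noteq> i \<Longrightarrow> \<bar>i - j\<bar> \<le> 4 \<Longrightarrow> \<bar>j - k\<bar> \<le> 4 \<Longrightarrow> \<bar>k - i\<bar> \<le> 4 \<Longrightarrow>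
   levels3 W i j k"
  unfolding levels3_def by (simp add: small_disjoint)

abbreviation cyc0 :: "'a set \<Rightarrow> 'a \<Rightarrow> 'a" where
  "cyc0 W \<equiv> cyc W (- 1) 0 1"

lemma cyc0_T: "cyc0 (T a ` W) = cyc W (a - 1) a (a + 1)"
  by (simp add: cyc_T add.commute)

text \<open>The two given cycles over \<open>E\<close> compose to a five-cycle on levels -1 to 3,
  which raises the levels -1, 0, 1 by one. Conjugation by it raises the cycle over any subset of
  \<open>E\<close>.\<close>

lemma cyc0_shift_up:
  assumes sm: "small E" and W: "W \<subseteq> E"
    and H: "cyc0 E \<in> generated F" "cyc0 (T 2 ` E) \<in> generated F" "cyc0 W \<in> generated F"
  shows "cyc0 (T 1 ` W) \<in> generated F"
proof -
  note l1 = small_levels3[OF sm order_refl, of "-1" 0 1, simplified]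
    and l2 = small_levels3[OF sm order_refl, of 1 2 3, simplified]
    and lW = small_levels3[OF sm W, of "-1" 0 1, simplified]
  let ?g = "cyc0 E \<circ> cyc E 1 2 3"
  have g: "?g \<in> generated F" using generated_comp[OF H(1,2)] by (simp add: cyc0_T)
  have "?g \<circ> cyc0 W \<circ> inv ?g = cyc W 0 1 2"
  proof (rule cyc_conj[OF _ lW])
    show "bij ?g" by (intro bij_comp bij_cyc l1 l2)
    fix w assume "w \<in> W"
    then have w: "w \<in> E" using W by blast
    have "cyc E 1 2 3 (T (-1) w) = T (-1) w" "cyc E 1 2 3 (T 0 w) = T 0 w" "cyc0 E (T 2 w) = T 2 w"
      by (intro cyc_fix small_notin[OF sm order_refl w]; simp)+
    then show "?g (T (-1) w) = T 0 w" "?g (T 0 w) = T 1 w" "?g (T 1 w) = T 2 w"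
      by (simp_all add: cyc_apply[OF l1 w] cyc_apply[OF l2 w])
  qed
  then show ?thesis
    using generated_comp[OF generated_comp[OF g H(3)] generated_inv[OF g]] by (simp add: cyc0_T)
qed

lemma cyc0_shift_down:
  assumes sm: "small E" and W: "W \<subseteq> E"
    and H: "cyc0 E \<in> generated F" "cyc0 (T (- 2) ` E) \<in> generated F" "cyc0 W \<in> generated F"
  shows "cyc0 (T (- 1) ` W) \<in> generated F"
proof -
  note l1 = small_levels3[OF sm order_refl, of "-1" 0 1, simplified]
    and l2 = small_levels3[OF sm order_refl, of "-3" "-2" "-1", simplified]
    and lW = small_levels3[OF sm W, of "-2" "-1" 0, simplified]
  let ?g = "cyc E (- 3) (- 2) (- 1) \<circ> cyc0 E"
  have g: "?g \<in> generated F" using generated_comp[OF H(2,1)] by (simp add: cyc0_T)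
  have bg: "bij ?g" by (intro bij_comp bij_cyc l1 l2)
  \<comment> \<open>This five-cycle on levels -3 to 1 also raises levels, so the wanted lower cycle
    is the conjugate of the given one by the inverse.\<close>
  have "?g \<circ> cyc W (- 2) (- 1) 0 \<circ> inv ?g = cyc0 W"
  proof (rule cyc_conj[OF bg lW])
    fix w assume "w \<in> W"
    then have w: "w \<in> E" using W by blast
    have "cyc0 E (T (-2) w) = T (-2) w" "cyc E (-3) (-2) (-1) (T 0 w) = T 0 w" "cyc E (-3) (-2) (-1) (T 1 w) = T 1 w"
      by (intro cyc_fix small_notin[OF sm order_refl w]; simp)+
    then show "?g (T (-2) w) = T (-1) w" "?g (T (-1) w) = T 0 w" "?g (T 0 w) = T 1 w"
      by (simp_all add: cyc_apply[OF l1 w] cyc_apply[OF l2 w])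
  qed
  then have "inv ?g \<circ> (?g \<circ> cyc W (- 2) (- 1) 0 \<circ> inv ?g) \<circ> ?g = inv ?g \<circ> cyc0 W \<circ> ?g" by simp
  moreover have "inv ?g \<circ> (?g \<circ> cyc W (- 2) (- 1) 0 \<circ> inv ?g) \<circ> ?g = cyc W (- 2) (- 1) 0"
    using bij_is_inj[OF bg] by (simp only: comp_assoc[symmetric] inv_o_cancel)
      (simp only: comp_assoc inv_o_cancel comp_id id_comp)
  ultimately show ?thesis
    using generated_comp[OF generated_comp[OF generated_inv[OF g] H(3)] g] by (simp only: cyc0_T) simp
qed

text \<open>The commutator trick. The cycles \<open>u\<close> over \<open>W1\<close> on levels -2,
  -1, 0 and \<open>v\<close> over \<open>W2\<close> on levels 0, 1, 2 can meet only at level 0 over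
  the intersection, so their commutator lives over the intersection.\<close>

lemma cyc0_Int:
  assumes sm: "small E" and W1: "W1 \<subseteq> E" and W2: "W2 \<subseteq> E"
    and H: "cyc0 (T (- 1) ` W1) \<in> generated F" "cyc0 (T 1 ` W2) \<in> generated F"
  shows "cyc0 (W1 \<inter> W2) \<in> generated F"
proof -
  define W D where "W = W1 \<inter> W2" and "D = W1 - W2"
  have WD: "W1 = W \<union> D" "W1 = D \<union> W" "W \<inter> D = {}" "D \<inter> W = {}" by (auto simp: W_def D_def)
  have sub: "W \<subseteq> E" "D \<subseteq> E" using W1 by (auto simp: W_def D_def)
  define u v where "u = cyc W1 (- 2) (- 1) 0" and "v = cyc W2 0 1 2"
  have uH: "u \<in> generated F" and vH: "v \<in> generated F" using H by (simp_all add: u_def v_def cyc0_T)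
  note lu = small_levels3[OF sm W1, of "-2" "-1" 0, simplified]
    and lu' = small_levels3[OF sm W1, of 0 "-1" "-2", simplified]
    and lv = small_levels3[OF sm W2, of 0 1 2, simplified]
    and lW = small_levels3[OF sm sub(1), of "-1" 0 1, simplified]
    and lW1 = small_levels3[OF sm sub(1), of "-2" "-1" 0, simplified]
    and lW2 = small_levels3[OF sm sub(1), of 0 "-1" "-2", simplified]
    and lW3 = small_levels3[OF sm sub(1), of 1 "-1" "-2", simplified]
    and lD = small_levels3[OF sm sub(2), of 0 "-1" "-2", simplified]
  have invu: "inv u = cyc W 0 (- 1) (- 2) \<circ> cyc D 0 (- 1) (- 2)"
    unfolding u_def inv_cyc[OF lu] using cyc_Un[OF lu'[unfolded WD(1)] WD(3)] WD(1) by simp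
  have u: "u = cyc D (- 2) (- 1) 0 \<circ> cyc W (- 2) (- 1) 0"
    unfolding u_def using cyc_Un[OF lu[unfolded WD(2)] WD(4)] WD(2) by simp
  have bv: "bij v" unfolding v_def by (rule bij_cyc[OF lv])
  have vinv: "inv v (v x) = x" "v (inv v x) = x" for x
    using bv by (simp_all add: bij_is_inj bij_is_surj surj_f_inv_f)
  have vlow: "v (T (-1) w) = T (-1) w" "v (T (-2) w) = T (-2) w" if "w \<in> E" for w
    unfolding v_def by (intro cyc_fix small_notin[OF sm W2 that]; simp)+
  \<comment> \<open>Over \<open>D\<close> the element \<open>v\<close> fixes every level that
    \<open>u\<close> moves, so this part of \<open>u\<close> cancels in the commutator. Over
    \<open>W\<close>, \<open>v\<close> lifts level 0 to level 1.\<close>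
  have "v \<circ> cyc D 0 (- 1) (- 2) \<circ> inv v = cyc D 0 (- 1) (- 2)"
  proof (rule cyc_conj[OF bv lD])
    fix w assume w: "w \<in> D"
    then have wE: "w \<in> E" using sub by blast
    show "v (T 0 w) = T 0 w"
      unfolding v_def
    proof (rule cyc_fix)
      show "T 0 w \<notin> T 0 ` W2" using w by (auto simp: D_def T_0)
      show "T 0 w \<notin> T 1 ` W2" "T 0 w \<notin> T 2 ` W2" by (rule small_notin[OF sm W2 wE]; simp)+
    qed
    show "v (T (-1) w) = T (-1) w" "v (T (-2) w) = T (-2) w" using vlow[OF wE] .
  qed
  then have conjD: "v (cyc D 0 (- 1) (- 2) (inv v x)) = cyc D 0 (- 1) (- 2) x" for x
    unfolding fun_eq_iff by simp
  have "v \<circ> cyc W 0 (- 1) (- 2) \<circ> inv v = cyc W 1 (- 1) (- 2)"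
  proof (rule cyc_conj[OF bv lW2])
    fix w assume w: "w \<in> W"
    then have "w \<in> E" "w \<in> W2" using sub by (auto simp: W_def)
    then show "v (T 0 w) = T 1 w" "v (T (-1) w) = T (-1) w" "v (T (-2) w) = T (-2) w"
      using vlow cyc_apply(1)[OF lv] unfolding v_def by blast+
  qed
  then have conjW: "v (cyc W 0 (- 1) (- 2) (inv v x)) = cyc W 1 (- 1) (- 2) x" for x
    unfolding fun_eq_iff by simp
  have "v \<circ> inv u \<circ> inv v \<circ> u = cyc W 1 (- 1) (- 2) \<circ> cyc W (- 2) (- 1) 0"
  proof
    fix x
    have "(v \<circ> inv u \<circ> inv v \<circ> u) x = v (cyc W 0 (- 1) (- 2) (inv v (v (cyc D 0 (- 1) (- 2) (inv v (u x))))))"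
      by (simp add: invu vinv)
    also have "\<dots> = cyc W 1 (- 1) (- 2) (cyc D 0 (- 1) (- 2) (cyc D (- 2) (- 1) 0 (cyc W (- 2) (- 1) 0 x)))"
      by (simp only: conjD conjW) (simp add: u)
    also have "\<dots> = (cyc W 1 (- 1) (- 2) \<circ> cyc W (- 2) (- 1) 0) x"
      by (simp add: cyc_rev_comp[OF lD])
    finally show "(v \<circ> inv u \<circ> inv v \<circ> u) x = (cyc W 1 (- 1) (- 2) \<circ> cyc W (- 2) (- 1) 0) x" .
  qed
  \<comment> \<open>Two three-cycles that share the levels -1 and -2 compose to one three-cycle,
    from which level -2 drops out.\<close>
  also have "\<dots> = cyc0 W"
  proof (rule cyc_unique[OF lW])
    fix w assume w: "w \<in> W"
    then have wE: "w \<in> E" using sub by blast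
    have "cyc W 1 (- 1) (- 2) (T 0 w) = T 0 w" "cyc W (- 2) (- 1) 0 (T 1 w) = T 1 w"
      by (intro cyc_fix small_notin[OF sm sub(1) wE]; simp)+
    then show "(cyc W 1 (- 1) (- 2) \<circ> cyc W (- 2) (- 1) 0) (T (- 1) w) = T 0 w"
      "(cyc W 1 (- 1) (- 2) \<circ> cyc W (- 2) (- 1) 0) (T 0 w) = T 1 w"
      "(cyc W 1 (- 1) (- 2) \<circ> cyc W (- 2) (- 1) 0) (T 1 w) = T (- 1) w"
      by (simp_all add: cyc_apply[OF lW1 w] cyc_apply[OF lW3 w])
  next
    fix x assume x: "x \<notin> T (- 1) ` W" "x \<notin> T 0 ` W" "x \<notin> T 1 ` W"
    show "(cyc W 1 (- 1) (- 2) \<circ> cyc W (- 2) (- 1) 0) x = x"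
    proof (cases "x \<in> T (- 2) ` W")
      case True
      then obtain w where "w \<in> W" "x = T (-2) w" by blast
      then show ?thesis by (simp add: cyc_apply[OF lW1] cyc_apply[OF lW3])
    next
      case False
      then show ?thesis using x by (simp add: cyc_fix)
    qed
  qed
  finally have "v \<circ> inv u \<circ> inv v \<circ> u = cyc0 W" .
  moreover have "v \<circ> inv u \<circ> inv v \<circ> u \<in> generated F"
    by (rule generated_comp[OF generated_comp[OF generated_comp[OF vH generated_inv[OF uH]] generated_inv[OF vH]] uH])
  ultimately show ?thesis unfolding W_def by (simp only:)
qed

end

section \<open>Cylinders of a separating labelling and a finite set of three-cycles\<close>

lemma disjoint_image_subset: "A \<inter> f ` A = {} \<Longrightarrow> D \<subseteq> A \<Longrightarrow> E \<subseteq> A \<Longrightarrow> D \<inter> f ` E = {}"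
  by blast

context clopen_system
begin

text \<open>An intrinsic form of a conjugacy to a subshift: the itineraries of points under
  \<open>lab\<close> are the symbolic sequences. Labels are natural numbers to agree with the
  alphabets of the statement.\<close>

definition separating :: "('a \<Rightarrow> nat) \<Rightarrow> bool" where
  "separating lab \<longleftrightarrow> loc_const lab \<and> (\<forall>x\<in>S. \<forall>y\<in>S. (\<forall>i. lab (T i x) = lab (T i y)) \<longrightarrow> x = y)"

definition cylinder :: "('a \<Rightarrow> nat) \<Rightarrow> int \<Rightarrow> int \<Rightarrow> 'a \<Rightarrow> 'a set" where
  "cylinder lab p q x = {y\<in>S. \<forall>i\<in>{p..<q}. lab (T i y) = lab (T i x)}"

lemma mem_cylinder_self: "x \<in> S \<Longrightarrow> x \<in> cylinder lab p q x"
  by (simp add: cylinder_def)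

lemma cylinder_eq: "y \<in> cylinder lab p q x \<Longrightarrow> cylinder lab p q y = cylinder lab p q x"
  by (auto simp: cylinder_def)

lemma cylinder_mono: "p \<le> p' \<Longrightarrow> q' \<le> q \<Longrightarrow> cylinder lab p q x \<subseteq> cylinder lab p' q' x"
  by (auto simp: cylinder_def)

lemma T_cylinder: "T j ` cylinder lab p q x = cylinder lab (p - j) (q - j) (T j x)"
proof -
  have "(\<forall>i\<in>{p..<q}. lab (T i (T (- j) y)) = lab (T i x)) \<longleftrightarrow>
    (\<forall>i\<in>{p - j..<q - j}. lab (T i y) = lab (T i (T j x)))" (is "?l \<longleftrightarrow> ?r") for y
  proof
    assume ?l
    show ?r
    proof
      fix i assume "i \<in> {p - j..<q - j}"
      then show "lab (T i y) = lab (T i (T j x))" using \<open>?l\<close>[rule_format, of "i + j"] by (simp add: T_T)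
    qed
  next
    assume ?r
    show ?l
    proof
      fix i assume "i \<in> {p..<q}"
      then show "lab (T i (T (- j) y)) = lab (T i x)" using \<open>?r\<close>[rule_format, of "i - j"] by (simp add: T_T)
    qed
  qed
  then show ?thesis unfolding set_eq_iff mem_T_image cylinder_def mem_Collect_eq T_mem_iff by blast
qed

context
  fixes lab assumes lab: "separating lab"
begin

lemma loc_const_lab: "loc_const lab"
  using lab by (simp add: separating_def)

lemma clopen_cylinder: "cylinder lab p q x \<in> \<C>"
proof -
  have lT: "loc_const (\<lambda>y. lab (T i y))" for i by (rule loc_const_T[OF loc_const_lab])
  have lc: "loc_const (\<lambda>y. lab (T i y) = lab (T i x))" for i
    by (rule loc_const_apply[OF lT, where F="\<lambda>n. n = lab (T i x)"])
  have "loc_const (\<lambda>y. \<forall>i\<in>{p..<q}. lab (T i y) = lab (T i x))"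
    by (rule loc_const_Ball) (simp, rule lc)
  from loc_const_clopen[OF this, where p="\<lambda>b. b"] show ?thesis by (simp add: cylinder_def)
qed

lemma finite_cylinders: "finite (cylinder lab p q ` S)"
proof (rule loc_const_finite, rule loc_constI)
  fix x assume "x \<in> S"
  then show "\<exists>B\<in>\<C>. x \<in> B \<and> (\<forall>y\<in>B. cylinder lab p q y = cylinder lab p q x)"
    by (intro bexI[of _ "cylinder lab p q x"] conjI ballI)
      (rule mem_cylinder_self cylinder_eq clopen_cylinder; assumption)+
qed

text \<open>The points that differ from \<open>x\<close> in a given coordinate form a clopen set.
  Together with the level set of \<open>f\<close> through \<open>x\<close> these sets cover the
  space, and a finite subcover bounds the coordinates to be looked at.\<close>

lemma window_local:
  assumes f: "loc_const f" and x: "x \<in> S"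
  shows "\<exists>m\<ge>0. \<forall>y\<in>cylinder lab (- m) m x. f y = f x"
proof -
  define V where "V i = {y\<in>S. lab (T i y) \<noteq> lab (T i x)}" for i
  have V: "V i \<in> \<C>" for i
    using loc_const_clopen[OF loc_const_T[OF loc_const_lab, of i], of "\<lambda>n. n \<noteq> lab (T i x)"] by (simp add: V_def)
  define A where "A = {y\<in>S. f y = f x}"
  have A: "A \<in> \<C>" using loc_const_clopen[OF f, of "\<lambda>v. v = f x"] by (simp add: A_def)
  have "S \<subseteq> \<Union>(insert A (range V))"
  proof
    fix y assume y: "y \<in> S"
    show "y \<in> \<Union>(insert A (range V))"
    proof (cases "y = x")
      case True then show ?thesis using y by (simp add: A_def)
    next
      case False
      then obtain i where "lab (T i y) \<noteq> lab (T i x)" using lab x y by (auto simp: separating_def)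
      then have "y \<in> V i" using y by (simp add: V_def)
      then show ?thesis by auto
    qed
  qed
  moreover have "insert A (range V) \<subseteq> \<C>" using A V by blast
  ultimately obtain \<V> where "\<V> \<subseteq> insert A (range V)" "finite \<V>" "S \<subseteq> \<Union>\<V>"
    using clopen_compact by metis
  moreover from this have "finite (\<V> - {A})" "\<V> - {A} \<subseteq> V ` UNIV" by auto
  ultimately obtain I where I: "finite I" "\<V> - {A} = V ` I" by (metis finite_subset_image)
  \<comment> \<open>The window of the cylinder is half open, so one more than the largest absolute
    value is required.\<close>
  define m where "m = Max (insert 0 (abs ` I)) + 1"
  have m: "\<bar>i\<bar> < m" if "i \<in> I" for i
    using that I(1) Max_ge[of "insert 0 (abs ` I)" "\<bar>i\<bar>"] by (simp add: m_def)
  have m0: "m \<ge> 0" using I(1) Max_ge[of "insert 0 (abs ` I)" 0] by (simp add: m_def)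
  have "f y = f x" if y: "y \<in> cylinder lab (- m) m x" for y
  proof -
    have "y \<in> S" using y by (simp add: cylinder_def)
    moreover have "y \<notin> V i" if "i \<in> I" for i
      using m[OF that] y by (auto simp: V_def cylinder_def abs_less_iff)
    ultimately have "y \<in> A" using \<open>S \<subseteq> \<Union>\<V>\<close> I(2) by blast
    then show ?thesis by (simp add: A_def)
  qed
  then show ?thesis using m0 by blast
qed

text \<open>A Lebesgue number argument: the largest of finitely many windows works everywhere,
  because a cylinder is the cylinder of each of its points.\<close>

lemma window_uniform:
  assumes f: "loc_const f"
  obtains m where "m \<ge> 0" "\<And>x y. x \<in> S \<Longrightarrow> y \<in> cylinder lab (- m) m x \<Longrightarrow> f y = f x"
proof -
  obtain M where M: "\<And>x. x \<in> S \<Longrightarrow> M x \<ge> 0 \<and> (\<forall>y\<in>cylinder lab (- M x) (M x) x. f y = f x)"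
    using window_local[OF f] by metis
  define B where "B x = cylinder lab (- M x) (M x) x" for x
  have "S \<subseteq> \<Union>(B ` S)" using mem_cylinder_self by (auto simp: B_def)
  moreover have "B ` S \<subseteq> \<C>" using clopen_cylinder by (auto simp: B_def)
  ultimately obtain \<V> where "\<V> \<subseteq> B ` S" "finite \<V>" "S \<subseteq> \<Union>\<V>"
    using clopen_compact by metis
  then obtain I where I: "finite I" "I \<subseteq> S" "S \<subseteq> \<Union>(B ` I)" by (metis finite_subset_image)
  define m where "m = Max (insert 0 (M ` I))"
  have m: "M x \<le> m" if "x \<in> I" for x using that I(1) by (simp add: m_def)
  have "m \<ge> 0" using I(1) by (simp add: m_def)
  moreover have "f y = f x" if x: "x \<in> S" and y: "y \<in> cylinder lab (- m) m x" for x y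
  proof -
    obtain z where z: "z \<in> I" "x \<in> B z" using I(3) x by blast
    have zS: "z \<in> S" using z I by blast
    have "y \<in> cylinder lab (- M z) (M z) x"
      using y cylinder_mono[of "- m" "- M z" "M z" m lab x] m[OF z(1)] by auto
    then have "y \<in> B z" using z(2) cylinder_eq unfolding B_def by blast
    then show ?thesis using z(2) M[OF zS] unfolding B_def by metis
  qed
  ultimately show ?thesis using that by blast
qed

text \<open>A window of bounded length determines the piece of a partition into small sets; two
  points of an orbit with the same window then lie in one small piece, so a short return is
  impossible. The position of the window is irrelevant up to translation.\<close>

lemma small_cylinders:
  obtains l where "l > 0" "\<And>p q x. q - p \<ge> l \<Longrightarrow> small (cylinder lab p q x)"
proof -
  let ?K = "{k::int. k \<noteq> 0 \<and> \<bar>k\<bar> \<le> 4}"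
  have finK: "finite ?K" by (rule finite_subset[of _ "{-4..4}"]) auto
  have loc: "\<exists>B\<in>\<C>. x \<in> B \<and> small B" if x: "x \<in> S" for x
    by (rule small_neighbourhood[OF x finK]) (auto simp: small_def)
  have mono: "small D" if "small B" "D \<subseteq> B" for B D
    using that unfolding small_def by blast
  obtain m and P :: "nat \<Rightarrow> 'a set" where P: "\<And>i. P i \<in> \<C>" "\<And>i. i < m \<Longrightarrow> small (P i)"
    "\<And>i j. i \<noteq> j \<Longrightarrow> P i \<inter> P j = {}" "S = (\<Union>i<m. P i)"
    by (rule clopen_partition[where Q=small, OF loc mono]) (assumption+, rule that)
  have "loc_const (\<lambda>x. {i\<in>{..<m}. x \<in> P i})"
    by (rule loc_const_Collect) (simp_all add: loc_const_mem P(1))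
  then obtain n where n: "n \<ge> 0"
    "\<And>x y. x \<in> S \<Longrightarrow> y \<in> cylinder lab (- n) n x \<Longrightarrow> {i\<in>{..<m}. y \<in> P i} = {i\<in>{..<m}. x \<in> P i}"
    by (rule window_uniform) blast
  have no_return: "T k x \<notin> cylinder lab (- n) n x" if x: "x \<in> S" and k: "k \<noteq> 0" "\<bar>k\<bar> \<le> 4" for k x
  proof
    assume "T k x \<in> cylinder lab (- n) n x"
    then have eq: "{i\<in>{..<m}. T k x \<in> P i} = {i\<in>{..<m}. x \<in> P i}" using n(2)[OF x] by blast
    obtain i where i: "i < m" "x \<in> P i" using P(4) x by blast
    then have "T k x \<in> P i" using eq by blast
    moreover have "T k ` P i \<inter> P i = {}" using P(2)[OF i(1)] k by (simp add: small_def)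
    ultimately show False using i by blast
  qed
  show ?thesis
  \<comment> \<open>The extra one keeps the length positive when \<open>n\<close> is 0.\<close>
  proof (rule that[of "2 * n + 1"])
    fix p q x assume pq: "q - p \<ge> 2 * n + 1"
    show "small (cylinder lab p q x)"
      unfolding small_def
    proof (intro allI impI, rule ccontr)
      fix k :: int assume k: "k \<noteq> 0 \<and> \<bar>k\<bar> \<le> 4" and "T k ` cylinder lab p q x \<inter> cylinder lab p q x \<noteq> {}"
      then obtain y where y: "y \<in> cylinder lab p q x" "T k y \<in> cylinder lab p q x" by blast
      \<comment> \<open>Seen from \<open>z\<close>, the coordinates from \<open>-n\<close> up to but
        excluding \<open>n\<close> are those of \<open>y\<close> from \<open>p\<close> up to but
        excluding \<open>p + 2 * n\<close>, which lie in the given window.\<close>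
      define z where "z = T (p + n) y"
      have zS: "z \<in> S" using y(1) by (simp add: z_def cylinder_def)
      have "lab (T i (T k z)) = lab (T i z)" if i: "i \<in> {-n..<n}" for i
      proof -
        have "i + p + n \<in> {p..<q}" using i pq by auto
        then have "lab (T (i + p + n) (T k y)) = lab (T (i + p + n) y)"
          using y by (simp add: cylinder_def)
        then show ?thesis by (simp add: z_def T_T algebra_simps)
      qed
      then have "T k z \<in> cylinder lab (- n) n z" using zS by (simp add: cylinder_def)
      then show False using no_return[OF zS] k by blast
    qed
  qed (use n(1) in simp)
qed

lemma cyc0_union:
  assumes fin: "finite \<D>" and W: "\<Union>\<D> = W" and dj: "disjoint \<D>" and l: "levels3 W (- 1) 0 1"
    and H: "\<And>D. D \<in> \<D> \<Longrightarrow> cyc0 D \<in> generated F"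
  shows "cyc0 W \<in> generated F"
  using assms
proof (induction \<D> arbitrary: W rule: finite_induct)
  case empty
  have "cyc0 {} = id" by (simp add: fun_eq_iff cyc_def)
  moreover have "W = {}" using empty by simp
  ultimately show ?case by (simp only: generated_id)
next
  case (insert D \<D>)
  have "disjoint \<D>" using insert.prems(2) by (simp add: pairwise_insert)
  moreover have "levels3 (\<Union>\<D>) (- 1) 0 1" using insert.prems(1,3) by (auto intro: levels3_subset)
  ultimately have "cyc0 (\<Union>\<D>) \<in> generated F" using insert.IH[of "\<Union>\<D>"] insert.prems(4) by simp
  moreover have W: "W = D \<union> \<Union>\<D>" using insert.prems(1) by simp
  moreover have "D \<inter> \<Union>\<D> = {}"
    using insert.prems(2) insert.hyps(2) by (auto simp: disjoint_def)
  then have "cyc0 W = cyc0 D \<circ> cyc0 (\<Union>\<D>)" using cyc_Un[of D "\<Union>\<D>" "-1" 0 1] insert.prems(3) unfolding W by simp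
  ultimately show ?case using generated_comp insert.prems(4)[of D] by (metis insertI1)
qed

text \<open>Windows are lengthened by one coordinate at a time. A cylinder over the longer window is
  the intersection of two over windows shifted by one against each other, one of them a translate of
  a cylinder already reached, and \<open>cyc0_Int\<close> applies.\<close>

theorem alt_group_finitely_generated:
  obtains F where "finite F" "F \<subseteq> alt_group" "alt_group = generated F"
proof -
  obtain l where l: "l > 0" "\<And>p q x. q - p \<ge> l \<Longrightarrow> small (cylinder lab p q x)"
    by (rule small_cylinders) blast
  \<comment> \<open>The base in \<open>cyc0_Int\<close> is the cylinder over the common part of the
    two windows, which is one shorter and must still be small.\<close>
  define L where "L = l + 1"
  define Cyl where "Cyl = cylinder lab 0 L ` S"
  \<comment> \<open>The translates by 2 and -2 are the second ingredients of the five-cycles in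
    \<open>cyc0_shift_up\<close> and \<open>cyc0_shift_down\<close>.\<close>
  define F where "F = (\<lambda>(j, E). cyc0 (T j ` E)) ` ({- 2..2} \<times> Cyl)"
  have finF: "finite F" unfolding F_def Cyl_def by (intro finite_imageI finite_cartesian_product finite_cylinders) simp
  have smallCyl: "small E" "E \<in> \<C>" if "E \<in> Cyl" for E
    using that by (auto simp: Cyl_def L_def intro: l(2) clopen_cylinder)
  have gen: "cyc0 (T j ` cylinder lab 0 L x) \<in> generated F" if "x \<in> S" "j \<in> {-2..2}" for j x
    by (rule generated_incl) (use that in \<open>force simp: F_def Cyl_def\<close>)
  have gen0: "cyc0 (cylinder lab 0 L x) \<in> generated F" if "x \<in> S" for x
    using gen[OF that, of 0] by simp
  have up: "cyc0 (T 1 ` W) \<in> generated F"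
    if "x \<in> S" "W \<subseteq> cylinder lab 0 L x" "cyc0 W \<in> generated F" for x W
    by (rule cyc0_shift_up[OF _ that(2) gen0[OF that(1)] gen[OF that(1)] that(3)])
      (use smallCyl that(1) in \<open>auto simp: Cyl_def\<close>)
  have down: "cyc0 (T (- 1) ` W) \<in> generated F"
    if "x \<in> S" "W \<subseteq> cylinder lab 0 L x" "cyc0 W \<in> generated F" for x W
    by (rule cyc0_shift_down[OF _ that(2) gen0[OF that(1)] gen[OF that(1)] that(3)])
      (use smallCyl that(1) in \<open>auto simp: Cyl_def\<close>)
  have right: "cyc0 (cylinder lab p (q + 1) x) \<in> generated F"
    if x: "x \<in> S" and pq: "p \<le> 0" "L \<le> q" and IH: "\<And>x. x \<in> S \<Longrightarrow> cyc0 (cylinder lab p q x) \<in> generated F"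
    for p q x
  proof -
    let ?W1 = "cylinder lab p q x" and ?W2 = "cylinder lab (p + 1) (q + 1) x"
    have "cylinder lab p (q + 1) x = ?W1 \<inter> ?W2"
      unfolding cylinder_def using pq l(1) by (auto simp: L_def)
    moreover have "cyc0 (?W1 \<inter> ?W2) \<in> generated F"
    proof (rule cyc0_Int)
      show "small (cylinder lab (p + 1) q x)" using l(2) pq by (simp add: L_def)
      show "?W1 \<subseteq> cylinder lab (p + 1) q x" "?W2 \<subseteq> cylinder lab (p + 1) q x" by (rule cylinder_mono; simp)+
      show "cyc0 (T (- 1) ` ?W1) \<in> generated F"
        by (rule down[OF x cylinder_mono IH[OF x]]) (use pq in auto)
      show "cyc0 (T 1 ` ?W2) \<in> generated F" using IH[of "T 1 x"] x by (simp add: T_cylinder)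
    qed
    ultimately show ?thesis by simp
  qed
  have left: "cyc0 (cylinder lab (p - 1) q x) \<in> generated F"
    if x: "x \<in> S" and pq: "p \<le> 0" "L \<le> q" and IH: "\<And>x. x \<in> S \<Longrightarrow> cyc0 (cylinder lab p q x) \<in> generated F"
    for p q x
  proof -
    let ?W1 = "cylinder lab (p - 1) (q - 1) x" and ?W2 = "cylinder lab p q x"
    have "cylinder lab (p - 1) q x = ?W1 \<inter> ?W2"
      unfolding cylinder_def using pq l(1) by (auto simp: L_def)
    moreover have "cyc0 (?W1 \<inter> ?W2) \<in> generated F"
    proof (rule cyc0_Int)
      show "small (cylinder lab p (q - 1) x)" using l(2) pq by (simp add: L_def)
      show "?W1 \<subseteq> cylinder lab p (q - 1) x" "?W2 \<subseteq> cylinder lab p (q - 1) x" by (rule cylinder_mono; simp)+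
      show "cyc0 (T 1 ` ?W2) \<in> generated F"
        by (rule up[OF x cylinder_mono IH[OF x]]) (use pq in auto)
      show "cyc0 (T (- 1) ` ?W1) \<in> generated F" using IH[of "T (- 1) x"] x by (simp add: T_cylinder)
    qed
    ultimately show ?thesis by simp
  qed
  have R: "\<forall>x\<in>S. cyc0 (cylinder lab 0 q x) \<in> generated F" if "L \<le> q" for q
    using that
  proof (induction q rule: int_ge_induct)
    case base then show ?case using gen0 by simp
  next
    case (step q) then show ?case using right[of _ 0 q] by simp
  qed
  have LR: "\<forall>x\<in>S. cyc0 (cylinder lab p q x) \<in> generated F" if "p \<le> 0" "L \<le> q" for p q
    using that(1)
  proof (induction p rule: int_le_induct)
    case base then show ?case using R[OF that(2)] by simp
  next
    case (step p) then show ?case using left[of _ p q] that(2) by simp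
  qed
  have all: "cyc0 W \<in> generated F" if W: "W \<in> \<C>" and lev: "levels3 W (- 1) 0 1" for W
  proof -
    obtain m where m: "m \<ge> 0" "\<And>x y. x \<in> S \<Longrightarrow> y \<in> cylinder lab (- m) m x \<Longrightarrow> (y \<in> W) = (x \<in> W)"
      using window_uniform[OF loc_const_mem[OF W]] by metis
    \<comment> \<open>At least \<open>m\<close>, so that cylinders respect \<open>W\<close>, and at
      least \<open>L\<close>, so that their cycles are already known to be generated.\<close>
    define n where "n = max m L"
    have sub: "cylinder lab (- n) n x \<subseteq> W" if "x \<in> W" for x
    proof
      fix y assume "y \<in> cylinder lab (- n) n x"
      then have "y \<in> cylinder lab (- m) m x"
        using cylinder_mono[of "- n" "- m" m n lab x] by (auto simp: n_def)
      then show "y \<in> W" using m(2)[of x y] that clopen_subset[OF W] by blast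
    qed
    show ?thesis
    proof (rule cyc0_union[OF _ _ _ lev])
      show "finite (cylinder lab (- n) n ` W)"
        using finite_subset[OF image_mono[OF clopen_subset[OF W]] finite_cylinders] .
      show "\<Union>(cylinder lab (- n) n ` W) = W"
      proof
        show "\<Union>(cylinder lab (- n) n ` W) \<subseteq> W" using sub by (rule UN_least)
        show "W \<subseteq> \<Union>(cylinder lab (- n) n ` W)"
        proof
          fix x assume x: "x \<in> W"
          then have "x \<in> S" using clopen_subset[OF W] by blast
          from mem_cylinder_self[OF this] show "x \<in> \<Union>(cylinder lab (- n) n ` W)" using x by (rule UN_I[rotated])
        qed
      qed
      show "disjoint (cylinder lab (- n) n ` W)"
      proof (rule disjointI)
        fix D E assume "D \<in> cylinder lab (- n) n ` W" "E \<in> cylinder lab (- n) n ` W" and ne: "D \<noteq> E"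
        then obtain x y where D: "D = cylinder lab (- n) n x" and E: "E = cylinder lab (- n) n y" by blast
        show "D \<inter> E = {}"
        proof (rule ccontr)
          assume "D \<inter> E \<noteq> {}"
          then obtain z where "z \<in> D" "z \<in> E" by blast
          then have "D = E" unfolding D E using cylinder_eq[of z] by metis
          then show False using ne by contradiction
        qed
      qed
      show "cyc0 D \<in> generated F" if D: "D \<in> cylinder lab (- n) n ` W" for D
      proof -
        obtain x where x: "x \<in> W" "D = cylinder lab (- n) n x" using D by blast
        have "x \<in> S" using x(1) clopen_subset[OF W] by blast
        moreover have "- n \<le> 0" "L \<le> n" using l(1) by (simp_all add: n_def L_def)
        ultimately show ?thesis unfolding x(2) using LR by blast
      qed
    qed
  qed
  have Falt: "F \<subseteq> alt_group"
  proof
    fix g assume "g \<in> F"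
    then obtain j E where E: "E \<in> Cyl" and g: "g = cyc0 (T j ` E)" by (auto simp: F_def)
    have "levels3 (T j ` E) (- 1) 0 1"
      unfolding levels3_T by (rule small_levels3[OF smallCyl(1)[OF E] order_refl]) auto
    then show "g \<in> alt_group" unfolding g using cyc_alt_group[OF clopen_T[OF smallCyl(2)[OF E]]] by blast
  qed
  have double: "swap A f \<circ> swap A h \<in> generated F"
    if A: "A \<in> \<C>" and f: "f \<in> full" and h: "h \<in> full"
      and df: "A \<inter> f ` A = {}" and dh: "A \<inter> h ` A = {}" and dfh: "f ` A \<inter> h ` A = {}" for A f h
  proof -
    have "D \<subseteq> A \<longrightarrow> swap D f \<circ> swap D h \<in> generated F" if "D \<in> \<C>" for D
      using that
    proof (induction rule: clopen_induct)
      case (local x)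
      obtain B1 a where B1: "B1 \<in> \<C>" "x \<in> B1" "\<And>y. y \<in> B1 \<Longrightarrow> cocycle f y = a"
        using loc_constE[OF loc_const_cocycle[OF f] local] by metis
      obtain B2 b where B2: "B2 \<in> \<C>" "x \<in> B2" "\<And>y. y \<in> B2 \<Longrightarrow> cocycle h y = b"
        using loc_constE[OF loc_const_cocycle[OF h] local] by metis
      \<comment> \<open>Covers the levels 0, \<open>a\<close> and \<open>b\<close>; two levels
        between \<open>-K\<close> and \<open>K\<close> differ by at most \<open>2 * K\<close>, the
        range of returns excluded next.\<close>
      define K where "K = \<bar>a\<bar> + \<bar>b\<bar> + 2"
      obtain B3 where B3: "B3 \<in> \<C>" "x \<in> B3" "\<And>j. j \<in> {- 2 * K..2 * K} - {0} \<Longrightarrow> T j ` B3 \<inter> B3 = {}"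
        by (rule small_neighbourhood[OF local, of "{- 2 * K..2 * K} - {0}"]) auto
      have main: "swap D f \<circ> swap D h \<in> generated F" if D: "D \<in> \<C>" "D \<subseteq> B1 \<inter> B2 \<inter> B3" "D \<subseteq> A" for D
      proof (cases "D = {}")
        case True
        then show ?thesis by (simp only: swap_empty comp_id generated_id)
      next
        case False
        have DS: "D \<subseteq> S" using clopen_subset[OF D(1)] .
        have fD: "f y = T a y" and hD: "h y = T b y" if "y \<in> D" for y
          using that D(2) DS full_apply[OF f, of y] full_apply[OF h, of y] B1(3)[of y] B2(3)[of y] by auto
        have sw: "swap D f = swap D (T a)" "swap D h = swap D (T b)"
          by (rule swap_cong; simp add: fD hD f h T_full)+
        have lev: "T i ` D \<inter> T j ` D = {}" if ij: "- K \<le> i" "i < j" "j \<le> K" for i j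
        proof (rule ccontr)
          assume "T i ` D \<inter> T j ` D \<noteq> {}"
          then obtain y z where yz: "y \<in> D" "z \<in> D" "T i y = T j z" by blast
          then have "T (i - j) y \<in> B3" using T_eqD[of i y j z] D(2) by auto
          moreover have "T (i - j) ` B3 \<inter> B3 = {}" using ij by (intro B3(3)) auto
          ultimately show False using yz(1) D(2) by blast
        qed
        \<comment> \<open>Distinctness of 0, \<open>a\<close> and \<open>b\<close> is read off at
          one point, which is why empty \<open>D\<close> is set apart.\<close>
        obtain y where y: "y \<in> D" using False by blast
        have "y \<in> A" using y D(3) by blast
        then have "f y \<in> f ` A" "h y \<in> h ` A" by simp_all
        then have "f y \<noteq> y" "h y \<noteq> y" "f y \<noteq> h y"
          using \<open>y \<in> A\<close> df dh dfh by (metis IntI empty_iff)+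
        then have ab: "a \<noteq> 0" "b \<noteq> 0" "a \<noteq> b" using fD[OF y] hD[OF y] by (auto simp: T_0)
        have lev': "T i ` D \<inter> T j ` D = {}" if ij: "i \<noteq> j" "\<bar>i\<bar> \<le> K" "\<bar>j\<bar> \<le> K" for i j
        proof -
          have b: "- K \<le> i" "i \<le> K" "- K \<le> j" "j \<le> K" using ij by linarith+
          show ?thesis
          proof (cases "i < j")
            case True then show ?thesis by (rule lev[OF b(1) _ b(4)])
          next
            case False
            then have "j < i" using ij(1) by simp
            from lev[OF b(3) this b(2)] show ?thesis by (simp only: Int_commute)
          qed
        qed
        have l3: "levels3 D 0 b a" unfolding levels3_def
          by (intro conjI lev') (use ab in \<open>auto simp: K_def\<close>)
        have "cyc D 0 b a \<in> generated F"
        proof (rule cyc_generate_consecutive[OF lev])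
          fix i assume i: "- K \<le> i" "i + 2 \<le> K"
          have "levels3 D i (i + 1) (i + 2)" unfolding levels3_def using i by (intro conjI lev') auto
          then have "cyc0 (T (i + 1) ` D) \<in> generated F"
            by (intro all clopen_T D(1)) (simp add: levels3_T add.commute)
          then show "cyc D i (i + 1) (i + 2) \<in> generated F" by (simp add: cyc0_T add.commute)
        qed (use ab in \<open>auto simp: K_def\<close>)
        then show ?thesis using cyc_eq_double_swap[OF l3] by (simp add: sw)
      qed
      show ?case
      proof (intro bexI[of _ "B1 \<inter> B2 \<inter> B3"] conjI ballI impI)
        show "x \<in> B1 \<inter> B2 \<inter> B3" using B1(2) B2(2) B3(2) by simp
        show "B1 \<inter> B2 \<inter> B3 \<in> \<C>" using B1(1) B2(1) B3(1) by (intro clopen_Int)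
      qed (rule main)
    next
      case (Un D E)
      show ?case
      proof
        assume sub: "D \<union> E \<subseteq> A"
        have DA: "D \<subseteq> A" and EA: "E \<subseteq> A" using sub by auto
        have eq: "swap (D \<union> E) f = swap D f \<circ> swap E f" "swap (D \<union> E) h = swap D h \<circ> swap E h"
          by (rule swap_Un[OF f disjoint_image_subset[OF df sub sub] Un(3)]
              swap_Un[OF h disjoint_image_subset[OF dh sub sub] Un(3)])+
        have D: "D \<inter> h ` D = {}" and E: "E \<inter> f ` E = {}"
          using disjoint_image_subset[OF dh DA DA] disjoint_image_subset[OF df EA EA] .
        have fE: "f ` E \<inter> h ` D = {}" using image_mono[OF EA, of f] image_mono[OF DA, of h] dfh by auto
        note dj = Un(3) fE disjoint_image_subset[OF df DA EA] disjoint_image_subset[OF dh EA DA]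
        have fix_h: "swap D h x = x" if "x \<in> E \<union> f ` E" for x
          using that dj by (intro swap_apply(3)[OF h D]) auto
        have fix_f: "swap E f x = x" if "x \<in> D \<union> h ` D" for x
          using that dj by (intro swap_apply(3)[OF f E]) auto
        \<comment> \<open>The factors have disjoint supports, because base and both images are
          pairwise disjoint; exchanging them groups the product by \<open>D\<close> and
          \<open>E\<close>.\<close>
        have "swap E f \<circ> swap D h = swap D h \<circ> swap E f"
        proof
          fix x
          consider "x \<in> E" | y where "y \<in> E" "x = f y" | "x \<in> D" | y where "y \<in> D" "x = h y"
            | "x \<notin> E \<union> f ` E" "x \<notin> D \<union> h ` D" by blast
          then show "(swap E f \<circ> swap D h) x = (swap D h \<circ> swap E f) x"
          proof cases
            case 5
            then show ?thesis using swap_apply(3)[OF f E, of x] swap_apply(3)[OF h D, of x] by simp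
          qed (simp_all add: fix_f fix_h swap_apply(1,2)[OF f E] swap_apply(1,2)[OF h D])
        qed
        then have "swap (D \<union> E) f \<circ> swap (D \<union> E) h = (swap D f \<circ> swap D h) \<circ> (swap E f \<circ> swap E h)"
          unfolding eq by (metis comp_assoc)
        then show "swap (D \<union> E) f \<circ> swap (D \<union> E) h \<in> generated F"
          using Un(4,5) sub generated_comp by (metis Un_subset_iff)
      qed
    qed
    then show ?thesis using A by simp
  qed
  have "alt_group \<subseteq> generated F"
    unfolding alt_group_def by (rule generated_subset) (clarify, rule double)
  moreover have "generated F \<subseteq> alt_group"
    using generated_subset[OF Falt[unfolded alt_group_def]] unfolding alt_group_def .
  ultimately show ?thesis using that finF Falt by blast
qed

end

end

section \<open>Relative size of commensurate sets\<close>

definition card_diff :: "'a set \<Rightarrow> 'a set \<Rightarrow> int" where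
  "card_diff A B = int (card (A - B)) - int (card (B - A))"

text \<open>\<open>card\<close> of an infinite set is 0, so \<open>card_diff\<close> measures
  something only for sets with finite differences.\<close>

definition commensurate :: "'a set \<Rightarrow> 'a set \<Rightarrow> bool" where
  "commensurate A B \<longleftrightarrow> finite (A - B) \<and> finite (B - A)"

lemma commensurate_sym: "commensurate A B \<Longrightarrow> commensurate B A"
  by (simp add: commensurate_def)

lemma commensurate_trans: "commensurate A B \<Longrightarrow> commensurate B C \<Longrightarrow> commensurate A C"
proof -
  assume AB: "commensurate A B" and BC: "commensurate B C"
  have "A - C \<subseteq> (A - B) \<union> (B - C)" "C - A \<subseteq> (B - A) \<union> (C - B)" by auto
  then show ?thesis using AB BC unfolding commensurate_def by (meson finite_UnI finite_subset)
qed

lemma card_diff_finite: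
  assumes "finite P" "finite Q" shows "card_diff P Q = int (card P) - int (card Q)"
proof -
  have "card P = card (P - Q) + card (P \<inter> Q)" "card Q = card (Q - P) + card (P \<inter> Q)"
    using assms card_Int_Diff[of P Q] card_Int_Diff[of Q P] by (simp_all add: Int_commute)
  then show ?thesis by (simp add: card_diff_def)
qed

lemma card_diff_trans:
  assumes "commensurate A B" "commensurate B C"
  shows "card_diff A C = card_diff A B + card_diff B C"
proof -
  \<comment> \<open>Cutting all three sets down to this finite set changes none of the differences,
    and for finite sets \<open>card_diff\<close> is a difference of cardinalities.\<close>
  define K where "K = (A - B) \<union> (B - A) \<union> (B - C) \<union> (C - B)"
  have K: "finite K" using assms by (simp add: K_def commensurate_def)
  have eq: "card_diff X Y = card_diff (X \<inter> K) (Y \<inter> K)" if "X - Y \<subseteq> K" "Y - X \<subseteq> K" for X Y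
  proof -
    have "X - Y = X \<inter> K - Y \<inter> K" "Y - X = Y \<inter> K - X \<inter> K" using that by auto
    then show ?thesis by (simp add: card_diff_def)
  qed
  have "card_diff A B = card_diff (A \<inter> K) (B \<inter> K)" "card_diff B C = card_diff (B \<inter> K) (C \<inter> K)"
    "card_diff A C = card_diff (A \<inter> K) (C \<inter> K)"
    by (rule eq; auto simp: K_def)+
  then show ?thesis using K by (simp add: card_diff_finite)
qed

lemma card_diff_image: "inj g \<Longrightarrow> card_diff (g ` A) (g ` B) = card_diff A B"
  unfolding card_diff_def by (simp add: image_set_diff[symmetric] card_image inj_on_subset)

lemma card_diff_swap: "card_diff B A = - card_diff A B"
  by (simp add: card_diff_def)

context clopen_system
begin

subsection \<open>The index as a flow across a cut\<close>

text \<open>The point \<open>x\<close> itself is excluded: the cut lies between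
  \<open>T (- 1) x\<close> and \<open>x\<close>. With this choice \<open>T 1\<close> has flow
  1.\<close>

definition past :: "'a \<Rightarrow> 'a set" where
  "past x = (\<lambda>j. T j x) ` {..<0}"

definition flow :: "('a \<Rightarrow> 'a) \<Rightarrow> 'a \<Rightarrow> int" where
  "flow g x = card_diff (g ` past x) (past x)"

lemma mem_past: "x \<in> S \<Longrightarrow> T k x \<in> past x \<longleftrightarrow> k < 0"
  by (auto simp: past_def T_cancel)

lemma past_T: "T 1 ` past x = insert x (past x)" "past (T 1 x) = insert x (past x)"
proof -
  have eq: "(\<lambda>j. T (j + 1) x) ` {..<0} = insert x ((\<lambda>j. T j x) ` {..<0})"
  proof -
    have "(\<lambda>j. T (j + 1) x) ` {..<0} = (\<lambda>j. T j x) ` (\<lambda>j. j + 1) ` {..<0::int}" by (simp add: image_image)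
    also have "(\<lambda>j. j + 1) ` {..<0::int} = insert 0 {..<0}"
      by (auto simp: image_iff intro!: bexI[of _ "_ - 1"])
    finally show ?thesis by (simp add: T_0)
  qed
  show "T 1 ` past x = insert x (past x)" "past (T 1 x) = insert x (past x)"
    using eq by (simp_all add: past_def image_image T_T add.commute)
qed

lemma full_orbit: "g \<in> full \<Longrightarrow> x \<in> S \<Longrightarrow> g (T j x) = T (j + cocycle g (T j x)) x"
  using full_apply[of g "T j x"] by (simp add: T_T add.commute)

lemma flow_sets:
  assumes g: "g \<in> full" and x: "x \<in> S"
  shows "g ` past x - past x = (\<lambda>j. g (T j x)) ` {j. j < 0 \<and> j + cocycle g (T j x) \<ge> 0}"
    and "past x - g ` past x = (\<lambda>j. g (T j x)) ` {j. j \<ge> 0 \<and> j + cocycle g (T j x) < 0}"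
proof -
  have mem: "g (T j x) \<in> past x \<longleftrightarrow> j + cocycle g (T j x) < 0" for j
    using mem_past[OF x] full_orbit[OF g x] by simp
  have mem': "g (T j x) \<in> g ` past x \<longleftrightarrow> j < 0" for j
    using mem_past[OF x] full_inj[OF g] by auto
  have "g ` past x = (\<lambda>j. g (T j x)) ` {..<0}" by (simp add: past_def image_image)
  then show "g ` past x - past x = (\<lambda>j. g (T j x)) ` {j. j < 0 \<and> j + cocycle g (T j x) \<ge> 0}"
    using mem by (auto simp: not_less)
  show "past x - g ` past x = (\<lambda>j. g (T j x)) ` {j. j \<ge> 0 \<and> j + cocycle g (T j x) < 0}"
  proof (intro equalityI subsetI)
    fix y assume y: "y \<in> past x - g ` past x"
    then obtain k where k: "y = T k x" by (auto simp: past_def)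
    have "inv g y = T (k + cocycle (inv g) (T k x)) x" using full_orbit[OF inv_full[OF g] x] k by simp
    then obtain j where "inv g y = T j x" by blast
    then have "y = g (T j x)" using g by (metis full_inv(2))
    then show "y \<in> (\<lambda>j. g (T j x)) ` {j. j \<ge> 0 \<and> j + cocycle g (T j x) < 0}"
      using y mem[of j] mem'[of j] by auto
  next
    fix y assume "y \<in> (\<lambda>j. g (T j x)) ` {j. j \<ge> 0 \<and> j + cocycle g (T j x) < 0}"
    then obtain j where "j \<ge> 0" "j + cocycle g (T j x) < 0" "y = g (T j x)" by blast
    then show "y \<in> past x - g ` past x" using mem[of j] mem'[of j] by simp
  qed
qed

lemma inj_orbit: "g \<in> full \<Longrightarrow> x \<in> S \<Longrightarrow> inj_on (\<lambda>j. g (T j x)) J"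
  by (auto simp: inj_on_def full_inj T_cancel)

lemma commensurate_past:
  assumes g: "g \<in> full" and x: "x \<in> S" shows "commensurate (g ` past x) (past x)"
proof -
  obtain N where N: "N \<ge> 0" "\<And>x. x \<in> S \<Longrightarrow> \<bar>cocycle g x\<bar> \<le> N"
    by (rule cocycle_bound[OF g]) blast
  have b: "\<bar>cocycle g (T j x)\<bar> \<le> N" for j using N(2) x by simp
  have "finite {j. j < 0 \<and> j + cocycle g (T j x) \<ge> 0}"
  proof (rule finite_subset[of _ "{- N..0}"])
    show "{j. j < 0 \<and> j + cocycle g (T j x) \<ge> 0} \<subseteq> {- N..0}"
      using b by (auto simp: abs_le_iff) (smt (verit))
  qed simp
  moreover have "finite {j. j \<ge> 0 \<and> j + cocycle g (T j x) < 0}"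
  proof (rule finite_subset[of _ "{0..N}"])
    show "{j. j \<ge> 0 \<and> j + cocycle g (T j x) < 0} \<subseteq> {0..N}"
      using b by (auto simp: abs_le_iff) (smt (verit))
  qed simp
  ultimately show ?thesis unfolding commensurate_def flow_sets[OF g x] by simp
qed

text \<open>As \<open>g\<close> moves points by at most \<open>N\<close>, only these positions can
  cross. The flow is thereby a function of finitely many cocycle values, which yields its local
  constancy and, later, its integral.\<close>

lemma flow_eq:
  assumes g: "g \<in> full" and x: "x \<in> S" and N: "\<And>x. x \<in> S \<Longrightarrow> \<bar>cocycle g x\<bar> \<le> N"
  shows "flow g x = int (card {j\<in>{- N..<0}. j + cocycle g (T j x) \<ge> 0})
    - int (card {j\<in>{0..<N}. j + cocycle g (T j x) < 0})"
proof -
  have b: "\<bar>cocycle g (T j x)\<bar> \<le> N" for j using N x by simp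
  have "{j. j < 0 \<and> j + cocycle g (T j x) \<ge> 0} = {j\<in>{- N..<0}. j + cocycle g (T j x) \<ge> 0}"
    using b by (auto simp: abs_le_iff) (smt (verit))
  moreover have "{j. j \<ge> 0 \<and> j + cocycle g (T j x) < 0} = {j\<in>{0..<N}. j + cocycle g (T j x) < 0}"
    using b by (auto simp: abs_le_iff) (smt (verit))
  ultimately show ?thesis
    by (simp add: flow_def card_diff_def flow_sets[OF g x] card_image[OF inj_orbit[OF g x]])
qed

lemma full_inj_fun: "g \<in> full \<Longrightarrow> inj g"
  using full_bij bij_is_inj by blast

text \<open>Compare through the image of the past under \<open>g\<close>: the first part is the flow
  of \<open>h\<close> carried along by the injection \<open>g\<close>, the second is the flow of
  \<open>g\<close>.\<close>

lemma flow_comp: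
  assumes g: "g \<in> full" and h: "h \<in> full" and x: "x \<in> S"
  shows "flow (g \<circ> h) x = flow g x + flow h x"
proof -
  have "commensurate (g ` h ` past x) (g ` past x)"
    using commensurate_past[OF h x] full_inj_fun[OF g] unfolding commensurate_def
    by (simp add: image_set_diff[symmetric])
  from card_diff_trans[OF this commensurate_past[OF g x]] show ?thesis
    unfolding flow_def image_comp[symmetric] card_diff_image[OF full_inj_fun[OF g]] by simp
qed

lemma flow_id: "flow id x = 0"
  by (simp add: flow_def card_diff_def)

lemma flow_inv: "g \<in> full \<Longrightarrow> x \<in> S \<Longrightarrow> flow (inv g) x = - flow g x"
proof -
  assume g: "g \<in> full" and x: "x \<in> S"
  have "inv g \<circ> g = id" using g by (simp add: fun_eq_iff)
  then show ?thesis using flow_comp[OF inv_full[OF g] g x] flow_id by simp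
qed

lemma card_diff_past: "x \<in> S \<Longrightarrow> card_diff (insert x (past x)) (past x) = 1"
proof -
  assume x: "x \<in> S"
  have "x \<notin> past x" using mem_past[OF x, of 0] by (simp add: T_0)
  then have "insert x (past x) - past x = {x}" "past x - insert x (past x) = {}" by auto
  then show ?thesis by (simp add: card_diff_def)
qed

lemma flow_T: "x \<in> S \<Longrightarrow> flow (T 1) x = 1"
  by (simp add: flow_def past_T card_diff_past)

text \<open>Moving the cut by one adds a point to the past and its image to the image of the past;
  the two contributions cancel.\<close>

lemma flow_step:
  assumes g: "g \<in> full" and x: "x \<in> S" shows "flow g (T 1 x) = flow g x"
proof -
  let ?P = "past x" and ?Q = "past (T 1 x)"
  have QP: "commensurate ?Q ?P" by (simp add: past_T commensurate_def insert_Diff_if)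
  have gQP: "commensurate (g ` ?Q) (g ` ?P)"
    using QP full_inj_fun[OF g] unfolding commensurate_def by (simp add: image_set_diff[symmetric])
  have gP: "commensurate (g ` ?P) ?P" by (rule commensurate_past[OF g x])
  have "card_diff (g ` ?Q) ?Q = card_diff (g ` ?Q) (g ` ?P) + (card_diff (g ` ?P) ?P + card_diff ?P ?Q)"
    using card_diff_trans[OF gQP commensurate_trans[OF gP commensurate_sym[OF QP]]]
      card_diff_trans[OF gP commensurate_sym[OF QP]] by simp
  then show ?thesis
    using card_diff_swap[of ?P ?Q] by (simp add: flow_def card_diff_image[OF full_inj_fun[OF g]])
qed

lemma flow_orbit:
  assumes g: "g \<in> full" and x: "x \<in> S" shows "flow g (T k x) = flow g x"
proof (induction k rule: int_induct[where k=0])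
  case base then show ?case by (simp add: T_0)
next
  case (step1 i)
  then show ?case using flow_step[OF g, of "T i x"] x by (simp add: T_T add.commute)
next
  case (step2 i)
  then show ?case using flow_step[OF g, of "T (i - 1) x"] x by (simp add: T_T)
qed

lemma loc_const_flow:
  assumes g: "g \<in> full" shows "loc_const (flow g)"
proof -
  obtain N where N: "N \<ge> 0" "\<And>x. x \<in> S \<Longrightarrow> \<bar>cocycle g x\<bar> \<le> N"
    by (rule cocycle_bound[OF g]) blast
  have c: "loc_const (\<lambda>x. cocycle g (T j x))" for j by (rule loc_const_T[OF loc_const_cocycle[OF g]])
  have c1: "loc_const (\<lambda>x. j + cocycle g (T j x) \<ge> 0)" for j
    by (rule loc_const_apply[OF c, where F="\<lambda>n. j + n \<ge> 0"])
  have c2: "loc_const (\<lambda>x. j + cocycle g (T j x) < 0)" for j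
    by (rule loc_const_apply[OF c, where F="\<lambda>n. j + n < 0"])
  have 1: "loc_const (\<lambda>x. {j\<in>{- N..<0}. j + cocycle g (T j x) \<ge> 0})"
    by (rule loc_const_Collect) (simp, rule c1)
  have 2: "loc_const (\<lambda>x. {j\<in>{0..<N}. j + cocycle g (T j x) < 0})"
    by (rule loc_const_Collect) (simp, rule c2)
  have "loc_const (\<lambda>x. int (card {j\<in>{- N..<0}. j + cocycle g (T j x) \<ge> 0})
    - int (card {j\<in>{0..<N}. j + cocycle g (T j x) < 0}))"
    by (rule loc_const_apply2[OF 1 2, where F="\<lambda>I J. int (card I) - int (card J)"])
  then show ?thesis by (subst loc_const_cong[OF flow_eq[OF g _ N(2)]])
qed

text \<open>A level set of the flow is clopen and invariant under the system, and every orbit meets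
  it.\<close>

lemma flow_constant:
  assumes g: "g \<in> full" and x: "x \<in> S" and y: "y \<in> S" shows "flow g x = flow g y"
proof -
  have "{z\<in>S. flow g z = flow g x} \<in> \<C>" by (rule loc_const_clopen[OF loc_const_flow[OF g]])
  moreover have "x \<in> {z\<in>S. flow g z = flow g x}" using x by simp
  ultimately obtain k where "flow g (T k y) = flow g x" using orbit_meets[OF _ _ y] by blast
  then show ?thesis using flow_orbit[OF g y] by simp
qed

definition full_0 :: "('a \<Rightarrow> 'a) set" where
  "full_0 = {g\<in>full. \<forall>x\<in>S. flow g x = 0}"

text \<open>A transposition is an involution, so twice its flow is zero.\<close>

lemma swap_group_full_0: "swap_group \<subseteq> full_0"
proof
  fix g assume "g \<in> swap_group"
  then have "g \<in> full \<and> (\<forall>x\<in>S. flow g x = 0)"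
    unfolding swap_group_def
  proof induction
    case generated_id
    then show ?case by (simp only: id_full flow_id) simp
  next
    case (generated_incl g)
    then obtain A f where g: "g = swap A f" and A: "A \<in> \<C>" and f: "f \<in> full" and d: "A \<inter> f ` A = {}" by auto
    have gf: "g \<in> full" unfolding g by (rule swap_full[OF A f d])
    have gg: "g \<circ> g = id" unfolding g by (rule swap_comp_swap[OF f d])
    have "flow g x = 0" if "x \<in> S" for x
      using flow_comp[OF gf gf that] unfolding gg flow_id by simp
    then show ?case using gf by blast
  next
    case (generated_comp g h)
    then have "flow (g \<circ> h) x = 0" if "x \<in> S" for x using flow_comp[of g h] that by simp
    then show ?case using comp_full generated_comp.IH by blast
  next
    case (generated_inv g)
    then show ?case using inv_full[of g] flow_inv[of g] by simp
  qed
  then show "g \<in> full_0" by (simp add: full_0_def)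
qed

text \<open>Selection sort: if \<open>k\<close> moves points only within the fibres of \<open>x \<mapsto> T (- r x) x\<close>, on which
  the level \<open>r\<close> is injective, then the levels can be put in place one after the other.\<close>

lemma sort_levels:
  assumes r: "loc_const r" and M: "\<And>x. x \<in> S \<Longrightarrow> r x < M"
  shows "k \<in> full \<Longrightarrow> (\<And>x. x \<in> S \<Longrightarrow> T (- int (r (k x))) (k x) = T (- int (r x)) x) \<Longrightarrow>
    (\<And>x. x \<in> S \<Longrightarrow> r x < m \<Longrightarrow> k x = x) \<Longrightarrow> m \<le> M \<Longrightarrow> k \<in> swap_group"
proof (induction "M - m" arbitrary: k m)
  case 0
  have "k = id"
  proof
    fix x show "k x = id x"
      using 0 M[of x] full_outside[OF 0(2), of x] by (cases "x \<in> S") auto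
  qed
  then show ?case by (simp only: swap_group_id)
next
  case (Suc d)
  note k = Suc.prems(1) and base = Suc.prems(2) and fixed = Suc.prems(3)
  have kS: "k x \<in> S \<longleftrightarrow> x \<in> S" for x using k by simp
  \<comment> \<open>The points of level \<open>m\<close> that \<open>k\<close> moves. None goes to
    another of them, since level and fibre determine a point. Exchanging them with their images
    makes \<open>t \<circ> k\<close> fix level \<open>m\<close> and leaves the lower levels
    alone.\<close>
  define A where "A = {x\<in>S. (r x, cocycle k x) \<in> {m} \<times> - {0}}"
  have A: "A \<in> \<C>" unfolding A_def by (rule loc_const_clopen[OF loc_const_pair[OF r loc_const_cocycle[OF k]]])
  have memA: "x \<in> A \<longleftrightarrow> x \<in> S \<and> r x = m \<and> k x \<noteq> x" for x
    using full_apply[OF k, of x] T_free[of x "cocycle k x"] by (auto simp: A_def T_0)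
  have disj: "A \<inter> k ` A = {}"
  proof (rule ccontr)
    assume "A \<inter> k ` A \<noteq> {}"
    then obtain x where x: "x \<in> A" "k x \<in> A" by blast
    then have "T (- int m) (k x) = T (- int m) x" using base[of x] memA by simp
    then show False using x memA by simp
  qed
  define t where "t = swap A k"
  have t: "t \<in> swap_group" unfolding t_def by (rule swap_in_swap_group[OF A k disj])
  have tf: "t \<in> full" using t swap_group_full by blast
  note ta = swap_apply[OF k disj, folded t_def]
  have kA: "x \<notin> k ` A" if "k x = x" for x
  proof
    assume "x \<in> k ` A"
    then obtain y where "y \<in> A" "x = k y" by blast
    moreover from this have "x = y" using that full_inj[OF k, of x y] by simp
    ultimately show False using memA that by simp
  qed
  have tb: "T (- int (r (t y))) (t y) = T (- int (r y)) y" if y: "y \<in> S" for y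
  proof -
    consider "y \<in> A" | x where "x \<in> A" "y = k x" | "y \<notin> A" "y \<notin> k ` A" by blast
    then show ?thesis
    proof cases
      case 1 then show ?thesis using ta(1) base[OF y] by simp
    next
      case 2 then show ?thesis using ta(2)[of x] base[of x] memA by simp
    next
      case 3 then show ?thesis using ta(3)[of y] by simp
    qed
  qed
  have "t \<circ> k \<in> swap_group"
  proof (rule Suc.hyps(1)[of "Suc m"])
    show "t \<circ> k \<in> full" by (rule comp_full[OF tf k])
    show "T (- int (r ((t \<circ> k) x))) ((t \<circ> k) x) = T (- int (r x)) x" if "x \<in> S" for x
      using tb[of "k x"] base[OF that] that kS by simp
    show "(t \<circ> k) x = x" if x: "x \<in> S" and rx: "r x < Suc m" for x
    proof (cases "k x = x")
      case True
      then have "x \<notin> A" using memA by blast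
      then have "t x = x" by (rule ta(3)[OF _ kA[OF True]])
      then show ?thesis by (simp only: True comp_apply)
    next
      case False
      then have "\<not> r x < m" using fixed[OF x] by blast
      then have "x \<in> A" unfolding memA using x rx False by simp
      from ta(2)[OF this] show ?thesis by (simp only: comp_apply)
    qed
  qed (use Suc.hyps(2) Suc.prems in auto)
  moreover have "t \<circ> (t \<circ> k) = k" using swap_swap[OF k disj] by (simp add: fun_eq_iff t_def)
  ultimately show ?case using swap_group_comp[OF t] by metis
qed

lemma mem_image_past: "g \<in> full \<Longrightarrow> x \<in> S \<Longrightarrow> T a x \<in> g ` past x \<longleftrightarrow> a + cocycle (inv g) (T a x) < 0"
proof -
  assume g: "g \<in> full" and x: "x \<in> S"
  show ?thesis unfolding mem_full_image[OF g] full_orbit[OF inv_full[OF g] x] mem_past[OF x] ..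
qed

lemma loc_const_image_past: "g \<in> full \<Longrightarrow> loc_const (\<lambda>x. T a x \<in> g ` past x)"
proof -
  assume g: "g \<in> full"
  have c: "loc_const (\<lambda>x. cocycle (inv g) (T a x))" by (rule loc_const_T[OF loc_const_cocycle[OF inv_full[OF g]]])
  have "loc_const (\<lambda>x. a + cocycle (inv g) (T a x) < 0)"
    by (rule loc_const_apply[OF c, where F="\<lambda>n. a + n < 0"])
  then show ?thesis by (subst loc_const_cong[OF mem_image_past[OF g]])
qed

text \<open>An element that crosses none of the cuts at \<open>Y\<close> maps each orbit segment
  between consecutive visits of \<open>Y\<close> to itself. With the height in the segment as level,
  it is sorted by transpositions.\<close>

lemma full_preserving_cuts:
  assumes k: "k \<in> full" and Y: "Y \<in> \<C>" "Y \<noteq> {}" and cut: "\<And>y. y \<in> Y \<Longrightarrow> k ` past y = past y"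
  shows "k \<in> swap_group"
proof -
  have YS: "y \<in> S" if "y \<in> Y" for y using that clopen_subset[OF Y(1)] by blast
  have "S \<subseteq> \<Union>(range (\<lambda>k. T k ` Y))"
  proof
    fix x assume "x \<in> S"
    then obtain k where "T k x \<in> Y" using orbit_meets[OF Y] by blast
    then have "x \<in> T (- k) ` Y" by (simp add: mem_T_image)
    then show "x \<in> \<Union>(range (\<lambda>k. T k ` Y))" by blast
  qed
  moreover have "range (\<lambda>k. T k ` Y) \<subseteq> \<C>" using clopen_T[OF Y(1)] by auto
  ultimately obtain \<V> where V: "\<V> \<subseteq> range (\<lambda>k. T k ` Y)" "finite \<V>" "S \<subseteq> \<Union>\<V>"
    using clopen_compact by metis
  obtain I where I: "finite I" "S \<subseteq> (\<Union>k\<in>I. T k ` Y)" using V by (metis finite_subset_image)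
  define K where "K = Max (insert 0 (abs ` I))"
  have K: "K \<ge> 0" "\<And>i. i \<in> I \<Longrightarrow> \<bar>i\<bar> \<le> K" using I(1) by (simp_all add: K_def)
  \<comment> \<open>Translates of \<open>Y\<close> by at most \<open>K\<close> cover the space.
    Applied to \<open>T (- K) x\<close>, this gives a visit between 0 and \<open>2 * K\<close> steps
    before \<open>x\<close>.\<close>
  have ret: "\<exists>n\<le>nat (2 * K). T (- int n) x \<in> Y" if "x \<in> S" for x
  proof -
    have "T (- K) x \<in> S" using that by simp
    then obtain k where k: "k \<in> I" "T (- K) x \<in> T k ` Y" using I(2) by blast
    moreover have "T (- (K + k)) x = T (- k) (T (- K) x)"
      by (simp only: T_T) (metis add.commute minus_add_distrib)
    ultimately have "T (- (K + k)) x \<in> Y" by (simp only: mem_T_image)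
    moreover have "0 \<le> K + k" "K + k \<le> 2 * K" using K(2)[OF k(1)] by auto
    ultimately show ?thesis by (intro exI[of _ "nat (K + k)"]) auto
  qed
  \<comment> \<open>The height of \<open>x\<close> above its last visit to \<open>Y\<close>. Being
    at most \<open>2 * K\<close>, it depends on finitely many membership tests and is locally
    constant.\<close>
  define r where "r x = (LEAST n. T (- int n) x \<in> Y)" for x
  have r: "T (- int (r x)) x \<in> Y" "r x \<le> nat (2 * K)" if "x \<in> S" for x
    using ret[OF that] LeastI_ex[of "\<lambda>n. T (- int n) x \<in> Y"] Least_le[of "\<lambda>n. T (- int n) x \<in> Y"]
    unfolding r_def by (blast, meson order_trans)
  have r_least: "T (- int n) x \<notin> Y" if "n < r x" for n x
    using not_less_Least that unfolding r_def by blast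
  have "loc_const (\<lambda>x. T (- int n) x \<in> Y)" for n by (rule loc_const_T[OF loc_const_mem[OF Y(1)]])
  then have lc: "loc_const (\<lambda>x. {n\<in>{..nat (2 * K)}. T (- int n) x \<in> Y})"
    using loc_const_Collect[of "{..nat (2 * K)}" "\<lambda>n x. T (- int n) x \<in> Y"] by simp
  have "loc_const (\<lambda>x. LEAST n. n \<in> {n\<in>{..nat (2 * K)}. T (- int n) x \<in> Y})" (is "loc_const ?r")
    by (rule loc_const_apply[OF lc, where F="\<lambda>I. LEAST n. n \<in> I"])
  moreover have r_eq: "r x = ?r x" if "x \<in> S" for x
  proof (rule Least_equality[symmetric])
    show "r x \<in> {n\<in>{..nat (2 * K)}. T (- int n) x \<in> Y}" using r[OF that] by simp
    fix n assume "n \<in> {n\<in>{..nat (2 * K)}. T (- int n) x \<in> Y}"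
    then have "T (- int n) x \<in> Y" by simp
    then show "r x \<le> n" using r_least[of n x] by (cases "n < r x") simp_all
  qed
  ultimately have lr: "loc_const r" using loc_const_cong[of r ?r, OF r_eq] by simp
  have base: "T (- int (r (k x))) (k x) = T (- int (r x)) x" if x: "x \<in> S" for x
  proof -
    define y where "y = T (- int (r x)) x"
    have y: "y \<in> Y" "x = T (int (r x)) y" using r(1)[OF x] by (simp_all add: y_def)
    obtain j where j: "k x = T j y" using full_apply[OF k x] y(2) by (metis T_T)
    have cut_j: "j < c \<longleftrightarrow> int (r x) < c" if "T c y \<in> Y" for c
    proof -
      let ?z = "T c y"
      have zS: "?z \<in> S" using YS[OF y(1)] by simp
      have "x = T (int (r x) - c) ?z" "k x = T (j - c) ?z" using y(2) j by (simp_all add: T_T)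
      then have "x \<in> past ?z \<longleftrightarrow> int (r x) < c" "k x \<in> past ?z \<longleftrightarrow> j < c"
        using mem_past[OF zS, of "int (r x) - c"] mem_past[OF zS, of "j - c"] by simp_all
      moreover have "k x \<in> past ?z \<longleftrightarrow> x \<in> past ?z"
        using cut[OF that] full_inj[OF k] by (metis image_iff)
      ultimately show ?thesis by simp
    qed
    have "j \<ge> 0" using cut_j[of 0] y(1) by (simp add: T_0)
    have "r (k x) = nat j"
      unfolding r_def
    proof (rule Least_equality)
      show "T (- int (nat j)) (k x) \<in> Y" using \<open>j \<ge> 0\<close> j y(1) by simp
      fix n assume "T (- int n) (k x) \<in> Y"
      then have c: "T (j - int n) y \<in> Y" by (simp add: j T_T)
      \<comment> \<open>A visit at a positive height not above \<open>k x\<close> would, by the cut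
        there, not be above \<open>x\<close> either, against the minimality of
        \<open>r x\<close>.\<close>
      show "nat j \<le> n"
      proof (rule ccontr)
        assume "\<not> nat j \<le> n"
        then have pos: "j - int n > 0" by simp
        have "\<not> int (r x) < j - int n" using cut_j[OF c] by simp
        then have "T (- int (nat (int (r x) - (j - int n)))) x \<in> Y"
          using c by (simp add: y_def T_T)
        moreover have "nat (int (r x) - (j - int n)) < r x" using pos \<open>\<not> int (r x) < j - int n\<close> by linarith
        ultimately show False using r_least by blast
      qed
    qed
    then show ?thesis using j \<open>j \<ge> 0\<close> by (simp add: y_def[symmetric])
  qed
  show ?thesis
    by (rule sort_levels[OF lr, of "Suc (nat (2 * K))" k 0]) (use r(2) k base in \<open>auto simp: less_Suc_eq_le\<close>)
qed


section \<open>Cancelling opposite crossings near a clopen set of cuts\<close>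

lemma both_empty: "A = {} \<or> B = {} \<Longrightarrow> card A = card B \<Longrightarrow> finite A \<Longrightarrow> finite B \<Longrightarrow> A = {} \<and> B = {}"
  by auto

text \<open>Corrections are confined to windows of \<open>N\<close> places on each side of the cuts;
  the element to be corrected moves points by less than \<open>N\<close>, so its crossings land
  inside.\<close>

definition window_map :: "'a set \<Rightarrow> int \<Rightarrow> ('a \<Rightarrow> 'a) \<Rightarrow> bool" where
  "window_map Y N h \<longleftrightarrow> (\<forall>y\<in>Y. \<forall>j\<in>{- N..<N}. \<exists>i\<in>{- N..<N}. h (T j y) = T i y) \<and>
     (\<forall>x. (\<forall>y\<in>Y. \<forall>j\<in>{- N..<N}. x \<noteq> T j y) \<longrightarrow> h x = x)"

context
  fixes Y N assumes Y: "Y \<in> \<C>" and N: "N > 0"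
    and disjY: "\<And>k. k \<in> {- 2 * N..2 * N} - {0} \<Longrightarrow> T k ` Y \<inter> Y = {}"
begin

lemma cut_in_space: "y \<in> Y \<Longrightarrow> y \<in> S"
  using clopen_subset[OF Y] by blast

lemma far_return:
  assumes "y \<in> Y" "T d y \<in> Y" "d \<noteq> 0" shows "\<bar>d\<bar> > 2 * N"
proof (rule ccontr)
  assume "\<not> \<bar>d\<bar> > 2 * N"
  then have "T d ` Y \<inter> Y = {}" using assms(3) by (intro disjY) auto
  then show False using assms(1,2) by blast
qed

lemma window_unique:
  assumes "y \<in> Y" "z \<in> Y" "i \<in> {- N..<N}" "j \<in> {- N..<N}" "T i y = T j z"
  shows "i = j \<and> y = z"
proof -
  have z: "z = T (i - j) y" using T_eqD[OF assms(5)] .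
  have "i - j = 0"
  proof (rule ccontr)
    assume "i - j \<noteq> 0"
    then have "2 * N < \<bar>i - j\<bar>" using far_return[OF assms(1), of "i - j"] assms(2) z by simp
    then show False using assms(3,4) unfolding atLeastLessThan_iff by linarith
  qed
  then show ?thesis using z by (simp add: T_0)
qed

text \<open>A point outside the window of \<open>y\<close> may lie in the window of another cut.
  That cut is more than \<open>2 * N\<close> away, so the point stays on its side of the window of
  \<open>y\<close>.\<close>

lemma window_map_side:
  assumes h: "window_map Y N h" and y: "y \<in> Y"
  obtains c where "h (T e y) = T c y" "- N \<le> e \<Longrightarrow> e < N \<Longrightarrow> - N \<le> c \<and> c < N" "e < - N \<Longrightarrow> c < - N" "N \<le> e \<Longrightarrow> N \<le> c"
proof (cases "e \<in> {- N..<N}")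
  case True
  then obtain i where "i \<in> {- N..<N}" "h (T e y) = T i y" using h y unfolding window_map_def by blast
  then show ?thesis using True by (intro that[of i]) auto
next
  case e: False
  show ?thesis
  proof (cases "\<exists>z\<in>Y. \<exists>j\<in>{- N..<N}. T e y = T j z")
    case True
    then obtain z j where z: "z \<in> Y" "j \<in> {- N..<N}" "T e y = T j z" by blast
    then have zd: "z = T (e - j) y" using T_eqD by blast
    have "e - j \<noteq> 0" using e z(2) by auto
    then have far: "\<bar>e - j\<bar> > 2 * N" using far_return[OF y] z(1) zd by simp
    obtain i where i: "i \<in> {- N..<N}" "h (T j z) = T i z" using h z unfolding window_map_def by blast
    have "h (T e y) = T i z" by (simp only: z(3) i(2))
    also have "\<dots> = T (i + (e - j)) y" by (simp only: zd T_T)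
    finally have heq: "h (T e y) = T (i + (e - j)) y" .
    show ?thesis
      by (rule that[OF heq]; use far i(1) z(2) e in \<open>unfold atLeastLessThan_iff, linarith\<close>)
  next
    case False
    then have "h (T e y) = T e y" using h unfolding window_map_def by blast
    then show ?thesis using e by (intro that[of e]) auto
  qed
qed

text \<open>Used with \<open>b < 0 \<le> a\<close>: then the point at \<open>a\<close> has arrived
  from the past of \<open>y\<close> and the point at \<open>b\<close> from outside it, a pair of
  crossings in opposite directions.\<close>

definition crossing_pair :: "('a \<Rightarrow> 'a) \<Rightarrow> int \<Rightarrow> int \<Rightarrow> 'a \<Rightarrow> bool" where
  "crossing_pair k a b y \<longleftrightarrow> T a y \<in> k ` past y \<and> T b y \<notin> k ` past y"

text \<open>Exchanging the places \<open>a0\<close> and \<open>b0\<close> over the cuts with this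
  pair undoes one crossing in each direction. At these cuts neither place is a landing place of a
  crossing afterwards, so no new pair arises and the removal can be iterated.\<close>

lemma remove_crossing_pair:
  assumes g: "g \<in> full" and a0: "a0 \<in> {0..<N}" and b0: "b0 \<in> {- N..<0}"
  obtains t where "t \<in> swap_group" "window_map Y N t" "\<And>y. y \<in> Y \<Longrightarrow> \<not> crossing_pair (t \<circ> g) a0 b0 y"
    "\<And>a b y. y \<in> Y \<Longrightarrow> a \<in> {0..<N} \<Longrightarrow> b \<in> {- N..<0} \<Longrightarrow> crossing_pair (t \<circ> g) a b y \<Longrightarrow> crossing_pair g a b y"
proof -
  define A where "A = {y\<in>Y. crossing_pair g a0 b0 y}"
  have "A = Y \<inter> ({y\<in>S. T a0 y \<in> g ` past y} - {y\<in>S. T b0 y \<in> g ` past y})"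
    using cut_in_space by (auto simp: A_def crossing_pair_def)
  moreover have "{y\<in>S. T a y \<in> g ` past y} \<in> \<C>" for a
    using loc_const_clopen[OF loc_const_image_past[OF g], where p="\<lambda>b. b"] by simp
  ultimately have A: "A \<in> \<C>" using Y by (simp add: clopen_Int clopen_Diff)
  have AY: "y \<in> Y" if "y \<in> A" for y using that by (simp add: A_def)
  have win0: "a0 \<in> {- N..<N}" "b0 \<in> {- N..<N}" "a0 \<noteq> b0" using a0 b0 by auto
  have im: "T (b0 - a0) ` T a0 ` A = T b0 ` A" by (simp add: T_image_T_image)
  have disj: "T a0 ` A \<inter> T (b0 - a0) ` T a0 ` A = {}"
  proof (rule ccontr)
    assume "T a0 ` A \<inter> T (b0 - a0) ` T a0 ` A \<noteq> {}"
    then obtain y z where "y \<in> A" "z \<in> A" "T a0 y = T b0 z" unfolding im by blast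
    then show False using window_unique[OF AY AY win0(1,2)] win0(3) by blast
  qed
  define t where "t = swap (T a0 ` A) (T (b0 - a0))"
  have tS: "t \<in> swap_group"
    unfolding t_def by (rule swap_in_swap_group[OF clopen_T[OF A] T_full disj])
  have tf: "t \<in> full" using tS swap_group_full by blast
  have tt: "t (t x) = x" for x unfolding t_def by (rule swap_swap[OF T_full disj])
  have t1: "t (T a0 y) = T b0 y" if "y \<in> A" for y
    using swap_apply(1)[OF T_full disj, of "T a0 y"] that by (simp add: t_def T_T)
  have t2: "t (T b0 y) = T a0 y" if "y \<in> A" for y using tt[of "T a0 y"] t1[OF that] by simp
  have t3: "t x = x" if "x \<notin> T a0 ` A" "x \<notin> T b0 ` A" for x
    using swap_apply(3)[OF T_full disj] that unfolding t_def im by blast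
  have t4: "t (T j y) = T j y" if y: "y \<in> Y" and j: "j \<in> {- N..<N}" and no: "y \<in> A \<Longrightarrow> j \<noteq> a0 \<and> j \<noteq> b0" for j y
  proof (rule t3)
    show "T j y \<notin> T a0 ` A"
    proof
      assume "T j y \<in> T a0 ` A"
      then obtain z where "z \<in> A" "T j y = T a0 z" by blast
      then show False using window_unique[OF y AY j win0(1)] no by blast
    qed
    show "T j y \<notin> T b0 ` A"
    proof
      assume "T j y \<in> T b0 ` A"
      then obtain z where "z \<in> A" "T j y = T b0 z" by blast
      then show False using window_unique[OF y AY j win0(2)] no by blast
    qed
  qed
  have mem: "T a y \<in> (t \<circ> g) ` past y \<longleftrightarrow> t (T a y) \<in> g ` past y" for a y
    unfolding image_comp[symmetric] by (metis tt image_iff)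
  show ?thesis
  proof (rule that[OF tS])
    show "window_map Y N t"
      unfolding window_map_def
    proof (intro conjI ballI allI impI)
      fix y j assume y: "y \<in> Y" and j: "j \<in> {- N..<N}"
      consider "y \<in> A" "j = a0" | "y \<in> A" "j = b0" | "y \<in> A \<Longrightarrow> j \<noteq> a0 \<and> j \<noteq> b0" by blast
      then show "\<exists>i\<in>{- N..<N}. t (T j y) = T i y"
        by cases (use t1 t2 t4[OF y j] win0 j in blast)+
    next
      fix x assume no: "\<forall>y\<in>Y. \<forall>j\<in>{- N..<N}. x \<noteq> T j y"
      show "t x = x" by (rule t3) (use no AY win0 in blast)+
    qed
    show "\<not> crossing_pair (t \<circ> g) a0 b0 y" if y: "y \<in> Y" for y
    proof (cases "y \<in> A")
      case True
      then have "T b0 y \<notin> g ` past y" by (simp add: A_def crossing_pair_def)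
      then show ?thesis using t1[OF True] mem by (simp add: crossing_pair_def)
    next
      case False
      then have "t (T a0 y) = T a0 y" "t (T b0 y) = T b0 y" using t4[OF y] win0 by blast+
      then show ?thesis using False y mem by (simp add: crossing_pair_def A_def)
    qed
    show "crossing_pair g a b y"
      if y: "y \<in> Y" and a: "a \<in> {0..<N}" and b: "b \<in> {- N..<0}" and c: "crossing_pair (t \<circ> g) a b y" for a b y
    proof (cases "y \<in> A")
      case True
      then have g0: "T a0 y \<in> g ` past y" "T b0 y \<notin> g ` past y" by (simp_all add: A_def crossing_pair_def)
      have c': "t (T a y) \<in> g ` past y" "t (T b y) \<notin> g ` past y" using c mem by (simp_all add: crossing_pair_def)
      have "a \<noteq> a0" "b \<noteq> b0" using c' g0 t1[OF True] t2[OF True] by auto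
      moreover have "a \<noteq> b0" "b \<noteq> a0" using a b a0 b0 by auto
      ultimately have "t (T a y) = T a y" "t (T b y) = T b y" using t4[OF y] a b by auto
      then show ?thesis using c' by (simp add: crossing_pair_def)
    next
      case False
      then have "t (T a y) = T a y" "t (T b y) = T b y" using t4[OF y] a b by auto
      then show ?thesis using c mem by (simp add: crossing_pair_def)
    qed
  qed
qed

lemma window_map_comp:
  assumes t: "window_map Y N t" and h: "window_map Y N h"
  shows "window_map Y N (t \<circ> h)"
  unfolding window_map_def
proof (intro conjI ballI allI impI)
  fix y j assume y: "y \<in> Y" and j: "j \<in> {- N..<N}"
  obtain i where i: "i \<in> {- N..<N}" "h (T j y) = T i y" using h y j unfolding window_map_def by blast
  obtain l where "l \<in> {- N..<N}" "t (T i y) = T l y" using t y i(1) unfolding window_map_def by blast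
  then show "\<exists>i\<in>{- N..<N}. (t \<circ> h) (T j y) = T i y" using i by auto
next
  fix x assume "\<forall>y\<in>Y. \<forall>j\<in>{- N..<N}. x \<noteq> T j y"
  then have "h x = x" "t x = x" using h t unfolding window_map_def by blast+
  then show "(t \<circ> h) x = x" by simp
qed

lemma remove_crossing_pairs:
  assumes g: "g \<in> full" and Q: "finite Q" "Q \<subseteq> {0..<N} \<times> {- N..<0}"
  shows "\<exists>h\<in>swap_group. window_map Y N h \<and> (\<forall>y\<in>Y. \<forall>(a, b)\<in>Q. \<not> crossing_pair (h \<circ> g) a b y)"
  using Q
proof (induction rule: finite_induct)
  case empty
  have "window_map Y N id" by (auto simp: window_map_def)
  then show ?case using swap_group_id by blast
next
  case (insert p Q)
  obtain a0 b0 where p: "p = (a0, b0)" by (cases p)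
  have ab: "a0 \<in> {0..<N}" "b0 \<in> {- N..<0}" using insert.prems by (auto simp: p)
  obtain h where h: "h \<in> swap_group" "window_map Y N h"
    "\<forall>y\<in>Y. \<forall>(a, b)\<in>Q. \<not> crossing_pair (h \<circ> g) a b y" using insert by blast
  have hg: "h \<circ> g \<in> full" using comp_full[OF _ g] h(1) swap_group_full by blast
  obtain t where t: "t \<in> swap_group" "window_map Y N t"
    "\<And>y. y \<in> Y \<Longrightarrow> \<not> crossing_pair (t \<circ> (h \<circ> g)) a0 b0 y"
    "\<And>a b y. y \<in> Y \<Longrightarrow> a \<in> {0..<N} \<Longrightarrow> b \<in> {- N..<0} \<Longrightarrow> crossing_pair (t \<circ> (h \<circ> g)) a b y \<Longrightarrow>
       crossing_pair (h \<circ> g) a b y"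
    by (rule remove_crossing_pair[OF hg ab]) blast
  show ?case
  proof (intro bexI[of _ "t \<circ> h"] conjI ballI)
    show "window_map Y N (t \<circ> h)" by (rule window_map_comp[OF t(2) h(2)])
    show "t \<circ> h \<in> swap_group" by (rule swap_group_comp[OF t(1) h(1)])
    fix y q assume y: "y \<in> Y" and q: "q \<in> insert p Q"
    obtain a b where ab': "q = (a, b)" by (cases q)
    have "a \<in> {0..<N}" "b \<in> {- N..<0}" using q insert.prems ab' by auto
    then have "\<not> crossing_pair (t \<circ> (h \<circ> g)) a b y"
      using q t(3)[OF y] t(4)[OF y, of a b] h(3) y ab' p by blast
    then show "case q of (a, b) \<Rightarrow> \<not> crossing_pair (t \<circ> h \<circ> g) a b y" by (simp add: ab' comp_assoc del: o_apply)
  qed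
qed

text \<open>Zero flow means equally many crossings in both directions. All of them land in the
  window, so without crossing pairs one direction is empty, and hence the other as well.\<close>

lemma no_crossing_pairs_imp_cut:
  assumes g: "g \<in> full" and bound: "\<And>x. x \<in> S \<Longrightarrow> \<bar>cocycle g x\<bar> < N"
    and h: "h \<in> full" "window_map Y N h" and y: "y \<in> Y" and flow: "flow (h \<circ> g) y = 0"
    and no: "\<And>a b. a \<in> {0..<N} \<Longrightarrow> b \<in> {- N..<0} \<Longrightarrow> \<not> crossing_pair (h \<circ> g) a b y"
  shows "(h \<circ> g) ` past y = past y"
proof -
  let ?k = "h \<circ> g"
  have k: "?k \<in> full" by (rule comp_full[OF h(1) g])
  have yS: "y \<in> S" by (rule cut_in_space[OF y])
  have bnd: "\<bar>cocycle g (T j y)\<bar> < N" for j using bound yS by simp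
  have right: "\<exists>a\<in>{0..<N}. z = T a y" if z: "z \<in> ?k ` past y - past y" for z
  proof -
    obtain j where j: "j < 0" "z = ?k (T j y)" using z by (auto simp: past_def)
    define e where "e = j + cocycle g (T j y)"
    have e: "e < N" "g (T j y) = T e y" using bnd[of j] j(1) full_orbit[OF g yS] by (auto simp: e_def)
    obtain c where c: "h (T e y) = T c y" "- N \<le> e \<Longrightarrow> e < N \<Longrightarrow> - N \<le> c \<and> c < N" "e < - N \<Longrightarrow> c < - N"
      by (rule window_map_side[OF h(2) y, of e]) blast
    have zc: "z = T c y" using j(2) e(2) c(1) by simp
    then have "c \<ge> 0" using z mem_past[OF yS, of c] by simp
    moreover have "c < N" using c(2,3) e(1) N by linarith
    ultimately show ?thesis using zc by auto
  qed
  have left: "\<exists>b\<in>{- N..<0}. z = T b y" if z: "z \<in> past y - ?k ` past y" for z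
  proof -
    obtain j where j: "j \<ge> 0" "z = ?k (T j y)" using z unfolding flow_sets(2)[OF k yS] by auto
    define e where "e = j + cocycle g (T j y)"
    have e: "- N \<le> e" "g (T j y) = T e y" using bnd[of j] j(1) full_orbit[OF g yS] by (auto simp: e_def)
    obtain c where c: "h (T e y) = T c y" "- N \<le> e \<Longrightarrow> e < N \<Longrightarrow> - N \<le> c \<and> c < N" "N \<le> e \<Longrightarrow> N \<le> c"
      by (rule window_map_side[OF h(2) y, of e]) blast
    have zc: "z = T c y" using j(2) e(2) c(1) by simp
    then have "c < 0" using z mem_past[OF yS, of c] by simp
    moreover have "- N \<le> c" using c(2,3) e(1) N by linarith
    ultimately show ?thesis using zc by auto
  qed
  have "?k ` past y - past y = {} \<or> past y - ?k ` past y = {}"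
  proof (rule ccontr)
    assume "\<not> ?thesis"
    then obtain z w where z: "z \<in> ?k ` past y - past y" and w: "w \<in> past y - ?k ` past y" by blast
    obtain a where a: "a \<in> {0..<N}" "z = T a y" using right[OF z] by blast
    obtain b where b: "b \<in> {- N..<0}" "w = T b y" using left[OF w] by blast
    have "crossing_pair ?k a b y" using a b z w by (simp add: crossing_pair_def del: o_apply)
    then show False using no[OF a(1) b(1)] by blast
  qed
  moreover have "card (?k ` past y - past y) = card (past y - ?k ` past y)"
    using flow unfolding flow_def card_diff_def by simp
  moreover have "finite (?k ` past y - past y)" "finite (past y - ?k ` past y)"
    using commensurate_past[OF k yS] unfolding commensurate_def by blast+
  ultimately have "?k ` past y - past y = {}" "past y - ?k ` past y = {}"
    using both_empty[of "?k ` past y - past y" "past y - ?k ` past y"] by blast+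
  then show ?thesis by blast
qed

end

theorem full_0_eq_swap_group: "full_0 = swap_group"
proof
  show "full_0 \<subseteq> swap_group"
  proof
    fix g assume "g \<in> full_0"
    then have g: "g \<in> full" and fl: "\<And>x. x \<in> S \<Longrightarrow> flow g x = 0" by (auto simp: full_0_def)
    obtain M where M: "M \<ge> 0" "\<And>x. x \<in> S \<Longrightarrow> \<bar>cocycle g x\<bar> \<le> M" by (rule cocycle_bound[OF g]) blast
    \<comment> \<open>One more than the bound, to have positive window width even if
      \<open>M\<close> is 0.\<close>
    define N where "N = M + 1"
    have N: "N > 0" "\<And>x. x \<in> S \<Longrightarrow> \<bar>cocycle g x\<bar> < N" using M by (auto simp: N_def intro: le_less_trans)
    obtain x where x: "x \<in> S" using space_nonempty by blast
    \<comment> \<open>No return within \<open>2 * N\<close> steps, so windows around different cuts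
      are disjoint and can be corrected independently.\<close>
    obtain Y where Y: "Y \<in> \<C>" "x \<in> Y" "\<And>k. k \<in> {- 2 * N..2 * N} - {0} \<Longrightarrow> T k ` Y \<inter> Y = {}"
      by (rule small_neighbourhood[OF x, of "{- 2 * N..2 * N} - {0}"]) auto
    obtain h where h: "h \<in> swap_group" "window_map Y N h"
      "\<forall>y\<in>Y. \<forall>(a, b)\<in>{0..<N} \<times> {- N..<0}. \<not> crossing_pair (h \<circ> g) a b y"
      using remove_crossing_pairs[OF Y(1) N(1) Y(3) g, of "{0..<N} \<times> {- N..<0}"] by auto
    have hf: "h \<in> full" using h(1) swap_group_full by blast
    have cut: "(h \<circ> g) ` past y = past y" if y: "y \<in> Y" for y
    proof (rule no_crossing_pairs_imp_cut[OF Y(1) N(1) Y(3) g N(2) hf h(2) y])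
      have yS: "y \<in> S" using y clopen_subset[OF Y(1)] by blast
      have "flow h y = 0" using h(1) swap_group_full_0 yS by (auto simp: full_0_def)
      then show "flow (h \<circ> g) y = 0" using flow_comp[OF hf g yS] fl[OF yS] by simp
      show "\<not> crossing_pair (h \<circ> g) a b y" if "a \<in> {0..<N}" "b \<in> {- N..<0}" for a b
        using h(3) y that by blast
    qed
    have "h \<circ> g \<in> swap_group"
      by (rule full_preserving_cuts[OF comp_full[OF hf g] Y(1) _ cut]) (use Y(2) in auto)
    then have "inv h \<circ> (h \<circ> g) \<in> swap_group" by (rule swap_group_comp[OF swap_group_inv[OF h(1)]])
    moreover have "inv h \<circ> (h \<circ> g) = g" using hf by (simp add: fun_eq_iff)
    ultimately show "g \<in> swap_group" by (simp only:)
  qed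
qed (rule swap_group_full_0)

section \<open>Finite generation and its consequences in the abstract setting\<close>

theorem full_0_finitely_generated:
  assumes lab: "separating lab" and fin: "finite_classes"
  shows "\<exists>F. finite F \<and> F \<subseteq> full_0 \<and> generated F = full_0"
proof -
  obtain F where F: "finite F" "F \<subseteq> alt_group" "alt_group = generated F"
    by (rule alt_group_finitely_generated[OF lab]) blast
  obtain F' where F': "finite F'" "F' \<subseteq> swap_group" "swap_group = generated (alt_group \<union> F')"
    by (rule swap_group_finite_extension[OF fin]) blast
  have "generated (alt_group \<union> F') \<subseteq> generated (F \<union> F')"
  proof (rule generated_subset)
    show "alt_group \<union> F' \<subseteq> generated (F \<union> F')"
      using generated_mono[of F "F \<union> F'"] F(3) by (auto intro: generated_incl)
  qed
  moreover have "generated (F \<union> F') \<subseteq> generated (alt_group \<union> F')"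
    using F(2) by (intro generated_mono) blast
  ultimately have "generated (F \<union> F') = swap_group" using F'(3) by blast
  moreover have "F \<union> F' \<subseteq> swap_group" using F(2) F'(2) alt_subset_swap_group by blast
  ultimately show ?thesis unfolding full_0_eq_swap_group using F(1) F'(1) by blast
qed

text \<open>\<open>T 1\<close> has flow 1, so composing with a power of it brings any element to
  index zero.\<close>

theorem full_finitely_generated:
  assumes F: "finite F" "F \<subseteq> full_0" "generated F = full_0"
  shows "\<exists>F. finite F \<and> F \<subseteq> full \<and> generated F = full"
proof (intro exI conjI)
  let ?G = "insert (T 1) F"
  show "finite ?G" using F by simp
  show G: "?G \<subseteq> full" using F T_full by (auto simp: full_0_def)
  show "generated ?G = full"
  proof
    show "generated ?G \<subseteq> full" by (rule generated_full[OF G])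
    show "full \<subseteq> generated ?G"
    proof
      fix g assume g: "g \<in> full"
      obtain x where x: "x \<in> S" using space_nonempty by blast
      have flT: "flow (T k) y = k" if y: "y \<in> S" for k y
      proof (induction k rule: int_induct[where k=0])
        case base
        have "T 0 = id" by (simp add: fun_eq_iff T_0)
        then show ?case by (simp only: flow_id)
      next
        case (step1 i)
        have "T (i + 1) = T i \<circ> T 1" by (simp add: fun_eq_iff T_T)
        then have "flow (T (i + 1)) y = flow (T i) y + flow (T 1) y"
          using flow_comp[OF T_full T_full y] by (simp only:)
        then show ?case using flow_T[OF y] step1 by simp
      next
        case (step2 i)
        have "T i = T (i - 1) \<circ> T 1" by (simp add: fun_eq_iff T_T)
        then have "flow (T i) y = flow (T (i - 1)) y + flow (T 1) y"
          using flow_comp[OF T_full T_full y] by (simp only:)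
        then show ?case using flow_T[OF y] step2 by simp
      qed
      have Tk: "T k \<in> generated ?G" for k
      proof (induction k rule: int_induct[where k=0])
        case base
        have "T 0 = id" by (simp add: fun_eq_iff T_0)
        then show ?case by (simp only: generated_id)
      next
        case (step1 i)
        have "T (i + 1) = T i \<circ> T 1" by (simp add: fun_eq_iff T_T)
        then show ?case using generated_comp[OF step1(2) generated_incl, of "T 1"] by (simp only: insertI1)
      next
        case (step2 i)
        have "T (i - 1) = T i \<circ> inv (T 1)" by (simp add: fun_eq_iff inv_T T_T)
        then show ?case using generated_comp[OF step2(2) generated_inv[OF generated_incl], of "T 1"]
          by (simp only: insertI1)
      qed
      define k where "k = flow g x"
      have "flow (g \<circ> T (- k)) y = 0" if y: "y \<in> S" for y
        using flow_comp[OF g T_full y] flT[OF y] flow_constant[OF g x y] by (simp add: k_def)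
      then have "g \<circ> T (- k) \<in> full_0" using comp_full[OF g T_full] by (simp add: full_0_def del: o_apply)
      then have "g \<circ> T (- k) \<in> generated ?G" using generated_mono[of F ?G] F(3) by blast
      from generated_comp[OF this Tk[of k]] have "(g \<circ> T (- k)) \<circ> T k \<in> generated ?G" .
      moreover have "(g \<circ> T (- k)) \<circ> T k = g" by (simp add: fun_eq_iff)
      ultimately show "g \<in> generated ?G" by (simp only:)
    qed
  qed
qed

lemma finitely_generated_imp_separating:
  assumes F: "finite F" "F \<subseteq> full" "generated F = full"
  shows "\<exists>lab. separating lab"
proof -
  define code where "code x = (\<lambda>g\<in>F. cocycle g x)" for x
  have "loc_const code"
  proof (rule loc_constI)
    fix x assume x: "x \<in> S"
    have "loc_const (\<lambda>y. \<forall>g\<in>F. cocycle g y = cocycle g x)"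
    proof (rule loc_const_Ball[OF F(1)])
      fix g assume "g \<in> F"
      then have "loc_const (cocycle g)" using F(2) loc_const_cocycle by blast
      then show "loc_const (\<lambda>y. cocycle g y = cocycle g x)"
        by (rule loc_const_apply[where F="\<lambda>n. n = cocycle g x"])
    qed
    from loc_const_clopen[OF this, where p="\<lambda>b. b"]
    show "\<exists>B\<in>\<C>. x \<in> B \<and> (\<forall>y\<in>B. code y = code x)"
      by (rule bexI[rotated]) (use x in \<open>auto simp: code_def intro!: restrict_ext\<close>)
  qed
  then obtain e :: "_ \<Rightarrow> nat" where e: "inj_on e (code ` S)"
    using finite_imp_inj_to_nat_seg[OF loc_const_finite] by blast
  define lab where "lab x = e (code x)" for x
  have "x = y" if x: "x \<in> S" and y: "y \<in> S" and eq: "\<forall>i. lab (T i x) = lab (T i y)" for x y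
  proof (rule ccontr)
    assume "x \<noteq> y"
    have code: "code (T i x) = code (T i y)" for i
      using eq[rule_format, of i] e x y by (auto simp: lab_def inj_on_def)
    \<comment> \<open>All positions are compared at once, because the cocycle of a composition reads
      its outer factor at another point of the orbit.\<close>
    have same: "g \<in> full \<and> (\<forall>i. cocycle g (T i x) = cocycle g (T i y))" if "g \<in> generated F" for g
      using that
    proof induction
      case generated_id
      have "cocycle id z = 0" if "z \<in> S" for z using that by (intro cocycle_eqI) (simp_all add: T_0)
      then show ?case using id_full x y by (metis T_mem_iff)
    next
      case (generated_incl g)
      have "cocycle g (T i x) = cocycle g (T i y)" for i
        using fun_cong[OF code[of i], of g] generated_incl by (simp add: code_def)
      then show ?case using F(2) generated_incl by blast
    next
      case (generated_comp g h)
      then have g: "g \<in> full" and h: "h \<in> full" by blast+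
      have "cocycle (g \<circ> h) (T i x) = cocycle (g \<circ> h) (T i y)" for i
        using cocycle_comp[OF g h, of "T i x"] cocycle_comp[OF g h, of "T i y"] x y
          full_orbit[OF h x, of i] full_orbit[OF h y, of i] generated_comp.IH by simp
      then show ?case using comp_full[OF g h] by blast
    next
      case (generated_inv g)
      then have g: "g \<in> full" and IH: "\<And>i. cocycle g (T i x) = cocycle g (T i y)" by blast+
      have "cocycle (inv g) (T i x) = cocycle (inv g) (T i y)" for i
      proof -
        define j where "j = i + cocycle (inv g) (T i x)"
        have "inv g (T i x) = T j x" using full_orbit[OF inv_full[OF g] x] by (simp add: j_def)
        then have "T i x = g (T j x)" using g by (metis full_inv(2))
        then have "i = j + cocycle g (T j y)" using full_orbit[OF g x] T_cancel[OF x] IH by simp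
        then have "T i y = g (T j y)" using full_orbit[OF g y] by simp
        then have "inv g (T i y) = T j y" using g by simp
        then have "inv g (T i y) = T (j - i) (T i y)" by (simp add: T_T)
        then have "cocycle (inv g) (T i y) = j - i" using y by (intro cocycle_eqI) simp_all
        then show ?thesis by (simp add: j_def)
      qed
      then show ?case using inv_full[OF g] by blast
    qed
    obtain A where A: "A \<in> \<C>" "x \<in> A" "y \<notin> A" using clopen_separates[OF x y \<open>x \<noteq> y\<close>] by blast
    obtain B where B: "B \<in> \<C>" "x \<in> B" "\<And>k. k \<in> {1} \<Longrightarrow> T k ` B \<inter> B = {}"
      by (rule small_neighbourhood[OF x, of "{1}"]) auto
    \<comment> \<open>The transposition of \<open>D\<close> and its translate has cocycle 1 on
      \<open>D\<close>, -1 on the translate and 0 elsewhere. Equal cocycles at \<open>x\<close> and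
      \<open>y\<close> would therefore put \<open>y\<close> into \<open>D\<close>.\<close>
    define D where "D = A \<inter> B"
    have D: "D \<in> \<C>" "x \<in> D" "y \<notin> D" using A B by (simp_all add: D_def clopen_Int)
    have d: "D \<inter> T 1 ` D = {}" using B(3)[of 1] by (auto simp: D_def)
    define g where "g = swap D (T 1)"
    have g: "g \<in> full" unfolding g_def by (rule swap_full[OF D(1) T_full d])
    have "cocycle g x = 1"
      by (rule cocycle_eqI[OF x]) (simp add: g_def swap_apply(1)[OF T_full d D(2)])
    then have "cocycle g y = 1" using same[of g] g F(3) by (metis T_0)
    then have gy: "g y = T 1 y" using full_apply[OF g y] by simp
    show False
    proof (cases "y \<in> T 1 ` D")
      case True
      then obtain z where z: "z \<in> D" "y = T 1 z" by blast
      then have "g y = z" using swap_apply(2)[OF T_full d, of z] by (simp add: g_def)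
      then have "T 2 z = z" using gy z by (simp add: T_T)
      then show False using T_free[of z 2] z clopen_subset[OF D(1)] by auto
    next
      case False
      then have "g y = y" using swap_apply(3)[OF T_full d D(3)] by (simp add: g_def)
      then show False using gy T_free[OF y, of 1] by simp
    qed
  qed
  moreover have "loc_const lab"
    using loc_const_apply[OF \<open>loc_const code\<close>, of e] by (simp add: lab_def[abs_def])
  ultimately show ?thesis unfolding separating_def by blast
qed

end

lemma odd_card_sym_diff:
  assumes "finite A" "finite B" shows "odd (card (A \<triangle> B)) \<longleftrightarrow> odd (card A) \<noteq> odd (card B)"
proof -
  have "card A = card (A - B) + card (A \<inter> B)" "card B = card (B - A) + card (A \<inter> B)"
    using assms card_Int_Diff[of A B] card_Int_Diff[of B A] by (simp_all add: Int_commute)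
  moreover have "card (A \<triangle> B) = card (A - B) + card (B - A)"
    unfolding sym_diff_def using assms by (intro card_Un_disjoint) auto
  ultimately show ?thesis by auto
qed

context clopen_system
begin

subsection \<open>Parity of inversions\<close>

lemma cohomologous_refl: "cohomologous U U"
  unfolding cohomologous_def using clopen_empty by (intro bexI[of _ "{}"]) simp_all

lemma cohomologous_sym: "cohomologous U V \<Longrightarrow> cohomologous V U"
  unfolding cohomologous_def by (simp only: sym_diff_commute)

lemma cohomologous_sym_diff:
  assumes "cohomologous A B" "cohomologous C D" shows "cohomologous (A \<triangle> C) (B \<triangle> D)"
proof -
  obtain V W where V: "V \<in> \<C>" "A \<triangle> B = V \<triangle> T 1 ` V" and W: "W \<in> \<C>" "C \<triangle> D = W \<triangle> T 1 ` W"
    using assms by (auto simp: cohomologous_def)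
  have im: "T 1 ` (V \<triangle> W) = T 1 ` V \<triangle> T 1 ` W" by (auto simp: mem_T_image set_eq_iff)
  have "(A \<triangle> C) \<triangle> (B \<triangle> D) = (A \<triangle> B) \<triangle> (C \<triangle> D)" by auto
  also have "\<dots> = (V \<triangle> W) \<triangle> T 1 ` (V \<triangle> W)" unfolding V(2) W(2) im by auto
  finally show ?thesis unfolding cohomologous_def using clopen_sym_diff[OF V(1) W(1)] by blast
qed

lemma cohomologous_trans [trans]:
  assumes "cohomologous A B" "cohomologous B C" shows "cohomologous A C"
proof -
  have "cohomologous (A \<triangle> B) (B \<triangle> C)"
    using cohomologous_sym_diff[OF assms] .
  moreover have "(A \<triangle> B) \<triangle> (B \<triangle> C) = A \<triangle> C" by auto
  ultimately show ?thesis by (simp add: cohomologous_def)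
qed

lemma cohomologous_T:
  assumes "A \<in> \<C>" shows "cohomologous (T k ` A) A"
proof (induction k rule: int_induct[where k=0])
  case base then show ?case by (simp add: cohomologous_refl)
next
  case (step1 i)
  have "cohomologous (T 1 ` T i ` A) (T i ` A)"
    unfolding cohomologous_def using clopen_T[OF assms] by (intro bexI[of _ "T i ` A"]) auto
  from cohomologous_trans[OF this step1(2)] show ?case by (simp add: T_image_T_image add.commute)
next
  case (step2 i)
  have "cohomologous (T (i - 1) ` A) (T 1 ` T (i - 1) ` A)"
    unfolding cohomologous_def using clopen_T[OF assms] by (intro bexI[of _ "T (i - 1) ` A"]) auto
  then have "cohomologous (T (i - 1) ` A) (T i ` A)" by (simp add: T_image_T_image)
  from cohomologous_trans[OF this step2(2)] show ?case .
qed

lemma cohomologous_full: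
  assumes g: "g \<in> full" and A: "A \<in> \<C>" shows "cohomologous (g ` A) A"
  using A
proof (induction rule: clopen_induct)
  case (local x)
  obtain B a where B: "B \<in> \<C>" "x \<in> B" "\<And>y. y \<in> B \<Longrightarrow> cocycle g y = a"
    using loc_constE[OF loc_const_cocycle[OF g] local] by metis
  have "cohomologous (g ` D) D" if D: "D \<in> \<C>" "D \<subseteq> B" for D
  proof -
    have "g y = T a y" if "y \<in> D" for y
      using that D(2) clopen_subset[OF D(1)] full_apply[OF g, of y] B(3)[of y] by auto
    then have "g ` D = T a ` D" by (auto intro!: image_cong)
    then show ?thesis using cohomologous_T[OF D(1)] by simp
  qed
  then show ?case using B(1,2) by blast
next
  case (Un D E)
  have "g ` (D \<union> E) = g ` D \<triangle> g ` E" "D \<union> E = D \<triangle> E"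
    using Un(3) full_inj[OF g] by (auto simp: set_eq_iff)
  then show ?case using cohomologous_sym_diff[OF Un(4,5)] by simp
qed

text \<open>The out-degree modulo two of a relation, as a set of points. An infinite out-degree
  would count as even; \<open>bounded_rel\<close> rules it out.\<close>

definition parity :: "('a \<Rightarrow> 'a \<Rightarrow> bool) \<Rightarrow> 'a set" where
  "parity R = {u\<in>S. odd (card {v. R u v})}"

text \<open>Relations inside orbits with finitely many offsets, each of which occurs on a clopen
  set; such a relation is a finite union of graphs of powers over clopen sets.\<close>

definition bounded_rel :: "int set \<Rightarrow> ('a \<Rightarrow> 'a \<Rightarrow> bool) \<Rightarrow> bool" where
  "bounded_rel K R \<longleftrightarrow> finite K \<and> (\<forall>u v. R u v \<longrightarrow> u \<in> S \<and> (\<exists>k\<in>K. v = T k u)) \<and>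
     (\<forall>k. {u\<in>S. R u (T k u)} \<in> \<C>)"

lemma bounded_rel_finite:
  assumes "bounded_rel K R" shows "finite {v. R u v}" "finite {v. R v u}"
proof -
  have K: "finite K" and R: "\<And>u v. R u v \<Longrightarrow> \<exists>k\<in>K. v = T k u" using assms by (auto simp: bounded_rel_def)
  show "finite {v. R u v}" by (rule finite_subset[of _ "(\<lambda>k. T k u) ` K"]) (use K R in auto)
  show "finite {v. R v u}"
  proof (rule finite_subset[of _ "(\<lambda>k. T (- k) u) ` K"])
    show "{v. R v u} \<subseteq> (\<lambda>k. T (- k) u) ` K"
    proof
      fix v assume "v \<in> {v. R v u}"
      then obtain k where "k \<in> K" "u = T k v" using R by blast
      then have "v = T (- k) u" by simp
      then show "v \<in> (\<lambda>k. T (- k) u) ` K" using \<open>k \<in> K\<close> by (rule image_eqI)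
    qed
  qed (use K in simp)
qed

lemma parity_xor:
  assumes "\<And>u. finite {v. R u v}" "\<And>u. finite {v. Q u v}"
  shows "parity (\<lambda>u v. R u v \<noteq> Q u v) = parity R \<triangle> parity Q"
proof -
  have "{v. R u v \<noteq> Q u v} = {v. R u v} \<triangle> {v. Q u v}" for u by auto
  then show ?thesis using odd_card_sym_diff[OF assms] by (auto simp: parity_def)
qed

text \<open>The part with offset \<open>k\<close>, over a clopen set \<open>A\<close>, contributes
  \<open>A\<close> to the out-degrees and the translate of \<open>A\<close> by \<open>T k\<close> to
  the in-degrees. Translates are cohomologous, and the offsets are added one at a time.\<close>

lemma parity_converse:
  "bounded_rel K R \<Longrightarrow>
   parity R \<in> \<C> \<and> parity (\<lambda>u v. R v u) \<in> \<C> \<and> cohomologous (parity R) (parity (\<lambda>u v. R v u))"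
proof -
  assume "bounded_rel K R"
  then have "finite K" by (simp add: bounded_rel_def)
  then show ?thesis using \<open>bounded_rel K R\<close>
  proof (induction K arbitrary: R rule: finite_induct)
    case empty
    then have "R u v \<longleftrightarrow> False" for u v by (auto simp: bounded_rel_def)
    then have "parity R = {}" "parity (\<lambda>u v. R v u) = {}" by (simp_all add: parity_def)
    then show ?case using clopen_empty cohomologous_refl by simp
  next
    case (insert k K)
    have b: "u \<in> S \<and> (\<exists>j\<in>insert k K. v = T j u)" if "R u v" for u v
      using insert.prems that by (auto simp: bounded_rel_def)
    define A where "A = {u\<in>S. R u (T k u)}"
    have A: "A \<in> \<C>" using insert.prems by (simp add: A_def bounded_rel_def)
    define P where "P u v \<longleftrightarrow> R u v \<and> v = T k u" for u v
    define Q where "Q u v \<longleftrightarrow> R u v \<and> v \<noteq> T k u" for u v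
    have Q: "bounded_rel K Q"
      unfolding bounded_rel_def
    proof (intro conjI allI impI)
      show "u \<in> S" "\<exists>j\<in>K. v = T j u" if "Q u v" for u v using b[of u v] that by (auto simp: Q_def)
      fix j
      have "{u\<in>S. Q u (T j u)} = (if j = k then {} else {u\<in>S. R u (T j u)})"
        by (auto simp: Q_def T_cancel)
      then show "{u\<in>S. Q u (T j u)} \<in> \<C>" using insert.prems clopen_empty by (simp add: bounded_rel_def)
    qed (rule insert.hyps)
    have R: "R u v \<longleftrightarrow> P u v \<noteq> Q u v" for u v by (auto simp: P_def Q_def)
    have setP: "{v. P u v} = (if R u (T k u) then {T k u} else {})" for u by (auto simp: P_def)
    have setP': "{v. P v u} = (if R (T (- k) u) u then {T (- k) u} else {})" for u
      by (auto simp: P_def)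
    have P: "parity P = A"
      unfolding parity_def setP A_def by auto
    have P': "parity (\<lambda>u v. P v u) = T k ` A"
      unfolding parity_def setP' A_def by (auto simp: mem_T_image)
    have fin: "finite {v. P u v}" "finite {v. P v u}" for u unfolding setP setP' by simp_all
    have "parity R = A \<triangle> parity Q"
      unfolding R[abs_def] P[symmetric] by (rule parity_xor) (rule fin bounded_rel_finite[OF Q])+
    moreover have "parity (\<lambda>u v. R v u) = T k ` A \<triangle> parity (\<lambda>u v. Q v u)"
      unfolding R P'[symmetric] by (rule parity_xor) (rule fin bounded_rel_finite[OF Q])+
    ultimately show ?case
      using insert.IH[OF Q] A clopen_T[OF A, of k] cohomologous_sym[OF cohomologous_T[OF A, of k]]
      by (auto intro: clopen_sym_diff cohomologous_sym_diff)
  qed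
qed

lemma parity_full: "h \<in> full \<Longrightarrow> parity (\<lambda>u v. R (h u) (h v)) = inv h ` parity R"
proof -
  assume h: "h \<in> full"
  have "{v. R (h u) (h v)} = inv h ` {v. R (h u) v}" for u
    using h by (auto simp: image_iff) (metis full_inv(1))
  then have "card {v. R (h u) (h v)} = card {v. R (h u) v}" for u
    using card_image[of "inv h"] full_inj_fun[OF inv_full[OF h]] inj_on_subset by (metis subset_UNIV)
  then show ?thesis
    using h by (auto simp: parity_def mem_full_image[OF inv_full[OF h]] inv_inv_eq full_bij)
qed

definition ahead :: "'a \<Rightarrow> 'a \<Rightarrow> bool" where
  "ahead u v \<longleftrightarrow> u \<in> S \<and> (\<exists>k>0. v = T k u)"

lemma ahead_T: "u \<in> S \<Longrightarrow> ahead (T i u) (T j u) \<longleftrightarrow> i < j"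
proof
  assume u: "u \<in> S"
  assume "ahead (T i u) (T j u)"
  then obtain k where "k > 0" "T j u = T (k + i) u" by (auto simp: ahead_def T_T)
  then show "i < j" using T_cancel[OF u] by auto
next
  assume "u \<in> S" "i < j"
  then show "ahead (T i u) (T j u)" unfolding ahead_def by (intro conjI exI[of _ "j - i"]) (simp_all add: T_T)
qed

lemma ahead_full:
  assumes g: "g \<in> full" and u: "u \<in> S"
  shows "ahead (g u) (g (T k u)) \<longleftrightarrow> cocycle g u < k + cocycle g (T k u)"
    "ahead (g (T k u)) (g u) \<longleftrightarrow> k + cocycle g (T k u) < cocycle g u"
  unfolding full_apply[OF g u] full_orbit[OF g u] ahead_T[OF u] by simp_all

lemma ahead_total:
  assumes g: "g \<in> full" and uv: "ahead u v" shows "ahead (g v) (g u) \<longleftrightarrow> \<not> ahead (g u) (g v)"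
proof -
  obtain k where u: "u \<in> S" and k: "k > 0" "v = T k u" using uv by (auto simp: ahead_def)
  have "g u \<noteq> g v" using full_inj[OF g, of u v] k T_free[OF u, of k] by auto
  then have "cocycle g u \<noteq> k + cocycle g v" using full_apply[OF g u] full_orbit[OF g u, of k] k(2) by auto
  then show ?thesis unfolding k(2) ahead_full[OF g u] using k(2) by auto
qed

definition inversion :: "('a \<Rightarrow> 'a) \<Rightarrow> 'a \<Rightarrow> 'a \<Rightarrow> bool" where
  "inversion g u v \<longleftrightarrow> ahead u v \<and> ahead (g v) (g u)"

lemma loc_const_ahead:
  assumes g: "g \<in> full"
  shows "loc_const (\<lambda>u. ahead (g u) (g (T k u)))" "loc_const (\<lambda>u. ahead (g (T k u)) (g u))"
proof -
  have c: "loc_const (cocycle g)" "loc_const (\<lambda>u. cocycle g (T k u))"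
    by (rule loc_const_cocycle[OF g], rule loc_const_T[OF loc_const_cocycle[OF g]])
  have "loc_const (\<lambda>u. cocycle g u < k + cocycle g (T k u))"
    by (rule loc_const_apply2[OF c, where F="\<lambda>m n. m < k + n"])
  then show "loc_const (\<lambda>u. ahead (g u) (g (T k u)))" by (subst loc_const_cong[OF ahead_full(1)[OF g]])
  have "loc_const (\<lambda>u. k + cocycle g (T k u) < cocycle g u)"
    by (rule loc_const_apply2[OF c, where F="\<lambda>m n. k + n < m"])
  then show "loc_const (\<lambda>u. ahead (g (T k u)) (g u))" by (subst loc_const_cong[OF ahead_full(2)[OF g]])
qed

text \<open>If points move by at most \<open>N\<close>, a pair farther apart than
  \<open>2 * N\<close> keeps its order.\<close>

lemma bounded_rel_inversion:
  assumes g: "g \<in> full"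
  obtains K where "bounded_rel K (inversion g)"
proof -
  obtain N where N: "N \<ge> 0" "\<And>x. x \<in> S \<Longrightarrow> \<bar>cocycle g x\<bar> \<le> N" by (rule cocycle_bound[OF g]) blast
  have "bounded_rel {1..2 * N} (inversion g)"
    unfolding bounded_rel_def
  proof (intro conjI allI impI)
    fix u v assume "inversion g u v"
    then obtain k where u: "u \<in> S" and k: "k > 0" "v = T k u" and inv: "ahead (g v) (g u)"
      by (auto simp: inversion_def ahead_def[of u])
    show "u \<in> S" by fact
    have "k + cocycle g v < cocycle g u" using inv unfolding k(2) ahead_full[OF g u] .
    moreover have "\<bar>cocycle g v\<bar> \<le> N" "\<bar>cocycle g u\<bar> \<le> N" using N(2) u k(2) by simp_all
    ultimately have "k \<le> 2 * N" by linarith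
    then show "\<exists>k\<in>{1..2 * N}. v = T k u" using k by (intro bexI[of _ k]) auto
  next
    fix k
    have "{u\<in>S. inversion g u (T k u)} = (if k > 0 then {u\<in>S. ahead (g (T k u)) (g u)} else {})"
      using ahead_T[of _ 0 k] by (auto simp: inversion_def T_0)
    then show "{u\<in>S. inversion g u (T k u)} \<in> \<C>"
      using loc_const_clopen[OF loc_const_ahead(2)[OF g], where p="\<lambda>b. b"] clopen_empty by simp
  qed simp
  then show ?thesis using that by blast
qed

lemma bounded_rel_restrict:
  assumes R: "bounded_rel K R" and Q: "\<And>k. loc_const (\<lambda>u. Q u (T k u))"
  shows "bounded_rel K (\<lambda>u v. R u v \<and> Q u v)"
proof -
  have "{u\<in>S. R u (T k u) \<and> Q u (T k u)} \<in> \<C>" for k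
  proof -
    have "{u\<in>S. R u (T k u) \<and> Q u (T k u)} = {u\<in>S. R u (T k u)} \<inter> {u\<in>S. Q u (T k u)}" by auto
    moreover have "{u\<in>S. R u (T k u)} \<in> \<C>" using R by (simp add: bounded_rel_def)
    moreover have "{u\<in>S. Q u (T k u)} \<in> \<C>" using loc_const_clopen[OF Q, where p="\<lambda>b. b"] .
    ultimately show ?thesis using clopen_Int by simp
  qed
  then show ?thesis using R unfolding bounded_rel_def by auto
qed

text \<open>A substitute for the sign of a permutation, with values in K^0 modulo two instead of
  Z/2.\<close>

definition inversion_parity :: "('a \<Rightarrow> 'a) \<Rightarrow> 'a set" where
  "inversion_parity g = parity (inversion g)"

lemma clopen_inversion_parity: "g \<in> full \<Longrightarrow> inversion_parity g \<in> \<C>"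
  unfolding inversion_parity_def by (rule bounded_rel_inversion) (auto dest: parity_converse)

text \<open>A pair inverted by \<open>g \<circ> h\<close> is inverted by \<open>h\<close> or its image is inverted by \<open>g\<close>, but not both.
  Pulling the inversions of \<open>g\<close> back along \<open>h\<close> may turn the left end point of a pair into the right
  one, which does not matter up to coboundaries.\<close>

lemma inversion_parity_comp:
  assumes g: "g \<in> full" and h: "h \<in> full"
  shows "cohomologous (inversion_parity (g \<circ> h)) (inversion_parity h \<triangle> inversion_parity g)"
proof -
  let ?h = "inv h"
  have h': "?h \<in> full" by (rule inv_full[OF h])
  \<comment> \<open>\<open>R1\<close> takes the inversions of \<open>g\<close> whose order
    \<open>inv h\<close> keeps, \<open>R2\<close> those whose order it reverses; the latter enter
    below through their converse.\<close>
  define R1 where "R1 u v \<longleftrightarrow> inversion g u v \<and> ahead (?h u) (?h v)" for u v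
  define R2 where "R2 u v \<longleftrightarrow> inversion g u v \<and> ahead (?h v) (?h u)" for u v
  obtain K where K: "bounded_rel K (inversion g)" by (rule bounded_rel_inversion[OF g])
  obtain L where L: "bounded_rel L (inversion h)" by (rule bounded_rel_inversion[OF h])
  have R1: "bounded_rel K R1" and R2: "bounded_rel K R2"
    unfolding R1_def[abs_def] R2_def[abs_def]
    by (rule bounded_rel_restrict[OF K, where Q="\<lambda>u v. ahead (?h u) (?h v)"] loc_const_ahead(1)[OF h']
        bounded_rel_restrict[OF K, where Q="\<lambda>u v. ahead (?h v) (?h u)"] loc_const_ahead(2)[OF h'])+
  have inv_g: "inversion g u v \<longleftrightarrow> R1 u v \<noteq> R2 u v" for u v
    using ahead_total[OF h', of u v] by (auto simp: R1_def R2_def inversion_def)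
  have fin1: "finite {v. R1 (h u) (h v)}" for u
    using finite_vimageI[OF bounded_rel_finite(1)[OF R1] full_inj_fun[OF h], of "h u"] by (simp add: vimage_def)
  have fin2: "finite {v. R2 (h v) (h u)}" for u
    using finite_vimageI[OF bounded_rel_finite(2)[OF R2] full_inj_fun[OF h], of "h u"] by (simp add: vimage_def)
  have fin12: "finite {v. R1 (h u) (h v) \<noteq> R2 (h v) (h u)}" for u
    by (rule finite_subset[OF _ finite_UnI[OF fin1[of u] fin2[of u]]]) auto
  have inv_gh: "inversion (g \<circ> h) u v \<longleftrightarrow> inversion h u v \<noteq> (R1 (h u) (h v) \<noteq> R2 (h v) (h u))" for u v
  proof (cases "ahead u v")
    case True
    have gh: "g \<circ> h \<in> full" by (rule comp_full[OF g h])
    have 1: "ahead (h v) (h u) \<longleftrightarrow> \<not> ahead (h u) (h v)" by (rule ahead_total[OF h True])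
    have 2: "ahead (g (h v)) (g (h u)) \<longleftrightarrow> \<not> ahead (g (h u)) (g (h v))" using ahead_total[OF gh True] by simp
    show ?thesis using True h by (simp add: inversion_def R1_def R2_def 1 2) blast
  next
    case False
    then show ?thesis using h by (simp add: inversion_def R1_def R2_def)
  qed
  have "inversion_parity (g \<circ> h) = inversion_parity h \<triangle> (parity (\<lambda>u v. R1 (h u) (h v)) \<triangle> parity (\<lambda>u v. R2 (h v) (h u)))"
    unfolding inversion_parity_def inv_gh[abs_def]
    using parity_xor[OF bounded_rel_finite(1)[OF L] fin12] parity_xor[OF fin1 fin2] by simp
  also have "\<dots> = inversion_parity h \<triangle> (?h ` parity R1 \<triangle> ?h ` parity (\<lambda>u v. R2 v u))"
    using parity_full[OF h, of R1] parity_full[OF h, of "\<lambda>u v. R2 v u"] by simp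
  finally have eq: "inversion_parity (g \<circ> h) = inversion_parity h \<triangle> (?h ` parity R1 \<triangle> ?h ` parity (\<lambda>u v. R2 v u))" .
  have c1: "cohomologous (?h ` parity R1) (parity R1)"
    using parity_converse[OF R1] by (intro cohomologous_full[OF h']) blast
  have c2: "cohomologous (?h ` parity (\<lambda>u v. R2 v u)) (parity R2)"
    using parity_converse[OF R2] cohomologous_trans[OF cohomologous_full[OF h'] cohomologous_sym] by blast
  have "inversion_parity g = parity R1 \<triangle> parity R2"
    unfolding inversion_parity_def inv_g[abs_def]
    by (rule parity_xor[OF bounded_rel_finite(1)[OF R1] bounded_rel_finite(1)[OF R2]])
  then show ?thesis
    unfolding eq using cohomologous_sym_diff[OF cohomologous_refl cohomologous_sym_diff[OF c1 c2]] by simp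
qed

lemma inversion_parity_id: "inversion_parity id = {}"
proof -
  have "\<not> inversion id u v" for u v
    using ahead_total[OF id_full, of u v] by (auto simp: inversion_def)
  then show ?thesis by (simp add: inversion_parity_def parity_def)
qed

text \<open>Only orbit neighbours are exchanged, in disjoint pairs, so no pair is inverted except
  the exchanged ones, whose left end points form \<open>D\<close>.\<close>

lemma inversion_parity_swap:
  assumes D: "D \<in> \<C>" and d: "D \<inter> T 1 ` D = {}"
  shows "inversion_parity (swap D (T 1)) = D"
proof -
  let ?g = "swap D (T 1)"
  have g: "?g \<in> full" by (rule swap_full[OF D T_full d])
  have c: "cocycle ?g u = (if u \<in> D then 1 else if u \<in> T 1 ` D then - 1 else 0)" if "u \<in> S" for u
    by (rule cocycle_eqI[OF that]) (simp add: swap_def inv_T T_0)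
  have "{v. inversion ?g u v} = (if u \<in> D then {T 1 u} else {})" if u: "u \<in> S" for u
  proof -
    have inv_iff: "inversion ?g u (T k u) \<longleftrightarrow> k = 1 \<and> u \<in> D" if "k > 0" for k
    proof -
      have "inversion ?g u (T k u) \<longleftrightarrow> k + cocycle ?g (T k u) < cocycle ?g u"
        using that u ahead_T[OF u, of 0 k] by (simp add: inversion_def ahead_full[OF g u] T_0)
      also have "\<dots> \<longleftrightarrow> k = 1 \<and> u \<in> D"
        using that u c[OF u] c[of "T k u"] d by (auto split: if_splits)
      finally show ?thesis .
    qed
    have "inversion ?g u v \<longleftrightarrow> u \<in> D \<and> v = T 1 u" for v
    proof
      assume i: "inversion ?g u v"
      then obtain k where k: "k > 0" "v = T k u" by (auto simp: inversion_def ahead_def[of u])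
      then show "u \<in> D \<and> v = T 1 u" using inv_iff[OF k(1)] i by simp
    next
      assume "u \<in> D \<and> v = T 1 u"
      then show "inversion ?g u v" using inv_iff[of 1] by simp
    qed
    then show ?thesis by auto
  qed
  then have "odd (card {v. inversion ?g u v}) \<longleftrightarrow> u \<in> D" if "u \<in> S" for u using that by simp
  then show ?thesis
    using clopen_subset[OF D] unfolding inversion_parity_def parity_def by blast
qed

text \<open>Surjectivity of the invariant: small sets come from transpositions, disjoint unions from
  compositions.\<close>

lemma cohomologous_inversion_parity:
  assumes "U \<in> \<C>" shows "\<exists>g\<in>full. cohomologous U (inversion_parity g)"
  using assms
proof (induction rule: clopen_induct)
  case (local x)
  obtain B where B: "B \<in> \<C>" "x \<in> B" "\<And>k. k \<in> {1} \<Longrightarrow> T k ` B \<inter> B = {}"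
    by (rule small_neighbourhood[OF local, of "{1}"]) auto
  have "\<exists>g\<in>full. cohomologous D (inversion_parity g)" if D: "D \<in> \<C>" "D \<subseteq> B" for D
  proof -
    have d: "D \<inter> T 1 ` D = {}" using B(3)[of 1] D(2) by blast
    have "cohomologous D (inversion_parity (swap D (T 1)))"
      by (simp only: inversion_parity_swap[OF D(1) d] cohomologous_refl)
    then show ?thesis using swap_full[OF D(1) T_full d] by blast
  qed
  then show ?case using B(1,2) by blast
next
  case (Un D E)
  then obtain g h where g: "g \<in> full" "cohomologous D (inversion_parity g)"
    and h: "h \<in> full" "cohomologous E (inversion_parity h)" by blast
  have "D \<union> E = E \<triangle> D" using Un(3) by auto
  then have "cohomologous (D \<union> E) (inversion_parity h \<triangle> inversion_parity g)"
    using cohomologous_sym_diff[OF h(2) g(2)] by simp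
  then have "cohomologous (D \<union> E) (inversion_parity (g \<circ> h))"
    using cohomologous_trans cohomologous_sym[OF inversion_parity_comp[OF g(1) h(1)]] by blast
  then show ?case using comp_full[OF g(1) h(1)] by blast
qed

theorem finitely_generated_imp_finite_classes:
  assumes F: "finite F" "F \<subseteq> full" "generated F = full"
  shows finite_classes
proof -
  \<comment> \<open>The sum modulo two of \<open>inversion_parity g\<close> over \<open>B\<close>,
    formed pointwise so that no order of summation enters. Words in the generators reduce modulo two
    to such sums over subsets.\<close>
  define V where "V B = {x\<in>S. odd (card {g\<in>B. x \<in> inversion_parity g})}" for B
  have V_clopen: "V B \<in> \<C>" if B: "B \<subseteq> F" for B
  proof -
    have "loc_const (\<lambda>x. {g\<in>B. x \<in> inversion_parity g})"
    proof (rule loc_const_Collect)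
      show "finite B" using finite_subset[OF B F(1)] .
      fix g assume "g \<in> B"
      then have "g \<in> full" using B F(2) by blast
      then show "loc_const (\<lambda>x. x \<in> inversion_parity g)"
        by (intro loc_const_mem clopen_inversion_parity)
    qed
    from loc_const_clopen[OF this, where p="\<lambda>I. odd (card I)"] show ?thesis by (simp add: V_def)
  qed
  have V_sym_diff: "V B \<triangle> V B' = V (B \<triangle> B')" if "B \<subseteq> F" "B' \<subseteq> F" for B B'
  proof -
    have fin: "finite B" "finite B'" using that F(1) finite_subset by blast+
    have eq: "{g \<in> B \<triangle> B'. x \<in> inversion_parity g} =
      {g\<in>B. x \<in> inversion_parity g} \<triangle> {g\<in>B'. x \<in> inversion_parity g}" for x by auto
    have odd: "odd (card ({g\<in>B. x \<in> inversion_parity g} \<triangle> {g\<in>B'. x \<in> inversion_parity g})) \<longleftrightarrow>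
      odd (card {g\<in>B. x \<in> inversion_parity g}) \<noteq> odd (card {g\<in>B'. x \<in> inversion_parity g})" for x
      by (rule odd_card_sym_diff) (simp_all add: fin)
    show ?thesis unfolding V_def eq odd by auto
  qed
  have gen: "\<exists>B\<subseteq>F. cohomologous (inversion_parity g) (V B)" if "g \<in> generated F" for g
    using that
  proof induction
    case generated_id
    have "V {} = {}" by (simp add: V_def)
    then show ?case using inversion_parity_id cohomologous_refl by (metis empty_subsetI)
  next
    case (generated_incl g)
    have "inversion_parity g \<subseteq> S" using clopen_subset clopen_inversion_parity generated_incl F(2) by blast
    moreover have "{h\<in>{g}. x \<in> inversion_parity h} = (if x \<in> inversion_parity g then {g} else {})" for x by auto
    ultimately have "V {g} = inversion_parity g" by (auto simp: V_def)
    then show ?case using cohomologous_refl generated_incl by (intro exI[of _ "{g}"]) simp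
  next
    case (generated_comp g h)
    then obtain B B' where B: "B \<subseteq> F" "cohomologous (inversion_parity g) (V B)"
      and B': "B' \<subseteq> F" "cohomologous (inversion_parity h) (V B')" by blast
    have g: "g \<in> full" and h: "h \<in> full" using generated_comp.hyps F(3) by simp_all
    have "cohomologous (inversion_parity (g \<circ> h)) (V (B' \<triangle> B))"
      using cohomologous_trans[OF inversion_parity_comp[OF g h] cohomologous_sym_diff[OF B'(2) B(2)]]
      by (simp only: V_sym_diff[OF B'(1) B(1)])
    moreover have "B' \<triangle> B \<subseteq> F" using B(1) B'(1) by (auto simp: sym_diff_def)
    ultimately show ?case by blast
  next
    case (generated_inv g)
    then obtain B where B: "B \<subseteq> F" "cohomologous (inversion_parity g) (V B)" by blast
    have g: "g \<in> full" using generated_inv.hyps F(3) by simp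
    \<comment> \<open>The classes of \<open>g\<close> and its inverse add up to zero, and modulo two
      this makes them equal.\<close>
    have "g \<circ> inv g = id" using g by (simp add: fun_eq_iff)
    then have "cohomologous {} (inversion_parity (inv g) \<triangle> inversion_parity g)"
      using inversion_parity_comp[OF g inv_full[OF g]] inversion_parity_id by simp
    from cohomologous_sym_diff[OF cohomologous_refl[of "inversion_parity g"] this]
    have "cohomologous (inversion_parity g) (inversion_parity g \<triangle> (inversion_parity (inv g) \<triangle> inversion_parity g))"
      by simp
    moreover have "X \<triangle> (Y \<triangle> X) = Y" for X Y :: "'a set" by auto
    ultimately have "cohomologous (inversion_parity g) (inversion_parity (inv g))" by simp
    then show ?case using B cohomologous_trans cohomologous_sym by blast
  qed
  show ?thesis
    unfolding finite_classes_def
  proof (intro exI[of _ "V ` Pow F"] conjI ballI)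
    show "V ` Pow F \<subseteq> \<C>" using V_clopen by auto
    show "finite (V ` Pow F)" using F(1) by simp
    fix U assume "U \<in> \<C>"
    then obtain g where "g \<in> full" "cohomologous U (inversion_parity g)" using cohomologous_inversion_parity by blast
    moreover from this obtain B where "B \<subseteq> F" "cohomologous (inversion_parity g) (V B)" using gen F(3) by blast
    ultimately show "\<exists>W\<in>V ` Pow F. cohomologous U W" using cohomologous_trans by blast
  qed
qed

end

section \<open>Cantor minimal systems as instances of the abstract setting\<close>

lemma carrier_BijGroup [simp]: "carrier (BijGroup A) = Bij A"
  by (simp add: BijGroup_def)

lemma one_BijGroup: "one (BijGroup A) = (\<lambda>x\<in>A. x)"
  by (simp add: BijGroup_def)

lemma mult_BijGroup: "f \<in> Bij A \<Longrightarrow> g \<in> Bij A \<Longrightarrow> monoid.mult (BijGroup A) f g = compose A f g"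
  by (simp add: BijGroup_def)

locale cantor_minimal_system =
  fixes X :: "'a topology" and \<phi> :: "'a \<Rightarrow> 'a"
  assumes cantor_minimal: "Cantor_minimal_system X \<phi>"
begin

text \<open>\<open>iterate\<close> is \<open>undefined\<close> off the space; the identity there is
  what \<open>T_outside\<close> asks for.\<close>

definition iter :: "int \<Rightarrow> 'a \<Rightarrow> 'a" where
  "iter k x = (if x \<in> topspace X then iterate X \<phi> k x else x)"

definition clopens :: "'a set set" where
  "clopens = {U. openin X U \<and> closedin X U}"

lemma homeomorphic_phi: "homeomorphic_map X X \<phi>"
  and compact_X: "compact_space X" and metrizable_X: "metrizable_space X"
  and nonempty_X: "topspace X \<noteq> {}"
  using cantor_minimal by (auto simp: Cantor_minimal_system_def minimal_homeomorphism_def Cantor_set_def)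

lemma Hausdorff_X: "Hausdorff_space X"
  using metrizable_X metrizable_imp_Hausdorff_space by blast

lemma phi_Bij: "restrict \<phi> (topspace X) \<in> Bij (topspace X)"
  using homeomorphic_imp_surjective_map[OF homeomorphic_phi] homeomorphic_imp_injective_map[OF homeomorphic_phi]
  by (auto simp: Bij_def bij_betw_def inj_on_def)

lemma iterate_Bij: "iterate X \<phi> k \<in> Bij (topspace X)"
  using group.int_pow_closed[OF group_BijGroup, of "restrict \<phi> (topspace X)" "topspace X" k] phi_Bij
  by (simp add: iterate_def)

lemma iterate_mem: "x \<in> topspace X \<Longrightarrow> iterate X \<phi> k x \<in> topspace X"
  using Bij_imp_funcset[OF iterate_Bij] by blast

lemma iterate_0: "x \<in> topspace X \<Longrightarrow> iterate X \<phi> 0 x = x"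
  by (simp add: iterate_def one_BijGroup)

lemma iterate_1: "x \<in> topspace X \<Longrightarrow> iterate X \<phi> 1 x = \<phi> x"
  using group.int_pow_1[OF group_BijGroup, of "restrict \<phi> (topspace X)" "topspace X"] phi_Bij
  by (simp add: iterate_def)

lemma iterate_add: "x \<in> topspace X \<Longrightarrow> iterate X \<phi> (a + b) x = iterate X \<phi> a (iterate X \<phi> b x)"
proof -
  assume x: "x \<in> topspace X"
  have "iterate X \<phi> (a + b) = iterate X \<phi> a \<otimes>\<^bsub>BijGroup (topspace X)\<^esub> iterate X \<phi> b"
    using group.int_pow_mult[OF group_BijGroup, of "restrict \<phi> (topspace X)" "topspace X" a b] phi_Bij
    by (simp add: iterate_def)
  also have "\<dots> = compose (topspace X) (iterate X \<phi> a) (iterate X \<phi> b)"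
    by (rule mult_BijGroup[OF iterate_Bij iterate_Bij])
  finally show ?thesis using x by (simp add: compose_def)
qed

lemma iter_0: "iter 0 x = x"
  by (simp add: iter_def iterate_0)

lemma iter_1: "x \<in> topspace X \<Longrightarrow> iter 1 x = \<phi> x"
  by (simp add: iter_def iterate_1)

lemma iter_add: "iter (a + b) x = iter a (iter b x)"
  by (simp add: iter_def iterate_add iterate_mem)

lemma iter_mem: "x \<in> topspace X \<Longrightarrow> iter a x \<in> topspace X"
  by (simp add: iter_def iterate_mem)

lemma iter_minus: "iter (- a) (iter a x) = x" "iter a (iter (- a) x) = x"
  using iter_add[of "-a" a x] iter_add[of a "-a" x] iter_0 by auto

lemma continuous_iter: "continuous_map X X (iter k)"
proof (induction k rule: int_induct[where k=0])
  case base
  have "iter 0 = (\<lambda>x. x)" by (simp add: fun_eq_iff iter_0)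
  then show ?case by simp
next
  case (step1 i)
  have "continuous_map X X (\<phi> \<circ> iter i)"
    by (rule continuous_map_compose[OF step1(2)]) (rule homeomorphic_imp_continuous_map[OF homeomorphic_phi])
  then show ?case
    by (rule continuous_map_eq) (use iter_1 iter_mem iter_add[of 1 i] in \<open>simp add: add.commute\<close>)
next
  case (step2 i)
  obtain \<psi> where \<psi>: "homeomorphic_maps X X \<phi> \<psi>"
    using homeomorphic_phi by (auto simp: homeomorphic_map_maps)
  have "continuous_map X X (\<psi> \<circ> iter i)"
    by (rule continuous_map_compose[OF step2(2)]) (use \<psi> in \<open>simp add: homeomorphic_maps_def\<close>)
  then show ?case
  proof (rule continuous_map_eq)
    fix x assume x: "x \<in> topspace X"
    have "iter i x = \<phi> (iter (i - 1) x)" using iter_1[of "iter (i - 1) x"] iter_mem[OF x] iter_add[of 1 "i - 1" x] by simp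
    then show "(\<psi> \<circ> iter i) x = iter (i - 1) x" using \<psi> iter_mem[OF x] by (simp add: homeomorphic_maps_def)
  qed
qed

lemma iter_image: "A \<subseteq> topspace X \<Longrightarrow> iter a ` A = {x \<in> topspace X. iter (- a) x \<in> A}"
  using iter_mem iter_minus by (auto simp: image_iff) (metis iter_minus(2))

text \<open>A periodic orbit is finite, hence closed and invariant, hence the whole space by
  minimality; but a nonempty perfect Hausdorff space is infinite.\<close>

lemma iter_free:
  assumes x: "x \<in> topspace X" and a: "iter a x = x" shows "a = 0"
proof (rule ccontr)
  assume "a \<noteq> 0"
  define Orb where "Orb = range (\<lambda>k. iter k x)"
  have per: "iter (a * q) x = x" for q
  proof (induction q rule: int_induct[where k=0])
    case base then show ?case by (simp add: iter_0)
  next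
    case (step1 i)
    then show ?case using a by (simp add: algebra_simps iter_add)
  next
    case (step2 i)
    have "iter (- a) x = x" using iter_minus(1)[of a x] a by simp
    then show ?case using step2 iter_add[of "- a" "a * i" x] by (simp add: algebra_simps)
  qed
  have "Orb \<subseteq> (\<lambda>k. iter k x) ` {- \<bar>a\<bar>..\<bar>a\<bar>}"
  proof
    fix y assume "y \<in> Orb"
    then obtain k where k: "y = iter k x" by (auto simp: Orb_def)
    have "iter k x = iter (k mod a + a * (k div a)) x" by simp
    also have "\<dots> = iter (k mod a) x" by (simp only: iter_add per)
    finally have "y = iter (k mod a) x" using k by simp
    moreover have "\<bar>k mod a\<bar> \<le> \<bar>a\<bar>" using abs_mod_less[OF \<open>a \<noteq> 0\<close>, of k] by simp
    ultimately show "y \<in> (\<lambda>k. iter k x) ` {- \<bar>a\<bar>..\<bar>a\<bar>}" by (intro image_eqI[of _ _ "k mod a"]) auto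
  qed
  then have fin: "finite Orb" using finite_subset by blast
  have sub: "Orb \<subseteq> topspace X" using iter_mem[OF x] by (auto simp: Orb_def)
  have "closedin X Orb" using fin sub Hausdorff_X by (simp add: closedin_Hausdorff_finite)
  moreover have "\<phi> ` Orb = Orb"
  proof
    show "\<phi> ` Orb \<subseteq> Orb"
    proof
      fix y assume "y \<in> \<phi> ` Orb"
      then obtain k where "y = \<phi> (iter k x)" by (auto simp: Orb_def)
      then have "y = iter (1 + k) x" using iter_1 iter_mem[OF x] iter_add by simp
      then show "y \<in> Orb" by (simp add: Orb_def)
    qed
    show "Orb \<subseteq> \<phi> ` Orb"
    proof
      fix y assume "y \<in> Orb"
      then obtain k where "y = iter k x" by (auto simp: Orb_def)
      then have "y = \<phi> (iter (k - 1) x)" using iter_1[of "iter (k - 1) x"] iter_mem[OF x] iter_add[of 1 "k - 1" x] by simp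
      then show "y \<in> \<phi> ` Orb" by (auto simp: Orb_def)
    qed
  qed
  moreover have "Orb \<noteq> {}" by (simp add: Orb_def)
  ultimately have "Orb = topspace X"
    using cantor_minimal by (auto simp: Cantor_minimal_system_def minimal_homeomorphism_def)
  moreover have "infinite (topspace X)"
    using infinite_perfect_set[OF Hausdorff_X, of "topspace X"] cantor_minimal nonempty_X
    by (auto simp: Cantor_minimal_system_def Cantor_set_def)
  ultimately show False using fin by simp
qed

lemma clopen_iter: "A \<in> clopens \<Longrightarrow> iter a ` A \<in> clopens"
proof -
  assume A: "A \<in> clopens"
  then have "A \<subseteq> topspace X" using openin_subset by (auto simp: clopens_def)
  from iter_image[OF this] show ?thesis
    using A openin_continuous_map_preimage[OF continuous_iter] closedin_continuous_map_preimage[OF continuous_iter]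
    by (simp add: clopens_def)
qed

text \<open>In a compact Hausdorff space quasi-components are connected components, and these are
  single points here.\<close>

lemma clopens_separate:
  assumes x: "x \<in> topspace X" and y: "y \<in> topspace X" and ne: "x \<noteq> y"
  shows "\<exists>A\<in>clopens. x \<in> A \<and> y \<notin> A"
proof (rule ccontr)
  assume "\<not> ?thesis"
  then have "quasi_component_of X x y" using x y by (auto simp: quasi_component_of clopens_def)
  then have "connected_component_of X x y"
    using quasi_eq_connected_component_of[of X x] compact_X Hausdorff_X by simp
  then obtain C where "connectedin X C" "x \<in> C" "y \<in> C" by (auto simp: connected_component_of_def)
  moreover have "\<exists>a. C \<subseteq> {a}" if "connectedin X C" for C
    using that cantor_minimal by (auto simp: Cantor_minimal_system_def Cantor_set_def)
  ultimately show False using ne by blast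
qed

text \<open>The points whose orbits avoid \<open>A\<close> form a closed invariant set that misses
  \<open>A\<close>, so by minimality it is empty.\<close>

lemma orbit_meets_clopen:
  assumes A: "A \<in> clopens" "A \<noteq> {}" and x: "x \<in> topspace X" shows "\<exists>k. iter k x \<in> A"
proof -
  define C where "C = {y \<in> topspace X. \<forall>k. iter k y \<notin> A}"
  have "C = topspace X - (\<Union>k. {y \<in> topspace X. iter k y \<in> A})" by (auto simp: C_def)
  moreover have "openin X (\<Union>k. {y \<in> topspace X. iter k y \<in> A})"
    using A openin_continuous_map_preimage[OF continuous_iter] by (intro openin_Union) (auto simp: clopens_def)
  ultimately have "closedin X C" by auto
  moreover have "\<phi> ` C = C"
  proof
    show "\<phi> ` C \<subseteq> C"
    proof
      fix y assume "y \<in> \<phi> ` C"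
      then obtain z where z: "z \<in> C" "y = \<phi> z" by blast
      then have "y = iter 1 z" using iter_1 by (simp add: C_def)
      then have "y \<in> topspace X" "iter k y = iter (k + 1) z" for k using z iter_mem iter_add by (simp_all add: C_def)
      then show "y \<in> C" using z by (simp add: C_def)
    qed
    show "C \<subseteq> \<phi> ` C"
    proof
      fix y assume y: "y \<in> C"
      have "iter (- 1) y \<in> C" using y iter_mem iter_add[of _ "- 1" y, symmetric] by (simp add: C_def)
      moreover have "y = \<phi> (iter (- 1) y)"
        using iter_1[of "iter (- 1) y"] iter_mem[of y "- 1"] iter_minus(2)[of 1 y] y by (simp add: C_def)
      ultimately show "y \<in> \<phi> ` C" by blast
    qed
  qed
  moreover have "C \<noteq> topspace X"
  proof -
    obtain a where "a \<in> A" using A by blast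
    then have "a \<in> topspace X" "a \<notin> C"
      using openin_subset[of X A] A iter_0[of a] by (auto simp: C_def clopens_def intro: exI[of _ 0])
    then show ?thesis by blast
  qed
  ultimately have "C = {}"
    using cantor_minimal unfolding Cantor_minimal_system_def minimal_homeomorphism_def by blast
  then show ?thesis using x by (auto simp: C_def)
qed

sublocale clopen_system "topspace X" clopens iter
proof
  show "iter 0 x = x" for x by (rule iter_0)
  show "iter (a + b) x = iter a (iter b x)" for a b x by (rule iter_add)
  show "x \<in> topspace X \<Longrightarrow> iter a x \<in> topspace X" for x a by (rule iter_mem)
  show "x \<notin> topspace X \<Longrightarrow> iter a x = x" for x a by (simp add: iter_def)
  show "x \<in> topspace X \<Longrightarrow> iter a x = x \<Longrightarrow> a = 0" for x a by (rule iter_free)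
  show "topspace X \<noteq> {}" by (rule nonempty_X)
  show "A \<in> clopens \<Longrightarrow> A \<subseteq> topspace X" for A using openin_subset by (auto simp: clopens_def)
  show "topspace X \<in> clopens" by (simp add: clopens_def)
  show "A \<in> clopens \<Longrightarrow> topspace X - A \<in> clopens" for A by (auto simp: clopens_def)
  show "A \<in> clopens \<Longrightarrow> B \<in> clopens \<Longrightarrow> A \<union> B \<in> clopens" for A B by (auto simp: clopens_def)
  show "A \<in> clopens \<Longrightarrow> iter a ` A \<in> clopens" for A a by (rule clopen_iter)
  show "\<exists>\<V>\<subseteq>\<U>. finite \<V> \<and> topspace X \<subseteq> \<Union>\<V>" if \<U>: "\<U> \<subseteq> clopens" "topspace X \<subseteq> \<Union>\<U>" for \<U>
  proof -
    have "\<forall>U\<in>\<U>. openin X U" using \<U>(1) by (auto simp: clopens_def)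
    then obtain \<F> where "finite \<F>" "\<F> \<subseteq> \<U>" "topspace X \<subseteq> \<Union>\<F>"
      using compact_X[unfolded compact_space_alt, rule_format, of \<U>] \<U>(2) by auto
    then show ?thesis by (intro exI[of _ \<F>]) simp
  qed
  show "\<exists>A\<in>clopens. x \<in> A \<and> y \<notin> A" if "x \<in> topspace X" "y \<in> topspace X" "x \<noteq> y" for x y
    by (rule clopens_separate[OF that])
  show "\<exists>k. iter k x \<in> A" if "A \<in> clopens" "A \<noteq> {}" "x \<in> topspace X" for A x
    by (rule orbit_meets_clopen[OF that])
qed

lemma loc_const_iff_continuous: "loc_const n \<longleftrightarrow> continuous_map X (discrete_topology UNIV) n"
proof
  assume n: "loc_const n"
  show "continuous_map X (discrete_topology UNIV) n"
    unfolding continuous_map_def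
  proof (intro conjI allI impI)
    fix U
    show "openin X {x \<in> topspace X. n x \<in> U}"
      using loc_const_clopen[OF n, where p="\<lambda>v. v \<in> U"] by (simp add: clopens_def)
  qed auto
next
  assume n: "continuous_map X (discrete_topology UNIV) n"
  show "loc_const n"
  proof (rule loc_constI)
    fix x assume x: "x \<in> topspace X"
    have "openin X {y \<in> topspace X. n y \<in> {n x}}" "closedin X {y \<in> topspace X. n y \<in> {n x}}"
      by (rule openin_continuous_map_preimage[OF n], simp, rule closedin_continuous_map_preimage[OF n], simp)
    then show "\<exists>B\<in>clopens. x \<in> B \<and> (\<forall>y\<in>B. n y = n x)"
      using x by (intro bexI[of _ "{y \<in> topspace X. n y \<in> {n x}}"]) (auto simp: clopens_def)
  qed
qed

subsection \<open>The full group inside the group of bijections\<close>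

definition rst :: "('a \<Rightarrow> 'a) \<Rightarrow> 'a \<Rightarrow> 'a" where
  "rst g = restrict g (topspace X)"

lemma rst_apply [simp]: "x \<in> topspace X \<Longrightarrow> rst g x = g x"
  by (simp add: rst_def)

lemma rst_Bij: "g \<in> full \<Longrightarrow> rst g \<in> Bij (topspace X)"
proof -
  assume g: "g \<in> full"
  have "bij_betw g (topspace X) (topspace X)"
    unfolding bij_betw_def
  proof
    show "inj_on g (topspace X)" using full_inj[OF g] by (auto simp: inj_on_def)
    show "g ` topspace X = topspace X" using g by (auto simp: mem_full_image set_eq_iff)
  qed
  then show ?thesis by (simp add: Bij_def rst_def bij_betw_cong[of "topspace X" "restrict g (topspace X)" g])
qed

lemma inj_on_rst: "inj_on rst full"
proof
  fix g h assume g: "g \<in> full" and h: "h \<in> full" and eq: "rst g = rst h"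
  show "g = h"
  proof
    fix x show "g x = h x"
      using fun_cong[OF eq, of x] full_outside[OF g, of x] full_outside[OF h, of x] by (cases "x \<in> topspace X") auto
  qed
qed

lemma rst_comp: "g \<in> full \<Longrightarrow> h \<in> full \<Longrightarrow> rst (g \<circ> h) = rst g \<otimes>\<^bsub>BijGroup (topspace X)\<^esub> rst h"
  unfolding mult_BijGroup[OF rst_Bij rst_Bij] by (auto simp: fun_eq_iff compose_def rst_def)

lemma continuous_full:
  assumes g: "g \<in> full" shows "continuous_map X X g"
  unfolding continuous_map_def
proof (intro conjI allI impI)
  show "g \<in> topspace X \<rightarrow> topspace X" using g by simp
  fix U assume U: "openin X U"
  show "openin X {x \<in> topspace X. g x \<in> U}"
  proof (subst openin_subopen, intro ballI)
    fix x assume "x \<in> {x \<in> topspace X. g x \<in> U}"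
    then have x: "x \<in> topspace X" "g x \<in> U" by auto
    obtain B k where B: "B \<in> clopens" "x \<in> B" "\<And>y. y \<in> B \<Longrightarrow> cocycle g y = k"
      using loc_constE[OF loc_const_cocycle[OF g] x(1)] by metis
    have eq: "g y = iter k y" if "y \<in> B" for y
      using full_apply[OF g, of y] B(3)[OF that] clopen_subset[OF B(1)] that by auto
    have "openin X (B \<inter> {y \<in> topspace X. iter k y \<in> U})"
      using B(1) openin_continuous_map_preimage[OF continuous_iter U] by (auto simp: clopens_def)
    then show "\<exists>V. openin X V \<and> x \<in> V \<and> V \<subseteq> {x \<in> topspace X. g x \<in> U}"
      using x B(2) eq by (intro exI[of _ "B \<inter> {y \<in> topspace X. iter k y \<in> U}"]) auto
  qed
qed

lemma carrier_topological_full_group: "carrier (topological_full_group X \<phi>) = rst ` full"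
proof
  show "rst ` full \<subseteq> carrier (topological_full_group X \<phi>)"
  proof
    fix \<gamma> assume "\<gamma> \<in> rst ` full"
    then obtain g where g: "g \<in> full" "\<gamma> = rst g" by blast
    have B: "rst g \<in> Bij (topspace X)" by (rule rst_Bij[OF g(1)])
    have "continuous_map X X (rst g)"
      by (rule continuous_map_eq[OF continuous_full[OF g(1)]]) simp
    \<comment> \<open>A continuous bijection of a compact Hausdorff space is a
      homeomorphism.\<close>
    then have "homeomorphic_map X X (rst g)"
      using B by (intro continuous_imp_homeomorphic_map[OF _ compact_X Hausdorff_X]) (auto simp: Bij_def bij_betw_def)
    moreover have "orbit_cocycle X \<phi> (rst g) (cocycle g)"
      unfolding orbit_cocycle_def
    proof
      show "continuous_map X (discrete_topology UNIV) (cocycle g)"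
        using loc_const_cocycle[OF g(1)] loc_const_iff_continuous by blast
      show "\<forall>x\<in>topspace X. rst g x = iterate X \<phi> (cocycle g x) x"
        using full_apply[OF g(1)] by (simp add: iter_def)
    qed
    ultimately show "\<gamma> \<in> carrier (topological_full_group X \<phi>)"
      using B unfolding g(2) topological_full_group_def by auto
  qed
  show "carrier (topological_full_group X \<phi>) \<subseteq> rst ` full"
  proof
    fix \<gamma> assume "\<gamma> \<in> carrier (topological_full_group X \<phi>)"
    then obtain n where B: "\<gamma> \<in> Bij (topspace X)" and n: "orbit_cocycle X \<phi> \<gamma> n"
      by (auto simp: topological_full_group_def)
    define g where "g x = (if x \<in> topspace X then \<gamma> x else x)" for x
    have bb: "bij_betw \<gamma> (topspace X) (topspace X)" using B by (simp add: Bij_def)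
    have "bij g"
    proof -
      have "bij_betw g (topspace X) (topspace X)"
        using bb by (simp add: g_def bij_betw_cong[of "topspace X" g \<gamma>])
      moreover have "bij_betw g (- topspace X) (- topspace X)"
        by (rule bij_betw_cong[THEN iffD2, OF _ bij_betw_id]) (simp add: g_def)
      ultimately have "bij_betw g (topspace X \<union> - topspace X) (topspace X \<union> - topspace X)"
        by (rule bij_betw_combine) simp
      then show ?thesis by simp
    qed
    moreover have "loc_const n" using n[unfolded orbit_cocycle_def] loc_const_iff_continuous[of n] by blast
    ultimately have "g \<in> full"
      using n by (intro fullI) (simp_all add: g_def orbit_cocycle_def iter_def)
    moreover have "\<gamma> = rst g"
      using B by (auto simp: rst_def g_def Bij_def extensional_def fun_eq_iff)
    ultimately show "\<gamma> \<in> rst ` full" by blast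
  qed
qed

text \<open>Treats the full group and the kernel of the index alike: finite generation is
  transferred once for every subgroup \<open>K\<close> of \<open>full\<close>.\<close>

definition bij_subgroup :: "('a \<Rightarrow> 'a) set \<Rightarrow> ('a \<Rightarrow> 'a) monoid" where
  "bij_subgroup K = (BijGroup (topspace X)) \<lparr>carrier := rst ` K\<rparr>"

context
  fixes K assumes K: "K \<subseteq> full" "id \<in> K" "\<And>g h. g \<in> K \<Longrightarrow> h \<in> K \<Longrightarrow> g \<circ> h \<in> K" "\<And>g. g \<in> K \<Longrightarrow> inv g \<in> K"
begin

lemma bij_subgroup_mult: "g \<in> K \<Longrightarrow> h \<in> K \<Longrightarrow> rst g \<otimes>\<^bsub>bij_subgroup K\<^esub> rst h = rst (g \<circ> h)"
  using rst_comp[of g h] K(1) by (simp add: bij_subgroup_def subset_iff)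

lemma bij_subgroup_one: "\<one>\<^bsub>bij_subgroup K\<^esub> = rst id"
  by (simp add: bij_subgroup_def one_BijGroup rst_def id_def)

lemma bij_subgroup_carrier: "carrier (bij_subgroup K) = rst ` K"
  by (simp add: bij_subgroup_def)

lemma inv_comp: "g \<in> K \<Longrightarrow> inv g \<circ> g = id"
  using K(1) by (auto simp: fun_eq_iff)

lemma group_bij_subgroup: "group (bij_subgroup K)"
proof (rule groupI)
  fix x y z assume "x \<in> carrier (bij_subgroup K)" "y \<in> carrier (bij_subgroup K)" "z \<in> carrier (bij_subgroup K)"
  then obtain f g h where f: "f \<in> K" "x = rst f" and g: "g \<in> K" "y = rst g" and h: "h \<in> K" "z = rst h"
    unfolding bij_subgroup_carrier by blast
  show "x \<otimes>\<^bsub>bij_subgroup K\<^esub> y \<otimes>\<^bsub>bij_subgroup K\<^esub> z = x \<otimes>\<^bsub>bij_subgroup K\<^esub> (y \<otimes>\<^bsub>bij_subgroup K\<^esub> z)"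
    by (simp only: f g h bij_subgroup_mult K comp_assoc)
next
  fix x y assume "x \<in> carrier (bij_subgroup K)" "y \<in> carrier (bij_subgroup K)"
  then obtain f g where f: "f \<in> K" "x = rst f" and g: "g \<in> K" "y = rst g"
    unfolding bij_subgroup_carrier by blast
  have "rst (f \<circ> g) \<in> rst ` K" by (rule imageI[OF K(3)[OF f(1) g(1)]])
  then show "x \<otimes>\<^bsub>bij_subgroup K\<^esub> y \<in> carrier (bij_subgroup K)"
    unfolding bij_subgroup_carrier f(2) g(2) bij_subgroup_mult[OF f(1) g(1)] .
next
  show "\<one>\<^bsub>bij_subgroup K\<^esub> \<in> carrier (bij_subgroup K)"
    unfolding bij_subgroup_one bij_subgroup_carrier by (rule imageI[OF K(2)])
next
  fix x assume "x \<in> carrier (bij_subgroup K)"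
  then obtain f where f: "f \<in> K" "x = rst f" unfolding bij_subgroup_carrier by blast
  show "\<one>\<^bsub>bij_subgroup K\<^esub> \<otimes>\<^bsub>bij_subgroup K\<^esub> x = x"
    unfolding f(2) bij_subgroup_one bij_subgroup_mult[OF K(2) f(1)] by (simp only: id_comp)
  have "rst (inv f) \<otimes>\<^bsub>bij_subgroup K\<^esub> x = \<one>\<^bsub>bij_subgroup K\<^esub>"
    unfolding f(2) bij_subgroup_one bij_subgroup_mult[OF K(4)[OF f(1)] f(1)] inv_comp[OF f(1)] ..
  then show "\<exists>y\<in>carrier (bij_subgroup K). y \<otimes>\<^bsub>bij_subgroup K\<^esub> x = \<one>\<^bsub>bij_subgroup K\<^esub>"
    unfolding bij_subgroup_carrier using K(4)[OF f(1)] by blast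
qed

lemma bij_subgroup_inv: "g \<in> K \<Longrightarrow> m_inv (bij_subgroup K) (rst g) = rst (inv g)"
proof -
  assume g: "g \<in> K"
  have "rst (inv g) \<otimes>\<^bsub>bij_subgroup K\<^esub> rst g = \<one>\<^bsub>bij_subgroup K\<^esub>"
    unfolding bij_subgroup_one bij_subgroup_mult[OF K(4)[OF g] g] inv_comp[OF g] ..
  then show ?thesis
    using g K(4) by (intro group.inv_equality[OF group_bij_subgroup]) (simp_all add: bij_subgroup_carrier)
qed

lemma generated_closed: "F \<subseteq> K \<Longrightarrow> generated F \<subseteq> K"
proof
  fix x assume F: "F \<subseteq> K" and "x \<in> generated F"
  from this(2) show "x \<in> K" by induction (use F K in blast)+
qed

lemma generate_bij_subgroup:
  assumes F: "F \<subseteq> K" shows "generate (bij_subgroup K) (rst ` F) = rst ` generated F"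
proof
  show "generate (bij_subgroup K) (rst ` F) \<subseteq> rst ` generated F"
  proof
    fix x assume "x \<in> generate (bij_subgroup K) (rst ` F)"
    then show "x \<in> rst ` generated F"
    proof induction
      case one
      then show ?case unfolding bij_subgroup_one by (rule imageI[OF generated_id])
    next
      case (incl h)
      then show ?case using generated_incl by blast
    next
      case (inv h)
      then obtain g where g: "g \<in> F" "h = rst g" by blast
      have "m_inv (bij_subgroup K) h = rst (inv g)" unfolding g(2) using F g(1) by (intro bij_subgroup_inv) blast
      then show ?case using generated_inv[OF generated_incl[OF g(1)]] by blast
    next
      case (eng h1 h2)
      then obtain g1 g2 where g: "g1 \<in> generated F" "g2 \<in> generated F" "h1 = rst g1" "h2 = rst g2" by blast
      have "h1 \<otimes>\<^bsub>bij_subgroup K\<^esub> h2 = rst (g1 \<circ> g2)"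
        unfolding g(3,4) using generated_closed[OF F] g(1,2) by (intro bij_subgroup_mult) blast+
      then show ?case using generated_comp[OF g(1,2)] by blast
    qed
  qed
  show "rst ` generated F \<subseteq> generate (bij_subgroup K) (rst ` F)"
  proof
    have carr: "rst ` F \<subseteq> carrier (bij_subgroup K)" unfolding bij_subgroup_carrier using F by blast
    fix x assume "x \<in> rst ` generated F"
    then obtain g where g: "g \<in> generated F" "x = rst g" by blast
    from g(1) have "rst g \<in> generate (bij_subgroup K) (rst ` F)"
    proof induction
      case generated_id
      then show ?case unfolding bij_subgroup_one[symmetric] by (rule generate.one)
    next
      case (generated_incl g)
      then show ?case by (intro generate.incl) blast
    next
      case (generated_comp g h)
      have "g \<in> K" "h \<in> K" using generated_closed[OF F] generated_comp.hyps by blast+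
      then show ?case using generate.eng[OF generated_comp.IH] by (simp only: bij_subgroup_mult)
    next
      case (generated_inv g)
      have "g \<in> K" using generated_closed[OF F] generated_inv.hyps by blast
      then show ?case
        using group.generate_m_inv_closed[OF group_bij_subgroup carr generated_inv.IH] by (simp only: bij_subgroup_inv)
    qed
    then show "x \<in> generate (bij_subgroup K) (rst ` F)" using g(2) by simp
  qed
qed

lemma finitely_generated_bij_subgroup:
  "finitely_generated_group (bij_subgroup K) \<longleftrightarrow> (\<exists>F. finite F \<and> F \<subseteq> K \<and> generated F = K)"
proof
  assume "finitely_generated_group (bij_subgroup K)"
  then obtain A where A: "finite A" "A \<subseteq> rst ` K" "generate (bij_subgroup K) A = rst ` K"
    unfolding finitely_generated_group_def bij_subgroup_carrier by blast
  obtain F where F: "finite F" "F \<subseteq> K" "A = rst ` F" using finite_subset_image[OF A(1,2)] by blast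
  have "rst ` generated F = rst ` K" using A(3) generate_bij_subgroup[OF F(2)] F(3) by simp
  then have "generated F = K"
    using inj_on_image_eq_iff[OF inj_on_rst] generated_closed[OF F(2)] K(1) by (metis subset_trans)
  then show "\<exists>F. finite F \<and> F \<subseteq> K \<and> generated F = K" using F by blast
next
  assume "\<exists>F. finite F \<and> F \<subseteq> K \<and> generated F = K"
  then obtain F where F: "finite F" "F \<subseteq> K" "generated F = K" by blast
  then show "finitely_generated_group (bij_subgroup K)"
    unfolding finitely_generated_group_def bij_subgroup_carrier
    using generate_bij_subgroup[OF F(2)] by (intro exI[of _ "rst ` F"]) auto
qed

end

lemma finitely_generated_topological_full_group:
  "finitely_generated_group (topological_full_group X \<phi>) \<longleftrightarrow> (\<exists>F. finite F \<and> F \<subseteq> full \<and> generated F = full)"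
proof -
  have "topological_full_group X \<phi> = bij_subgroup full"
    using carrier_topological_full_group by (simp add: bij_subgroup_def topological_full_group_def)
  then show ?thesis
    using finitely_generated_bij_subgroup[OF order_refl id_full comp_full inv_full] by simp
qed

end

subsection \<open>Existence of an invariant measure\<close>

text \<open>A cluster point, in the compact space of all functions from sets to \<open>[0, 1]\<close>, of the relative
  frequencies along the sequence.\<close>

lemma exists_shift_invariant_mean:
  fixes s :: "nat \<Rightarrow> 'a"
  obtains m :: "'a set \<Rightarrow> real" where "\<And>U. 0 \<le> m U" "m UNIV = 1"
    "\<And>U V. U \<inter> V = {} \<Longrightarrow> m (U \<union> V) = m U + m V"
    "\<And>U V. (\<And>j. s j \<in> U \<longleftrightarrow> s (Suc j) \<in> V) \<Longrightarrow> m U = m V"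
proof -
  define a :: "nat \<Rightarrow> 'a set \<Rightarrow> real" where
    "a n U = (\<Sum>j<Suc n. indicator U (s j)) / real (Suc n)" for n U
  define K :: "('a set \<Rightarrow> real) set" where "K = PiE UNIV (\<lambda>_. {0..1})"
  define F where "F k = closure (a ` {k..})" for k
  have "compactin (product_topology (\<lambda>_. euclidean) UNIV) K"
    unfolding K_def compactin_PiE by simp
  then have K: "compact K" by (simp add: euclidean_product_topology)
  have "0 \<le> a n U" "a n U \<le> 1" for n U
  proof -
    have "(\<Sum>j<Suc n. indicator U (s j) :: real) \<le> (\<Sum>j<Suc n. 1)" by (rule sum_mono) (simp add: indicator_def)
    then show "a n U \<le> 1" by (simp add: a_def divide_le_eq)
    have "(\<Sum>j<Suc n. indicator U (s j) :: real) \<ge> 0" by (rule sum_nonneg) simp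
    then show "0 \<le> a n U" unfolding a_def by (intro divide_nonneg_nonneg) simp_all
  qed
  then have aK: "a n \<in> K" for n by (simp add: K_def PiE_def)
  have "K \<inter> (\<Inter>k\<in>UNIV. F k) \<noteq> {}"
  proof (rule compact_imp_fip_image[OF K])
    show "closed (F k)" for k by (simp add: F_def)
    fix I :: "nat set" assume "finite I"
    then obtain n where "\<forall>i\<in>I. i \<le> n" using finite_nat_set_iff_bounded_le by blast
    then have "a n \<in> F i" if "i \<in> I" for i
      using that closure_subset[of "a ` {i..}"] by (auto simp: F_def)
    then show "K \<inter> (\<Inter>k\<in>I. F k) \<noteq> {}" using aK by blast
  qed
  then obtain m where m: "\<And>k. m \<in> F k" by blast
  \<comment> \<open>Closed conditions that hold for all late averages pass to the cluster
    point.\<close>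
  have closed: "m \<in> C" if "closed C" "\<And>n. n \<ge> k \<Longrightarrow> a n \<in> C" for C k
    using m[of k] closure_minimal[of "a ` {k..}" C] that by (auto simp: F_def)
  have cont: "continuous_on UNIV (\<lambda>f :: 'a set \<Rightarrow> real. f U)" for U by simp
  show ?thesis
  proof (rule that)
    show "0 \<le> m U" for U
    proof -
      have "m \<in> {f. 0 \<le> f U}"
        by (rule closed[of _ 0])
          (use \<open>\<And>n U. 0 \<le> a n U\<close> in \<open>auto intro!: closed_Collect_le continuous_intros\<close>)
      then show ?thesis by simp
    qed
    show "m UNIV = 1"
    proof -
      have "m \<in> {f. f UNIV = 1}"
      proof (rule closed[of _ 0])
        show "closed {f :: 'a set \<Rightarrow> real. f UNIV = 1}" by (intro closed_Collect_eq continuous_intros cont)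
        show "a n \<in> {f. f UNIV = 1}" for n by (simp add: a_def del: of_nat_Suc)
      qed
      then show ?thesis by simp
    qed
    show "m (U \<union> V) = m U + m V" if "U \<inter> V = {}" for U V
    proof -
      have "m \<in> {f. f (U \<union> V) = f U + f V}"
      proof (rule closed[of _ 0])
        show "closed {f :: 'a set \<Rightarrow> real. f (U \<union> V) = f U + f V}"
          by (intro closed_Collect_eq continuous_intros cont)
        have "indicator (U \<union> V) x = (indicator U x + indicator V x :: real)" for x
          using that by (auto simp: indicator_def)
        then show "a n \<in> {f. f (U \<union> V) = f U + f V}" for n
          by (simp add: a_def sum.distrib add_divide_distrib del: of_nat_Suc sum.lessThan_Suc)
      qed
      then show ?thesis by simp
    qed
    show "m U = m V" if UV: "\<And>j. s j \<in> U \<longleftrightarrow> s (Suc j) \<in> V" for U V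
    proof (rule ccontr)
      assume "m U \<noteq> m V"
      define e where "e = \<bar>m U - m V\<bar> / 2"
      have e: "e > 0" using \<open>m U \<noteq> m V\<close> by (simp add: e_def)
      obtain k where k: "inverse (real (Suc k)) < e" using reals_Archimedean[OF e] by blast
      \<comment> \<open>The difference of the two sums telescopes to boundary terms, so the averages
        at \<open>n\<close> differ by at most \<open>1 / (n + 1)\<close>.\<close>
      have "m \<in> {f. \<bar>f U - f V\<bar> \<le> e}"
      proof (rule closed[of _ k])
        show "closed {f :: 'a set \<Rightarrow> real. \<bar>f U - f V\<bar> \<le> e}"
          by (intro closed_Collect_le continuous_intros cont)
        fix n assume n: "n \<ge> k"
        have "(\<Sum>j<Suc n. indicator U (s j)) - (\<Sum>j<Suc n. indicator V (s j)) =
          (\<Sum>j<Suc n. indicator V (s (Suc j)) - indicator V (s j) :: real)"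
          using UV by (simp add: sum_subtractf indicator_def del: sum.lessThan_Suc)
        also have "\<dots> = indicator V (s (Suc n)) - indicator V (s 0)" by (rule sum_lessThan_telescope)
        finally have "\<bar>(\<Sum>j<Suc n. indicator U (s j)) - (\<Sum>j<Suc n. indicator V (s j))\<bar> \<le> (1 :: real)"
          by (simp add: indicator_def)
        then have "\<bar>a n U - a n V\<bar> \<le> inverse (real (Suc n))"
          unfolding a_def by (simp only: diff_divide_distrib[symmetric] abs_divide) (simp add: divide_simps)
        also have "\<dots> \<le> inverse (real (Suc k))" using n by (intro le_imp_inverse_le) auto
        finally show "a n \<in> {f. \<bar>f U - f V\<bar> \<le> e}" using k by simp
      qed
      then show False using e by (simp add: e_def)
    qed
  qed
qed

context cantor_minimal_system
begin

text \<open>The complement of \<open>U\<close> is covered by complements of clopen neighbourhoods of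
  \<open>x\<close>; removing a finite subcover from the space leaves a clopen neighbourhood inside
  \<open>U\<close>.\<close>

lemma clopen_basis:
  assumes U: "openin X U" and x: "x \<in> U" shows "\<exists>B\<in>clopens. x \<in> B \<and> B \<subseteq> U"
proof -
  define \<U> where "\<U> = {topspace X - A |A. A \<in> clopens \<and> x \<in> A}"
  have xS: "x \<in> topspace X" using openin_subset[OF U] x by blast
  have "topspace X \<subseteq> \<Union>(insert U \<U>)"
  proof
    fix y assume y: "y \<in> topspace X"
    show "y \<in> \<Union>(insert U \<U>)"
    proof (cases "y = x")
      case True then show ?thesis using x by simp
    next
      case False
      then obtain A where "A \<in> clopens" "x \<in> A" "y \<notin> A" using clopens_separate[OF xS y] by blast
      then show ?thesis using y by (auto simp: \<U>_def)
    qed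
  qed
  moreover have Uc: "\<U> \<subseteq> clopens" by (auto simp: \<U>_def intro: clopen_compl)
  then have "\<forall>V\<in>insert U \<U>. openin X V" using U by (auto simp: clopens_def)
  ultimately obtain \<F> where F: "finite \<F>" "\<F> \<subseteq> insert U \<U>" "topspace X \<subseteq> \<Union>\<F>"
    using compact_X[unfolded compact_space_alt, rule_format, of "insert U \<U>"] by auto
  have "topspace X - \<Union>(\<F> - {U}) \<in> clopens"
    by (intro clopen_compl clopen_Union) (use F Uc in auto)
  moreover have "x \<in> topspace X - \<Union>(\<F> - {U})" using xS F(2) by (auto simp: \<U>_def)
  moreover have "topspace X - \<Union>(\<F> - {U}) \<subseteq> U" using F(3) by blast
  ultimately show ?thesis by blast
qed

text \<open>By metrizability \<open>U\<close> is a countable union of closed sets, and by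
  compactness a clopen set fits between each of them and \<open>U\<close>.\<close>

lemma open_in_sigma_clopens:
  assumes U: "openin X U" shows "U \<in> sigma_sets (topspace X) clopens"
proof -
  obtain C where C: "\<And>n::nat. closedin X (C n)" "\<Union>(range C) = U"
    using open_imp_fsigma_in[OF metrizable_X U] by (auto simp: fsigma_in_ascending)
  have "\<exists>D\<in>clopens. C n \<subseteq> D \<and> D \<subseteq> U" for n
  proof -
    have CU: "C n \<subseteq> U" using C(2) by blast
    define \<U> where "\<U> = {B \<in> clopens. B \<subseteq> U \<or> B \<inter> C n = {}}"
    have "topspace X \<subseteq> \<Union>\<U>"
    proof
      fix x assume x: "x \<in> topspace X"
      show "x \<in> \<Union>\<U>"
      proof (cases "x \<in> U")
        case True
        then show ?thesis using clopen_basis[OF U] by (auto simp: \<U>_def)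
      next
        case False
        then have "x \<in> topspace X - C n" using x CU by blast
        moreover have "openin X (topspace X - C n)" using C(1)[of n] by (rule openin_diff[OF openin_topspace])
        ultimately obtain B where "B \<in> clopens" "x \<in> B" "B \<subseteq> topspace X - C n" using clopen_basis by blast
        then have "B \<in> \<U>" by (auto simp: \<U>_def)
        then show ?thesis using \<open>x \<in> B\<close> by blast
      qed
    qed
    moreover have "\<U> \<subseteq> clopens" by (auto simp: \<U>_def)
    ultimately obtain \<V> where V: "\<V> \<subseteq> \<U>" "finite \<V>" "topspace X \<subseteq> \<Union>\<V>" using clopen_compact by metis
    define D where "D = \<Union>{B \<in> \<V>. B \<subseteq> U}"
    have "D \<in> clopens" unfolding D_def by (rule clopen_Union) (use V in \<open>auto simp: \<U>_def\<close>)
    moreover have "C n \<subseteq> D"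
    proof
      fix x assume x: "x \<in> C n"
      then have "x \<in> topspace X" using closedin_subset[OF C(1)] by blast
      then obtain B where "B \<in> \<V>" "x \<in> B" using V(3) by blast
      then have "B \<subseteq> U" using V(1) x by (auto simp: \<U>_def)
      then show "x \<in> D" using \<open>B \<in> \<V>\<close> \<open>x \<in> B\<close> by (auto simp: D_def)
    qed
    moreover have "D \<subseteq> U" by (auto simp: D_def)
    ultimately show ?thesis by blast
  qed
  then obtain D where D: "\<And>n. D n \<in> clopens" "\<And>n. C n \<subseteq> D n" "\<And>n. D n \<subseteq> U" by metis
  have "U = (\<Union>n. D n)" using C(2) D(2,3) by blast
  moreover have "(\<Union>n. D n) \<in> sigma_sets (topspace X) clopens"
    using D(1) by (intro sigma_sets.Union sigma_sets.Basic)
  ultimately show ?thesis by simp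
qed

lemma sigma_clopens: "sigma_sets (topspace X) clopens = sigma_sets (topspace X) {U. openin X U}"
proof
  show "sigma_sets (topspace X) clopens \<subseteq> sigma_sets (topspace X) {U. openin X U}"
    by (rule sigma_sets_subseteq) (auto simp: clopens_def)
  show "sigma_sets (topspace X) {U. openin X U} \<subseteq> sigma_sets (topspace X) clopens"
    by (rule sigma_sets_mono) (auto intro: open_in_sigma_clopens)
qed

lemma clopens_Pow: "clopens \<subseteq> Pow (topspace X)"
  using clopen_subset by blast

text \<open>A decreasing sequence of clopen sets with empty intersection is eventually empty by
  compactness, so finitely additive frequencies are continuous at the empty set and extend to a
  measure. Invariance is checked on clopen sets, a generator stable under intersections.\<close>

lemma exists_invariant_prob_measure: "\<exists>\<mu>. invariant_prob_measure X \<phi> \<mu>"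
proof -
  obtain x0 where x0: "x0 \<in> topspace X" using nonempty_X by blast
  define s where "s j = iter (int j) x0" for j
  obtain m :: "'a set \<Rightarrow> real" where m: "\<And>U. 0 \<le> m U" "m UNIV = 1"
    "\<And>U V. U \<inter> V = {} \<Longrightarrow> m (U \<union> V) = m U + m V"
    "\<And>U V. (\<And>j. s j \<in> U \<longleftrightarrow> s (Suc j) \<in> V) \<Longrightarrow> m U = m V"
    by (rule exists_shift_invariant_mean[of s]) blast
  have sS: "s j \<in> topspace X" for j using x0 by (simp add: s_def)
  have m_space: "m (topspace X) = 1" using m(4)[of "topspace X" UNIV] sS m(2) by simp
  have m_empty: "m {} = 0" using m(3)[of "{}" "{}"] by simp
  have m_phi: "m {x \<in> topspace X. \<phi> x \<in> A} = m A" for A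
  proof (rule m(4))
    fix j
    have "s (Suc j) = \<phi> (s j)" using iter_1[OF sS] iter_add[of 1 "int j" x0] by (simp add: s_def)
    then show "s j \<in> {x \<in> topspace X. \<phi> x \<in> A} \<longleftrightarrow> s (Suc j) \<in> A" using sS by simp
  qed
  interpret ring_of_sets "topspace X" clopens
    unfolding ring_of_sets_iff using clopens_Pow clopen_empty clopen_Un clopen_Diff by blast
  have "\<exists>\<nu>. (\<forall>A\<in>clopens. \<nu> A = ennreal (m A)) \<and> measure_space (topspace X) (sigma_sets (topspace X) clopens) \<nu>"
  proof (rule caratheodory_empty_continuous)
    show "positive clopens (\<lambda>A. ennreal (m A))" by (simp add: positive_def m_empty)
    show "additive clopens (\<lambda>A. ennreal (m A))" using m(1,3) by (simp add: additive_def)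
    show "ennreal (m A) \<noteq> \<infinity>" for A by simp
    fix A :: "nat \<Rightarrow> 'a set" assume A: "range A \<subseteq> clopens" "decseq A" "(\<Inter>i. A i) = {}"
    have "topspace X \<subseteq> \<Union>((\<lambda>i. topspace X - A i) ` UNIV)" using A(3) by blast
    moreover have "(\<lambda>i. topspace X - A i) ` UNIV \<subseteq> clopens" using A(1) clopen_compl by blast
    ultimately obtain \<V> where "\<V> \<subseteq> (\<lambda>i. topspace X - A i) ` UNIV" "finite \<V>" "topspace X \<subseteq> \<Union>\<V>"
      using clopen_compact by metis
    then obtain I where I: "finite I" "topspace X \<subseteq> (\<Union>i\<in>I. topspace X - A i)" by (metis finite_subset_image)
    obtain n where n: "\<forall>i\<in>I. i \<le> n" using I(1) finite_nat_set_iff_bounded_le by blast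
    have "A k = {}" if "k \<ge> n" for k
    proof -
      have "A k \<subseteq> A i" if "i \<in> I" for i by (rule decseqD[OF A(2)]) (use n that \<open>k \<ge> n\<close> in force)
      moreover have "A k \<subseteq> topspace X" using A(1) clopens_Pow by blast
      ultimately show ?thesis using I(2) by blast
    qed
    then have "eventually (\<lambda>k. ennreal (m (A k)) = 0) sequentially"
      unfolding eventually_sequentially by (intro exI[of _ n]) (simp add: m_empty)
    then show "(\<lambda>k. ennreal (m (A k))) \<longlonglongrightarrow> 0" by (rule tendsto_eventually)
  qed
  then obtain \<nu> where \<nu>: "\<And>A. A \<in> clopens \<Longrightarrow> \<nu> A = ennreal (m A)"
    "measure_space (topspace X) (sigma_sets (topspace X) clopens) \<nu>" by blast
  define \<mu> where "\<mu> = measure_of (topspace X) clopens \<nu>"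
  have sets: "sets \<mu> = sigma_sets (topspace X) clopens" and space: "space \<mu> = topspace X"
    using clopens_Pow by (simp_all add: \<mu>_def)
  have em: "emeasure \<mu> A = ennreal (m A)" if "A \<in> clopens" for A
  proof -
    have "emeasure \<mu> A = \<nu> A"
      using emeasure_measure_of[OF \<mu>_def clopens_Pow] \<nu>(2) that sets
      by (simp add: measure_space_def sigma_sets.Basic)
    then show ?thesis using \<nu>(1)[OF that] by simp
  qed
  have pre: "{x \<in> topspace X. \<phi> x \<in> A} \<in> clopens" if "A \<in> clopens" for A
    using that openin_continuous_map_preimage[OF homeomorphic_imp_continuous_map[OF homeomorphic_phi]]
      closedin_continuous_map_preimage[OF homeomorphic_imp_continuous_map[OF homeomorphic_phi]]
    by (simp add: clopens_def)
  have vim: "\<phi> -` A \<inter> topspace X = {x \<in> topspace X. \<phi> x \<in> A}" for A by auto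
  have phi_meas: "\<phi> \<in> measurable \<mu> \<mu>"
  proof (rule measurable_sigma_sets[OF sets clopens_Pow])
    show "\<phi> \<in> space \<mu> \<rightarrow> topspace X" using homeomorphic_imp_surjective_map[OF homeomorphic_phi] by (auto simp: space)
    show "\<phi> -` A \<inter> space \<mu> \<in> sets \<mu>" if "A \<in> clopens" for A
      unfolding space vim sets using pre[OF that] by (rule sigma_sets.Basic)
  qed
  have "distr \<mu> \<mu> \<phi> = \<mu>"
  proof (rule measure_eqI_generator_eq[where A="\<lambda>_. topspace X"])
    show "Int_stable clopens" by (rule Int_stableI) (rule clopen_Int)
    show "emeasure (distr \<mu> \<mu> \<phi>) A = emeasure \<mu> A" if A: "A \<in> clopens" for A
    proof -
      have "A \<in> sets \<mu>" unfolding sets using A by (rule sigma_sets.Basic)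
      then have "emeasure (distr \<mu> \<mu> \<phi>) A = emeasure \<mu> {x \<in> topspace X. \<phi> x \<in> A}"
        using emeasure_distr[OF phi_meas] by (simp add: space vim)
      then show ?thesis by (simp add: em pre A m_phi)
    qed
    show "emeasure (distr \<mu> \<mu> \<phi>) (topspace X) \<noteq> \<infinity>" for i :: nat
      using emeasure_distr[OF phi_meas, of "topspace X"] em[OF clopen_space] em[OF pre[OF clopen_space]] sets clopen_space
      by (simp add: space vim sigma_sets.Basic)
  qed (use clopens_Pow clopen_space sets in auto)
  moreover have "prob_space \<mu>"
    by (rule prob_spaceI) (simp add: space em[OF clopen_space] m_space)
  ultimately show ?thesis
    unfolding invariant_prob_measure_def using sets space sigma_clopens by blast
qed

section \<open>The index map as the flow\<close>

lemma phi_measurable: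
  assumes "invariant_prob_measure X \<phi> \<mu>" shows "\<phi> \<in> measurable \<mu> \<mu>"
proof (rule measurable_sigma_sets)
  have sets: "sets \<mu> = sigma_sets (topspace X) {U. openin X U}" and space: "space \<mu> = topspace X"
    using assms by (auto simp: invariant_prob_measure_def)
  show "sets \<mu> = sigma_sets (topspace X) {U. openin X U}" by (rule sets)
  show "{U. openin X U} \<subseteq> Pow (topspace X)" using openin_subset by blast
  show "\<phi> \<in> space \<mu> \<rightarrow> topspace X" using homeomorphic_imp_surjective_map[OF homeomorphic_phi] by (auto simp: space)
  show "\<phi> -` A \<inter> space \<mu> \<in> sets \<mu>" if A: "A \<in> {U. openin X U}" for A
  proof -
    have "openin X {x \<in> topspace X. \<phi> x \<in> A}"
      using A by (intro openin_continuous_map_preimage[OF homeomorphic_imp_continuous_map[OF homeomorphic_phi]]) simp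
    moreover have "\<phi> -` A \<inter> space \<mu> = {x \<in> topspace X. \<phi> x \<in> A}" by (auto simp: space)
    ultimately show ?thesis unfolding sets by (simp add: sigma_sets.Basic)
  qed
qed

context
  fixes \<mu> assumes \<mu>: "invariant_prob_measure X \<phi> \<mu>"
begin

lemma clopen_sets: "A \<in> clopens \<Longrightarrow> A \<in> sets \<mu>"
  using \<mu> by (auto simp: invariant_prob_measure_def clopens_def intro!: sigma_sets.Basic)

lemma clopen_preimage: "A \<in> clopens \<Longrightarrow> {x \<in> topspace X. iter k x \<in> A} \<in> clopens"
  using iter_image[OF clopen_subset, of A "- k"] clopen_T[of A "- k"] by simp

lemma measure_shift_1:
  assumes A: "A \<in> clopens" shows "measure \<mu> {x \<in> topspace X. iter 1 x \<in> A} = measure \<mu> A"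
proof -
  have space: "space \<mu> = topspace X" and distr: "distr \<mu> \<mu> \<phi> = \<mu>"
    using \<mu> by (auto simp: invariant_prob_measure_def)
  have "{x \<in> topspace X. iter 1 x \<in> A} = \<phi> -` A \<inter> space \<mu>" by (auto simp: space iter_1)
  then show ?thesis
    using measure_distr[OF phi_measurable[OF \<mu>] clopen_sets[OF A]] distr by simp
qed

lemma measure_shift:
  assumes "A \<in> clopens" shows "measure \<mu> {x \<in> topspace X. iter k x \<in> A} = measure \<mu> A"
proof (induction k rule: int_induct[where k=0])
  case base
  have "{x \<in> topspace X. iter 0 x \<in> A} = A" using clopen_subset[OF assms] by (auto simp: iter_0)
  then show ?case by simp
next
  case (step1 i)
  have "{x \<in> topspace X. iter (i + 1) x \<in> A} = {x \<in> topspace X. iter 1 x \<in> {x \<in> topspace X. iter i x \<in> A}}"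
    by (auto simp: iter_add)
  then show ?case using measure_shift_1[OF clopen_preimage[OF assms, of i]] step1 by simp
next
  case (step2 i)
  have "{x \<in> topspace X. iter i x \<in> A} = {x \<in> topspace X. iter 1 x \<in> {x \<in> topspace X. iter (i - 1) x \<in> A}}"
    using iter_add[of "i - 1" 1] by auto
  then show ?case using measure_shift_1[OF clopen_preimage[OF assms, of "i - 1"]] step2 by simp
qed

lemma clopen_level: "g \<in> full \<Longrightarrow> {x \<in> topspace X. p (cocycle g x)} \<in> clopens"
  by (rule loc_const_clopen[OF loc_const_cocycle])

lemma measure_level_shift:
  assumes g: "g \<in> full"
  shows "measure \<mu> {x \<in> topspace X. p (cocycle g (iter k x))} = measure \<mu> {x \<in> topspace X. p (cocycle g x)}"
proof -
  have "{x \<in> topspace X. iter k x \<in> {x \<in> topspace X. p (cocycle g x)}} = {x \<in> topspace X. p (cocycle g (iter k x))}"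
    by auto
  then show ?thesis using measure_shift[OF clopen_level[OF g, of p], of k] by simp
qed

lemma clopen_level_shift: "g \<in> full \<Longrightarrow> {x \<in> topspace X. p (cocycle g (iter k x))} \<in> clopens"
  by (rule loc_const_clopen[OF loc_const_T[OF loc_const_cocycle]])

text \<open>Both the cocycle and the flow are sums of indicator functions; by invariance their integrals
  are the same sums of measures of level sets.\<close>

lemma integral_cocycle:
  assumes g: "g \<in> full" and x0: "x0 \<in> topspace X"
  shows "(\<integral>x. real_of_int (cocycle g x) \<partial>\<mu>) = real_of_int (flow g x0)"
proof -
  interpret prob_space \<mu> using \<mu> by (simp add: invariant_prob_measure_def)
  have space: "space \<mu> = topspace X" using \<mu> by (simp add: invariant_prob_measure_def)
  obtain N where N: "N \<ge> 0" "\<And>x. x \<in> topspace X \<Longrightarrow> \<bar>cocycle g x\<bar> \<le> N" by (rule cocycle_bound[OF g]) blast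
  let ?P = "\<lambda>j. {x \<in> topspace X. j \<le> cocycle g x}" and ?M = "\<lambda>j. {x \<in> topspace X. cocycle g x \<le> - j}"
  let ?A = "\<lambda>j. {x \<in> topspace X. j + cocycle g (iter j x) \<ge> 0}"
    and ?B = "\<lambda>j. {x \<in> topspace X. j + cocycle g (iter j x) < 0}"
  have sets: "?P j \<in> sets \<mu>" "?M j \<in> sets \<mu>" "?A j \<in> sets \<mu>" "?B j \<in> sets \<mu>" for j
    by (rule clopen_sets, rule clopen_level[OF g] clopen_level_shift[OF g])+
  have int: "integrable \<mu> (indicat_real A)" if "A \<in> sets \<mu>" for A
    using that by (simp add: emeasure_eq_measure)
  have ind: "(\<integral>x. indicat_real A x \<partial>\<mu>) = measure \<mu> A" if "A \<in> sets \<mu>" for A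
    using that sets.sets_into_space[OF that] by (simp add: Int_absorb1)
  \<comment> \<open>Writes an integer as the number of positive thresholds it reaches minus the
    number of negative ones, which turns the cocycle into a sum of indicators.\<close>
  have count: "real_of_int v = real (card ({1..N} \<inter> {j. j \<le> v})) - real (card ({1..N} \<inter> {j. v \<le> - j}))"
    if v: "\<bar>v\<bar> \<le> N" for v
  proof -
    have "{1..N} \<inter> {j. j \<le> v} = {1..v}" "{1..N} \<inter> {j. v \<le> - j} = {1..- v}" using v by auto
    then show ?thesis by simp
  qed
  have "(\<integral>x. real_of_int (cocycle g x) \<partial>\<mu>) =
    (\<integral>x. (\<Sum>j\<in>{1..N}. indicat_real (?P j) x) - (\<Sum>j\<in>{1..N}. indicat_real (?M j) x) \<partial>\<mu>)"
  proof (rule Bochner_Integration.integral_cong[OF refl])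
    fix x assume "x \<in> space \<mu>"
    then have x: "x \<in> topspace X" by (simp add: space)
    show "real_of_int (cocycle g x) = (\<Sum>j\<in>{1..N}. indicat_real (?P j) x) - (\<Sum>j\<in>{1..N}. indicat_real (?M j) x)"
      unfolding count[OF N(2)[OF x]] using x by (simp add: indicator_def sum.If_cases)
  qed
  also have "\<dots> = (\<Sum>j\<in>{1..N}. measure \<mu> (?P j)) - (\<Sum>j\<in>{1..N}. measure \<mu> (?M j))"
    using sets int ind by (simp add: Bochner_Integration.integral_diff Bochner_Integration.integral_sum)
  finally have 1: "(\<integral>x. real_of_int (cocycle g x) \<partial>\<mu>) =
    (\<Sum>j\<in>{1..N}. measure \<mu> (?P j)) - (\<Sum>j\<in>{1..N}. measure \<mu> (?M j))" .
  have "real_of_int (flow g x0) = (\<integral>x. real_of_int (flow g x0) \<partial>\<mu>)" by (simp add: prob_space)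
  also have "\<dots> = (\<integral>x. (\<Sum>j\<in>{- N..<0}. indicat_real (?A j) x) - (\<Sum>j\<in>{0..<N}. indicat_real (?B j) x) \<partial>\<mu>)"
  proof (rule Bochner_Integration.integral_cong[OF refl])
    fix x assume "x \<in> space \<mu>"
    then have x: "x \<in> topspace X" by (simp add: space)
    have cnt: "(\<Sum>j\<in>J. indicat_real {x \<in> topspace X. q j x} x) = real (card {j \<in> J. q j x})" if "finite J" for q and J :: "int set"
    proof -
      have "(\<Sum>j\<in>J. indicat_real {x \<in> topspace X. q j x} x) = (\<Sum>j\<in>J. if q j x then 1 else 0)"
        using x by (intro sum.cong) (simp_all add: indicator_def)
      also have "\<dots> = real (card {j \<in> J. q j x})" using that by (simp add: sum.If_cases Int_def)
      finally show ?thesis .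
    qed
    have sums: "(\<Sum>j\<in>{- N..<0}. indicat_real (?A j) x) = real (card {j \<in> {- N..<0}. j + cocycle g (iter j x) \<ge> 0})"
      "(\<Sum>j\<in>{0..<N}. indicat_real (?B j) x) = real (card {j \<in> {0..<N}. j + cocycle g (iter j x) < 0})"
      by (rule cnt[of _ "\<lambda>j x. 0 \<le> j + cocycle g (iter j x)"] cnt[of _ "\<lambda>j x. j + cocycle g (iter j x) < 0"], simp)+
    have fl: "flow g x0 = int (card {j \<in> {- N..<0}. j + cocycle g (iter j x) \<ge> 0})
        - int (card {j \<in> {0..<N}. j + cocycle g (iter j x) < 0})"
      using flow_constant[OF g x0 x] flow_eq[OF g x N(2)] by (rule trans)
    show "real_of_int (flow g x0) = (\<Sum>j\<in>{- N..<0}. indicat_real (?A j) x) - (\<Sum>j\<in>{0..<N}. indicat_real (?B j) x)"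
      unfolding sums fl by simp
  qed
  also have "\<dots> = (\<Sum>j\<in>{- N..<0}. measure \<mu> (?A j)) - (\<Sum>j\<in>{0..<N}. measure \<mu> (?B j))"
    using sets int ind by (simp add: Bochner_Integration.integral_diff Bochner_Integration.integral_sum)
  \<comment> \<open>By invariance the shift by \<open>j\<close> may be dropped, and
    \<open>0 \<le> j + n\<close> is the threshold \<open>- j \<le> n\<close>.\<close>
  also have "(\<Sum>j\<in>{- N..<0}. measure \<mu> (?A j)) = (\<Sum>j\<in>{1..N}. measure \<mu> (?P j))"
  proof (rule sum.reindex_bij_witness[of _ uminus uminus])
    fix j assume "j \<in> {- N..<0}"
    show "measure \<mu> (?P (- j)) = measure \<mu> (?A j)"
    proof -
      have "{x \<in> topspace X. 0 \<le> j + cocycle g x} = ?P (- j)" by auto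
      then show ?thesis using measure_level_shift[OF g, of "\<lambda>n. 0 \<le> j + n" j] by simp
    qed
  qed auto
  \<comment> \<open>The strict inequality \<open>j + n < 0\<close> is
    \<open>n \<le> - (j + 1)\<close>, hence the reindexing by one.\<close>
  also have "(\<Sum>j\<in>{0..<N}. measure \<mu> (?B j)) = (\<Sum>j\<in>{1..N}. measure \<mu> (?M j))"
  proof (rule sum.reindex_bij_witness[of _ "\<lambda>j. j - 1" "\<lambda>j. j + 1"])
    fix j assume "j \<in> {0..<N}"
    have "{x \<in> topspace X. j + cocycle g x < 0} = ?M (j + 1)" by auto
    then show "measure \<mu> (?M (j + 1)) = measure \<mu> (?B j)"
      using measure_level_shift[OF g, of "\<lambda>n. j + n < 0" j] by simp
  qed auto
  finally show ?thesis using 1 by simp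
qed

end

text \<open>The defining condition of the index quantifies over invariant measures; uniqueness of
  the value therefore rests on the existence of one.\<close>

lemma index_map_rst:
  assumes g: "g \<in> full" and x0: "x0 \<in> topspace X" shows "index_map X \<phi> (rst g) = flow g x0"
  unfolding index_map_def
proof (rule the_equality)
  have oc: "orbit_cocycle X \<phi> (rst g) (cocycle g)"
    unfolding orbit_cocycle_def
    using loc_const_cocycle[OF g] loc_const_iff_continuous[of "cocycle g"] full_apply[OF g] by (simp add: iter_def)
  show "\<forall>n \<mu>. orbit_cocycle X \<phi> (rst g) n \<and> invariant_prob_measure X \<phi> \<mu> \<longrightarrow>
    real_of_int (flow g x0) = (\<integral>x. real_of_int (n x) \<partial>\<mu>)"
  proof (intro allI impI, elim conjE)
    fix n \<mu> assume n: "orbit_cocycle X \<phi> (rst g) n" and \<mu>: "invariant_prob_measure X \<phi> \<mu>"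
    have "cocycle g x = n x" if "x \<in> topspace X" for x
      using n that by (intro cocycle_eqI) (simp_all add: orbit_cocycle_def iter_def)
    then have "(\<integral>x. real_of_int (n x) \<partial>\<mu>) = (\<integral>x. real_of_int (cocycle g x) \<partial>\<mu>)"
      using \<mu> by (intro Bochner_Integration.integral_cong) (auto simp: invariant_prob_measure_def)
    then show "real_of_int (flow g x0) = (\<integral>x. real_of_int (n x) \<partial>\<mu>)"
      using integral_cocycle[OF \<mu> g x0] by simp
  qed
  fix k assume k: "\<forall>n \<mu>. orbit_cocycle X \<phi> (rst g) n \<and> invariant_prob_measure X \<phi> \<mu> \<longrightarrow>
    real_of_int k = (\<integral>x. real_of_int (n x) \<partial>\<mu>)"
  obtain \<mu> where \<mu>: "invariant_prob_measure X \<phi> \<mu>" using exists_invariant_prob_measure by blast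
  then have "real_of_int k = real_of_int (flow g x0)" using k oc integral_cocycle[OF \<mu> g x0] by metis
  then show "k = flow g x0" by simp
qed

lemma finitely_generated_topological_full_group_0:
  "finitely_generated_group (topological_full_group_0 X \<phi>) \<longleftrightarrow> (\<exists>F. finite F \<and> F \<subseteq> full_0 \<and> generated F = full_0)"
proof -
  obtain x0 where x0: "x0 \<in> topspace X" using nonempty_X by blast
  have zero: "index_map X \<phi> (rst g) = 0 \<longleftrightarrow> g \<in> full_0" if g: "g \<in> full" for g
  proof -
    have "flow g x0 = 0 \<longleftrightarrow> (\<forall>x\<in>topspace X. flow g x = 0)" using flow_constant[OF g x0] x0 by metis
    then show ?thesis unfolding index_map_rst[OF g x0] full_0_def using g by blast
  qed
  have "full_0 \<subseteq> full" unfolding full_0_def by blast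
  with zero have "kernel (topological_full_group X \<phi>) integer_group (index_map X \<phi>) = rst ` full_0"
    unfolding kernel_def carrier_topological_full_group one_integer_group by blast
  then have eq: "topological_full_group_0 X \<phi> = bij_subgroup full_0"
    by (simp add: topological_full_group_0_def bij_subgroup_def topological_full_group_def)
  show ?thesis
    unfolding eq full_0_eq_swap_group
    by (rule finitely_generated_bij_subgroup[OF swap_group_full swap_group_id swap_group_comp swap_group_inv])
qed


subsection \<open>The group \<open>K\<^sup>0\<close> modulo two\<close>

abbreviation int_functions :: "('a \<Rightarrow> int) monoid" where
  "int_functions \<equiv> continuous_int_functions X"

abbreviation K0 :: "('a \<Rightarrow> int) set monoid" where
  "K0 \<equiv> K0_group X \<phi>"

definition cob :: "('a \<Rightarrow> int) \<Rightarrow> 'a \<Rightarrow> int" where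
  "cob h = (\<lambda>x\<in>topspace X. h x - h (iter (- 1) x))"

definition cls :: "('a \<Rightarrow> int) \<Rightarrow> ('a \<Rightarrow> int) set" where
  "cls f = coboundaries X \<phi> #>\<^bsub>int_functions\<^esub> f"

text \<open>Reduction modulo two of an integer-valued function, recorded as a clopen set.\<close>

definition odd_set :: "('a \<Rightarrow> int) \<Rightarrow> 'a set" where
  "odd_set f = {x \<in> topspace X. odd (f x)}"

definition zero_function :: "'a \<Rightarrow> int" where
  "zero_function = (\<lambda>x\<in>topspace X. 0)"

definition ind :: "'a set \<Rightarrow> 'a \<Rightarrow> int" where
  "ind U = (\<lambda>x\<in>topspace X. if x \<in> U then 1 else 0)"

lemma mem_int_functions: "f \<in> carrier int_functions \<longleftrightarrow> f \<in> extensional (topspace X) \<and> loc_const f"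
  by (simp add: continuous_int_functions_def loc_const_iff_continuous)

lemma mult_int_functions: "f \<otimes>\<^bsub>int_functions\<^esub> g = (\<lambda>x\<in>topspace X. f x + g x)"
  and one_int_functions: "\<one>\<^bsub>int_functions\<^esub> = (\<lambda>x\<in>topspace X. 0)"
  by (simp_all add: continuous_int_functions_def)

lemma restrict_int_functions: "loc_const f \<Longrightarrow> (\<lambda>x\<in>topspace X. f x) \<in> carrier int_functions"
  unfolding mem_int_functions using loc_const_cong[of "\<lambda>x\<in>topspace X. f x" f] by simp

lemma zero_function_closed: "zero_function \<in> carrier int_functions"
  unfolding zero_function_def by (rule restrict_int_functions[OF loc_const_const])

lemma int_functions_ext:
  "f \<in> carrier int_functions \<Longrightarrow> g \<in> carrier int_functions \<Longrightarrow> (\<And>x. x \<in> topspace X \<Longrightarrow> f x = g x) \<Longrightarrow> f = g"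
  unfolding mem_int_functions by (auto intro: extensionalityI)

lemma mult_closed: "f \<in> carrier int_functions \<Longrightarrow> g \<in> carrier int_functions \<Longrightarrow> (\<lambda>x\<in>topspace X. f x + g x) \<in> carrier int_functions"
  by (rule restrict_int_functions, rule loc_const_apply2) (simp_all add: mem_int_functions)

lemma comm_group_int_functions: "comm_group int_functions"
proof (rule comm_groupI)
  fix f g h assume "f \<in> carrier int_functions" "g \<in> carrier int_functions" "h \<in> carrier int_functions"
  show "f \<otimes>\<^bsub>int_functions\<^esub> g \<otimes>\<^bsub>int_functions\<^esub> h = f \<otimes>\<^bsub>int_functions\<^esub> (g \<otimes>\<^bsub>int_functions\<^esub> h)"
    unfolding mult_int_functions by (rule restrict_ext) simp
next
  fix f g assume f: "f \<in> carrier int_functions" and g: "g \<in> carrier int_functions"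
  show "f \<otimes>\<^bsub>int_functions\<^esub> g \<in> carrier int_functions" unfolding mult_int_functions by (rule mult_closed[OF f g])
  show "f \<otimes>\<^bsub>int_functions\<^esub> g = g \<otimes>\<^bsub>int_functions\<^esub> f"
    unfolding mult_int_functions by (simp add: add.commute)
next
  show "\<one>\<^bsub>int_functions\<^esub> \<in> carrier int_functions"
    unfolding one_int_functions by (rule restrict_int_functions[OF loc_const_const])
next
  fix f assume f: "f \<in> carrier int_functions"
  show "\<one>\<^bsub>int_functions\<^esub> \<otimes>\<^bsub>int_functions\<^esub> f = f"
    unfolding one_int_functions mult_int_functions
    by (rule int_functions_ext[OF mult_closed[OF restrict_int_functions[OF loc_const_const] f] f]) simp
  have "(\<lambda>x\<in>topspace X. - f x) \<in> carrier int_functions"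
    using f by (intro restrict_int_functions loc_const_apply[where F=uminus]) (simp add: mem_int_functions)
  moreover have "(\<lambda>x\<in>topspace X. - f x) \<otimes>\<^bsub>int_functions\<^esub> f = \<one>\<^bsub>int_functions\<^esub>"
    unfolding one_int_functions mult_int_functions by (rule restrict_ext) simp
  ultimately show "\<exists>g\<in>carrier int_functions. g \<otimes>\<^bsub>int_functions\<^esub> f = \<one>\<^bsub>int_functions\<^esub>" by blast
qed

lemma inv_into_phi: "x \<in> topspace X \<Longrightarrow> inv_into (topspace X) \<phi> x = iter (- 1) x"
proof (rule inv_into_f_eq)
  show "inj_on \<phi> (topspace X)" by (rule homeomorphic_imp_injective_map[OF homeomorphic_phi])
  show "iter (- 1) x \<in> topspace X" if "x \<in> topspace X" using that by simp
  show "\<phi> (iter (- 1) x) = x" if "x \<in> topspace X" using iter_1[of "iter (- 1) x"] that by simp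
qed

lemma coboundaries_eq: "coboundaries X \<phi> = cob ` carrier int_functions"
  unfolding coboundaries_def cob_def by (intro image_cong refl restrict_ext) (simp add: inv_into_phi)

lemma cob_closed: "h \<in> carrier int_functions \<Longrightarrow> cob h \<in> carrier int_functions"
  unfolding cob_def
  by (intro restrict_int_functions loc_const_apply2[where F="(-)"] loc_const_T) (simp_all add: mem_int_functions)

lemma cob_add: "h \<in> carrier int_functions \<Longrightarrow> k \<in> carrier int_functions \<Longrightarrow>
  (\<lambda>x\<in>topspace X. cob h x + cob k x) = cob (\<lambda>x\<in>topspace X. h x + k x)"
  unfolding cob_def by (intro restrict_ext) simp

lemma cob_uminus: "(\<lambda>x\<in>topspace X. - cob h x) = cob (\<lambda>x\<in>topspace X. - h x)"
  unfolding cob_def by (intro restrict_ext) simp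

lemma uminus_closed: "f \<in> carrier int_functions \<Longrightarrow> (\<lambda>x\<in>topspace X. - f x) \<in> carrier int_functions"
  by (intro restrict_int_functions loc_const_apply[where F=uminus]) (simp add: mem_int_functions)

lemma inv_int_functions: "f \<in> carrier int_functions \<Longrightarrow> m_inv int_functions f = (\<lambda>x\<in>topspace X. - f x)"
proof (rule group.inv_equality[OF comm_group.axioms(2)[OF comm_group_int_functions]])
  show "(\<lambda>x\<in>topspace X. - f x) \<otimes>\<^bsub>int_functions\<^esub> f = \<one>\<^bsub>int_functions\<^esub>"
    unfolding one_int_functions mult_int_functions by (rule restrict_ext) simp
qed (simp_all only: uminus_closed)

lemma subgroup_coboundaries: "subgroup (coboundaries X \<phi>) int_functions"
proof (rule group.subgroupI[OF comm_group.axioms(2)[OF comm_group_int_functions]])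
  show "coboundaries X \<phi> \<subseteq> carrier int_functions" unfolding coboundaries_eq using cob_closed by blast
  show "coboundaries X \<phi> \<noteq> {}"
    unfolding coboundaries_eq using restrict_int_functions[OF loc_const_const] by blast
  fix f assume "f \<in> coboundaries X \<phi>"
  then obtain h where h: "h \<in> carrier int_functions" "f = cob h" unfolding coboundaries_eq by blast
  show "m_inv int_functions f \<in> coboundaries X \<phi>"
    unfolding h(2) inv_int_functions[OF cob_closed[OF h(1)]] cob_uminus coboundaries_eq
    by (rule imageI[OF uminus_closed[OF h(1)]])
  fix g assume "g \<in> coboundaries X \<phi>"
  then obtain k where k: "k \<in> carrier int_functions" "g = cob k" unfolding coboundaries_eq by blast
  show "f \<otimes>\<^bsub>int_functions\<^esub> g \<in> coboundaries X \<phi>"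
    unfolding h(2) k(2) mult_int_functions cob_add[OF h(1) k(1)] coboundaries_eq
    by (rule imageI[OF mult_closed[OF h(1) k(1)]])
qed

lemma normal_coboundaries: "normal (coboundaries X \<phi>) int_functions"
  using comm_group.normal_iff_subgroup[OF comm_group_int_functions] subgroup_coboundaries by blast

lemma carrier_K0: "carrier K0 = cls ` carrier int_functions"
  unfolding K0_group_def FactGroup_def RCOSETS_def cls_def by auto

lemma mult_K0:
  "f \<in> carrier int_functions \<Longrightarrow> g \<in> carrier int_functions \<Longrightarrow>
   cls f \<otimes>\<^bsub>K0\<^esub> cls g = cls (\<lambda>x\<in>topspace X. f x + g x)"
  unfolding K0_group_def FactGroup_def cls_def
  using normal.rcos_sum[OF normal_coboundaries, of f g] by (simp add: mult_int_functions)

lemma mem_cls: "g \<in> cls f \<longleftrightarrow> (\<exists>h\<in>carrier int_functions. g = (\<lambda>x\<in>topspace X. cob h x + f x))"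
  unfolding cls_def r_coset_def coboundaries_eq mult_int_functions by auto

lemma cls_self: "f \<in> carrier int_functions \<Longrightarrow> f \<in> cls f"
proof -
  assume f: "f \<in> carrier int_functions"
  have "f = (\<lambda>x\<in>topspace X. cob zero_function x + f x)"
    by (rule int_functions_ext[OF f mult_closed[OF cob_closed[OF zero_function_closed] f]])
      (simp add: cob_def zero_function_def)
  then show ?thesis unfolding mem_cls using zero_function_closed by blast
qed

lemma cls_eq: "f \<in> carrier int_functions \<Longrightarrow> g \<in> cls f \<Longrightarrow> cls g = cls f"
  unfolding cls_def
  using group.repr_independence[OF comm_group.axioms(2)[OF comm_group_int_functions] _ _ subgroup_coboundaries] by metis

lemma clopen_odd_set: "f \<in> carrier int_functions \<Longrightarrow> odd_set f \<in> clopens"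
  unfolding odd_set_def by (rule loc_const_clopen) (simp add: mem_int_functions)

lemma ind_closed: "U \<in> clopens \<Longrightarrow> ind U \<in> carrier int_functions"
  unfolding ind_def by (intro restrict_int_functions loc_const_if loc_const_mem loc_const_const)

lemma odd_set_ind: "U \<in> clopens \<Longrightarrow> odd_set (ind U) = U"
  using clopen_subset[of U] by (auto simp: odd_set_def ind_def)

text \<open>Modulo two a difference is a sum, so coboundaries of functions become the sets that
  define \<open>cohomologous\<close>.\<close>

lemma odd_set_cob: "odd_set (cob h) = odd_set h \<triangle> iter 1 ` odd_set h"
  by (auto simp: odd_set_def cob_def mem_T_image)

lemma odd_set_cls:
  assumes f: "f \<in> carrier int_functions" and g: "g \<in> cls f" shows "cohomologous (odd_set g) (odd_set f)"
proof -
  obtain h where h: "h \<in> carrier int_functions" "g = (\<lambda>x\<in>topspace X. cob h x + f x)" using g unfolding mem_cls by blast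
  have "odd_set g \<triangle> odd_set f = odd_set (cob h)" unfolding h(2) by (auto simp: odd_set_def)
  then show ?thesis unfolding cohomologous_def odd_set_cob using clopen_odd_set[OF h(1)] by blast
qed

section \<open>The tensor product with Z/2\<close>

abbreviation pairs :: "(('a \<Rightarrow> int) set \<times> int) set" where
  "pairs \<equiv> carrier K0 \<times> carrier (integer_mod_group 2)"

abbreviation relations :: "(('a \<Rightarrow> int) set \<times> int \<Rightarrow>\<^sub>0 int) set" where
  "relations \<equiv> generate (free_Abelian_group pairs) (tensor_relations K0 (integer_mod_group 2))"

lemma carrier_Z2: "carrier (integer_mod_group 2) = {0, 1}"
  by (auto simp: carrier_integer_mod_group)

lemma K0_mult_closed: "a \<in> carrier K0 \<Longrightarrow> b \<in> carrier K0 \<Longrightarrow> a \<otimes>\<^bsub>K0\<^esub> b \<in> carrier K0"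
  unfolding carrier_K0 using mult_K0 mult_closed by auto

lemma tensor_relations_subset: "tensor_relations K0 (integer_mod_group 2) \<subseteq> carrier (free_Abelian_group pairs)"
proof -
  have d: "c - d - e \<in> carrier (free_Abelian_group pairs)"
    if "c \<in> carrier (free_Abelian_group pairs)" "d \<in> carrier (free_Abelian_group pairs)"
      "e \<in> carrier (free_Abelian_group pairs)" for c d e
  proof -
    have "Poly_Mapping.keys (c - d - e) \<subseteq> Poly_Mapping.keys c \<union> Poly_Mapping.keys d \<union> Poly_Mapping.keys e"
      using keys_diff[of "c - d" e] keys_diff[of c d] by blast
    then show ?thesis using that unfolding carrier_free_Abelian_group_iff by blast
  qed
  show ?thesis
    unfolding tensor_relations_def
    by (intro Un_least subsetI; clarify; intro d)
      (auto simp: K0_mult_closed carrier_Z2 simp del: carrier_free_Abelian_group_iff)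
qed

lemma subgroup_relations: "subgroup relations (free_Abelian_group pairs)"
  by (rule group.generate_is_subgroup[OF group_free_Abelian_group tensor_relations_subset])

lemma relations_0: "0 \<in> relations"
  using subgroup.one_closed[OF subgroup_relations] by simp

lemma relations_add: "c \<in> relations \<Longrightarrow> d \<in> relations \<Longrightarrow> c + d \<in> relations"
  using subgroup.m_closed[OF subgroup_relations, of c d] by simp

lemma relations_keys: "c \<in> relations \<Longrightarrow> Poly_Mapping.keys c \<subseteq> pairs"
  using subgroup.mem_carrier[OF subgroup_relations, of c] by simp

lemma relations_uminus: "c \<in> relations \<Longrightarrow> - c \<in> relations"
  using subgroup.m_inv_closed[OF subgroup_relations, of c] inv_free_Abelian_group[OF relations_keys] by simp

lemma relations_diff: "c \<in> relations \<Longrightarrow> d \<in> relations \<Longrightarrow> c - d \<in> relations"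
  using relations_add[OF _ relations_uminus, of c d] by simp

lemma relations_left: "a \<in> carrier K0 \<Longrightarrow> a' \<in> carrier K0 \<Longrightarrow>
  frag_of (a \<otimes>\<^bsub>K0\<^esub> a', 1) - frag_of (a, 1) - frag_of (a', 1) \<in> relations"
  by (rule generate.incl) (unfold tensor_relations_def carrier_Z2, blast)

lemma relations_right: "a \<in> carrier K0 \<Longrightarrow> b \<in> {0, 1} \<Longrightarrow> b' \<in> {0, 1} \<Longrightarrow>
  frag_of (a, (b + b') mod 2) - frag_of (a, b) - frag_of (a, b') \<in> relations"
  by (rule generate.incl)
    (unfold tensor_relations_def carrier_Z2 mult_integer_mod_group of_nat_numeral, intro UnI2 CollectI, blast)

lemma relations_zero: "a \<in> carrier K0 \<Longrightarrow> frag_of (a, 0) \<in> relations"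
  using relations_uminus[OF relations_right[of a 0 0]] by simp

text \<open>Twice the tensor of \<open>a\<close> with 1 is the tensor of \<open>a\<close> with 1 + 1
  = 0, and tensors with 0 vanish.\<close>

lemma relations_double: "a \<in> carrier K0 \<Longrightarrow> frag_of (a, 1) + frag_of (a, 1) \<in> relations"
proof -
  assume a: "a \<in> carrier K0"
  have "frag_of (a, 0) - (frag_of (a, 0) - frag_of (a, 1) - frag_of (a, 1)) \<in> relations"
    using relations_diff[OF relations_zero[OF a] relations_right[OF a, of 1 1]] by simp
  then show ?thesis by (simp add: algebra_simps)
qed

lemma carrier_tensor:
  "carrier (tensor_product K0 (integer_mod_group 2)) =
   (\<lambda>c. relations #>\<^bsub>free_Abelian_group pairs\<^esub> c) ` carrier (free_Abelian_group pairs)"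
  unfolding tensor_product_def Let_def FactGroup_def RCOSETS_def by auto

lemma relations_coset_eq:
  assumes "Poly_Mapping.keys c \<subseteq> pairs" "Poly_Mapping.keys d \<subseteq> pairs"
  shows "relations #>\<^bsub>free_Abelian_group pairs\<^esub> c = relations #>\<^bsub>free_Abelian_group pairs\<^esub> d \<longleftrightarrow> c - d \<in> relations"
proof
  assume "relations #>\<^bsub>free_Abelian_group pairs\<^esub> c = relations #>\<^bsub>free_Abelian_group pairs\<^esub> d"
  moreover have "c \<in> relations #>\<^bsub>free_Abelian_group pairs\<^esub> c"
    unfolding r_coset_def using relations_0 by (auto intro!: bexI[of _ 0])
  ultimately have "c \<in> relations #>\<^bsub>free_Abelian_group pairs\<^esub> d" by simp
  then show "c - d \<in> relations" unfolding r_coset_def by auto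
next
  assume "c - d \<in> relations"
  then have "c \<in> relations #>\<^bsub>free_Abelian_group pairs\<^esub> d"
    unfolding r_coset_def by (auto intro!: bexI[of _ "c - d"])
  then show "relations #>\<^bsub>free_Abelian_group pairs\<^esub> c = relations #>\<^bsub>free_Abelian_group pairs\<^esub> d"
    using group.repr_independence[OF group_free_Abelian_group _ _ subgroup_relations, of c d] assms(2) by simp
qed

lemma cls_zero_function: "cls zero_function \<in> carrier K0"
  "cls zero_function \<otimes>\<^bsub>K0\<^esub> cls zero_function = cls zero_function"
proof -
  show "cls zero_function \<in> carrier K0" unfolding carrier_K0 by (rule imageI[OF zero_function_closed])
  have "(\<lambda>x\<in>topspace X. zero_function x + zero_function x) = zero_function"
    unfolding zero_function_def by (rule restrict_ext) simp
  then show "cls zero_function \<otimes>\<^bsub>K0\<^esub> cls zero_function = cls zero_function"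
    unfolding mult_K0[OF zero_function_closed zero_function_closed] by simp
qed

lemma relations_zero_function: "frag_of (cls zero_function, 1) \<in> relations"
  using relations_uminus[OF relations_left[OF cls_zero_function(1) cls_zero_function(1)]]
  by (simp add: cls_zero_function(2))

text \<open>Every formal combination collapses to one generator with second entry 1. Differences are
  absorbed like sums, because doubles are relations.\<close>

lemma tensor_element:
  assumes "Poly_Mapping.keys c \<subseteq> pairs"
  shows "\<exists>f\<in>carrier int_functions. c - frag_of (cls f, 1) \<in> relations"
  using assms
proof (induction rule: frag_induction)
  case zero
  show ?case using relations_uminus[OF relations_zero_function] zero_function_closed
    by (intro bexI[of _ zero_function]) simp_all
next
  case (one p)
  then obtain a b where p: "p = (a, b)" "a \<in> carrier K0" "b \<in> {0, 1}" unfolding carrier_Z2 by blast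
  obtain f where f: "f \<in> carrier int_functions" "a = cls f" using p(2) unfolding carrier_K0 by blast
  show ?case
  proof (cases "b = 0")
    case True
    have "frag_of (a, 0) - frag_of (cls zero_function, 1) \<in> relations"
      by (rule relations_diff[OF relations_zero[OF p(2)] relations_zero_function])
    then show ?thesis using zero_function_closed True p(1) by blast
  next
    case False
    then have "p = (cls f, 1)" using p f by simp
    then have "frag_of p - frag_of (cls f, 1) \<in> relations" using relations_0 by simp
    then show ?thesis using f(1) by blast
  qed
next
  case (diff c d)
  then obtain f g where f: "f \<in> carrier int_functions" "c - frag_of (cls f, 1) \<in> relations"
    and g: "g \<in> carrier int_functions" "d - frag_of (cls g, 1) \<in> relations" by blast
  let ?s = "\<lambda>x\<in>topspace X. f x + g x"
  have fK: "cls f \<in> carrier K0" and gK: "cls g \<in> carrier K0" using f(1) g(1) unfolding carrier_K0 by blast+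
  have "frag_of (cls ?s, 1) - frag_of (cls f, 1) - frag_of (cls g, 1) \<in> relations"
    using relations_left[OF fK gK] unfolding mult_K0[OF f(1) g(1)] .
  from relations_diff[OF relations_diff[OF relations_diff[OF f(2) g(2)] this] relations_double[OF gK]]
  have "c - d - frag_of (cls ?s, 1) \<in> relations" by (simp add: algebra_simps)
  then show ?case using mult_closed[OF f(1) g(1)] by blast
qed

text \<open>An integer-valued function with odd set cohomologous to \<open>V\<close> is the
  indicator of \<open>V\<close> plus a coboundary plus twice a function; the last two vanish in the
  tensor product.\<close>

lemma tensor_cohomologous:
  assumes f: "f \<in> carrier int_functions" and V: "V \<in> clopens" and coh: "cohomologous (odd_set f) V"
  shows "frag_of (cls f, 1) - frag_of (cls (ind V), 1) \<in> relations"
proof -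
  obtain W where W: "W \<in> clopens" "odd_set f \<triangle> V = W \<triangle> iter 1 ` W" using coh by (auto simp: cohomologous_def)
  \<comment> \<open>Half of what remains after the indicator and the coboundary are subtracted; that
    remainder is even at every point of the space.\<close>
  define k where "k = (\<lambda>x\<in>topspace X. (f x - ind V x - cob (ind W) x) div 2)"
  have iV: "ind V \<in> carrier int_functions" and iW: "ind W \<in> carrier int_functions" using V W by (auto intro: ind_closed)
  have cW: "cob (ind W) \<in> carrier int_functions" by (rule cob_closed[OF iW])
  have "loc_const (\<lambda>x. f x - ind V x - cob (ind W) x)"
    using f iV cW unfolding mem_int_functions by (intro loc_const_apply2[where F="(-)"]) auto
  then have k: "k \<in> carrier int_functions"
    unfolding k_def by (intro restrict_int_functions loc_const_apply[where F="\<lambda>n. n div 2"])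
  have even: "even (f x - ind V x - cob (ind W) x)" if x: "x \<in> topspace X" for x
  proof -
    have "odd (f x) \<longleftrightarrow> x \<in> odd_set f" using x by (simp add: odd_set_def)
    moreover have "odd (ind V x) \<longleftrightarrow> x \<in> V" using x by (simp add: ind_def)
    moreover have "odd (cob (ind W) x) \<longleftrightarrow> x \<in> W \<triangle> iter 1 ` W"
    proof -
      have "odd_set (cob (ind W)) = W \<triangle> iter 1 ` W" by (simp only: odd_set_cob odd_set_ind[OF W(1)])
      then show ?thesis using x unfolding odd_set_def by blast
    qed
    ultimately show ?thesis using W(2) by (auto simp: set_eq_iff)
  qed
  have eq: "f x = cob (ind W) x + (ind V x + (k x + k x))" if x: "x \<in> topspace X" for x
    using even[OF x] x by (simp add: k_def)
  define kk where "kk = (\<lambda>x\<in>topspace X. k x + k x)"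
  have kk: "kk \<in> carrier int_functions" unfolding kk_def by (rule mult_closed[OF k k])
  have sum: "(\<lambda>x\<in>topspace X. ind V x + kk x) \<in> carrier int_functions" by (rule mult_closed[OF iV kk])
  have "f = (\<lambda>x\<in>topspace X. cob (ind W) x + (\<lambda>x\<in>topspace X. ind V x + kk x) x)"
    by (rule int_functions_ext[OF f mult_closed[OF cW sum]]) (simp add: eq kk_def)
  then have "f \<in> cls (\<lambda>x\<in>topspace X. ind V x + kk x)" unfolding mem_cls using iW by blast
  then have "cls f = cls (\<lambda>x\<in>topspace X. ind V x + kk x)" by (rule cls_eq[OF sum])
  then have cf: "cls f = cls (ind V) \<otimes>\<^bsub>K0\<^esub> (cls k \<otimes>\<^bsub>K0\<^esub> cls k)"
    unfolding mult_K0[OF k k] kk_def[symmetric] mult_K0[OF iV kk] .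
  have VK: "cls (ind V) \<in> carrier K0" and kK: "cls k \<in> carrier K0" using iV k unfolding carrier_K0 by blast+
  from relations_add[OF relations_add[OF relations_left[OF VK K0_mult_closed[OF kK kK]] relations_left[OF kK kK]]
      relations_double[OF kK]]
  show ?thesis unfolding cf by (simp add: algebra_simps)
qed

text \<open>An arbitrary choice, which need not be additive. Another choice changes the odd set only
  by a coboundary.\<close>

definition rep :: "('a \<Rightarrow> int) set \<Rightarrow> 'a \<Rightarrow> int" where
  "rep a = (SOME f. f \<in> a)"

lemma rep_cls: "f \<in> carrier int_functions \<Longrightarrow> rep (cls f) \<in> cls f"
  unfolding rep_def by (rule someI[of "\<lambda>g. g \<in> cls f", OF cls_self])

text \<open>The value of the bilinear map \<open>(a, b) \<mapsto> b * rep a x\<close> extended to a formal combination of pairs.\<close>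

definition pair_value :: "(('a \<Rightarrow> int) set \<times> int \<Rightarrow>\<^sub>0 int) \<Rightarrow> 'a \<Rightarrow> int" where
  "pair_value c x = poly_mapping.lookup (frag_extend (\<lambda>(a, b). frag_cmul (b * rep a x) (frag_of ())) c) ()"

lemma pair_value_add: "pair_value (c + d) x = pair_value c x + pair_value d x"
  and pair_value_diff: "pair_value (c - d) x = pair_value c x - pair_value d x"
  and pair_value_uminus: "pair_value (- c) x = - pair_value c x"
  and pair_value_0: "pair_value 0 x = 0"
  by (simp_all add: pair_value_def frag_extend_add frag_extend_diff frag_extend_minus lookup_add lookup_minus)

lemma pair_value_of: "pair_value (frag_of (a, b)) x = b * rep a x"
  by (simp add: pair_value_def lookup_frag_of)

text \<open>\<open>pair_value\<close> need not vanish on relations, because \<open>rep\<close> need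
  not be additive and 1 + 1 is not 0 in the integers. Its odd set does so up to coboundaries, which
  separates classes in the tensor product.\<close>

lemma odd_set_tensor_relation:
  assumes "c \<in> tensor_relations K0 (integer_mod_group 2)" shows "cohomologous (odd_set (pair_value c)) {}"
proof -
  show ?thesis
  proof (cases "\<exists>a a' b. c = frag_of (a \<otimes>\<^bsub>K0\<^esub> a', b) - frag_of (a, b) - frag_of (a', b) \<and>
      a \<in> carrier K0 \<and> a' \<in> carrier K0 \<and> b \<in> carrier (integer_mod_group 2)")
    case True
    then obtain a a' b where c: "c = frag_of (a \<otimes>\<^bsub>K0\<^esub> a', b) - frag_of (a, b) - frag_of (a', b)"
      and a: "a \<in> carrier K0" "a' \<in> carrier K0" and b: "b \<in> {0, 1}" unfolding carrier_Z2 by blast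
    obtain f f' where f: "f \<in> carrier int_functions" "a = cls f" and f': "f' \<in> carrier int_functions" "a' = cls f'"
      using a unfolding carrier_K0 by blast
    let ?s = "\<lambda>x\<in>topspace X. f x + f' x"
    have s: "?s \<in> carrier int_functions" by (rule mult_closed[OF f(1) f'(1)])
    have aa: "a \<otimes>\<^bsub>K0\<^esub> a' = cls ?s" unfolding f(2) f'(2) by (rule mult_K0[OF f(1) f'(1)])
    have val: "pair_value c x = b * (rep (cls ?s) x - rep (cls f) x - rep (cls f') x)" for x
      unfolding c aa unfolding f(2) f'(2) pair_value_diff pair_value_of by (simp add: algebra_simps)
    show ?thesis
    proof (cases "b = 0")
      case True
      then have "odd_set (pair_value c) = {}" by (simp add: odd_set_def val)
      then show ?thesis by (simp add: cohomologous_refl)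
    next
      case False
      then have "b = 1" using b by simp
      then have "odd_set (pair_value c) = (odd_set (rep (cls ?s)) \<triangle> odd_set (rep (cls f))) \<triangle> odd_set (rep (cls f'))"
        by (auto simp: odd_set_def val)
      moreover have "cohomologous \<dots> ((odd_set ?s \<triangle> odd_set f) \<triangle> odd_set f')"
        by (intro cohomologous_sym_diff odd_set_cls rep_cls s f(1) f'(1))
      moreover have "(odd_set ?s \<triangle> odd_set f) \<triangle> odd_set f' = {}" by (auto simp: odd_set_def)
      ultimately show ?thesis by simp
    qed
  next
    case False
    then obtain a b b' where c: "c = frag_of (a, b \<otimes>\<^bsub>integer_mod_group 2\<^esub> b') - frag_of (a, b) - frag_of (a, b')"
      using assms unfolding tensor_relations_def by blast
    have "pair_value c x = ((b + b') mod 2 - b - b') * rep a x" for x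
      unfolding c pair_value_diff pair_value_of by (simp add: algebra_simps)
    moreover have "even ((b + b') mod 2 - b - b')" by presburger
    ultimately have "odd_set (pair_value c) = {}" by (simp add: odd_set_def)
    then show ?thesis by (simp add: cohomologous_refl)
  qed
qed

lemma odd_set_relations:
  assumes "c \<in> relations" shows "cohomologous (odd_set (pair_value c)) {}"
  using assms
proof induction
  case one
  have "odd_set (pair_value 0) = {}" by (simp add: odd_set_def pair_value_0)
  then show ?case by (simp add: cohomologous_refl)
next
  case (incl c)
  then show ?case by (rule odd_set_tensor_relation)
next
  case (inv c)
  have "c \<in> carrier (free_Abelian_group pairs)" using inv tensor_relations_subset by blast
  then have eq: "m_inv (free_Abelian_group pairs) c = - c" by (simp add: inv_free_Abelian_group)
  have "odd_set (pair_value (- c)) = odd_set (pair_value c)" by (simp add: odd_set_def pair_value_uminus)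
  then show ?case unfolding eq using odd_set_tensor_relation[OF inv] by simp
next
  case (eng c d)
  have "odd_set (pair_value (c + d)) = odd_set (pair_value c) \<triangle> odd_set (pair_value d)"
    by (auto simp: odd_set_def pair_value_add)
  then show ?case using cohomologous_sym_diff[OF eng.IH] by simp
qed

text \<open>Tensoring the class of the indicator of a clopen set with 1 reaches every element of the
  tensor product and identifies only cohomologous sets. The first fact gives one direction, the
  second the other.\<close>

theorem finite_tensor_iff_finite_classes:
  "finite (carrier (tensor_product K0 (integer_mod_group 2))) \<longleftrightarrow> finite_classes"
proof
  let ?t = "\<lambda>U. relations #>\<^bsub>free_Abelian_group pairs\<^esub> frag_of (cls (ind U), 1)"
  have key: "Poly_Mapping.keys (frag_of (cls f, 1 :: int)) \<subseteq> pairs" if "f \<in> carrier int_functions" for f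
    using that by (simp add: carrier_Z2 carrier_K0)
  {
    assume fin: "finite (carrier (tensor_product K0 (integer_mod_group 2)))"
    have "?t ` clopens \<subseteq> carrier (tensor_product K0 (integer_mod_group 2))"
      unfolding carrier_tensor
    proof (rule image_subsetI)
      fix A assume "A \<in> clopens"
      then have "frag_of (cls (ind A), 1) \<in> carrier (free_Abelian_group pairs)"
        unfolding carrier_free_Abelian_group_iff by (rule key[OF ind_closed])
      then show "?t A \<in> (\<lambda>c. relations #>\<^bsub>free_Abelian_group pairs\<^esub> c) ` carrier (free_Abelian_group pairs)"
        by (rule imageI)
    qed
    then have "finite (?t ` clopens)" using fin finite_subset by blast
    from finite_subset_image[OF this order_refl]
    obtain \<U> where U: "\<U> \<subseteq> clopens" "finite \<U>" "?t ` clopens = ?t ` \<U>" by (elim exE conjE)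
    show finite_classes
      unfolding finite_classes_def
    proof (intro exI[of _ \<U>] conjI ballI U(1,2))
      fix A assume A: "A \<in> clopens"
      have "?t A \<in> ?t ` \<U>" unfolding U(3)[symmetric] by (rule imageI[OF A])
      then obtain V where V: "V \<in> \<U>" "?t A = ?t V" by (elim imageE)
      have VC: "V \<in> clopens" using V(1) U(1) by blast
      have "frag_of (cls (ind A), 1 :: int) - frag_of (cls (ind V), 1) \<in> relations"
        using V(2) unfolding relations_coset_eq[OF key[OF ind_closed[OF A]] key[OF ind_closed[OF VC]]] .
      moreover have "odd_set (pair_value (frag_of (cls (ind A), 1 :: int) - frag_of (cls (ind V), 1))) =
          odd_set (rep (cls (ind A))) \<triangle> odd_set (rep (cls (ind V)))"
        by (auto simp: odd_set_def pair_value_diff pair_value_of)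
      ultimately have 1: "cohomologous (odd_set (rep (cls (ind A))) \<triangle> odd_set (rep (cls (ind V)))) {}"
        using odd_set_relations by metis
      have "cohomologous (odd_set (rep (cls (ind A))) \<triangle> odd_set (rep (cls (ind V)))) (A \<triangle> V)"
        using cohomologous_sym_diff[OF odd_set_cls[OF ind_closed[OF A] rep_cls[OF ind_closed[OF A]]]
            odd_set_cls[OF ind_closed[OF VC] rep_cls[OF ind_closed[OF VC]]]]
        by (simp only: odd_set_ind[OF A] odd_set_ind[OF VC])
      from cohomologous_trans[OF cohomologous_sym[OF this] 1] have "cohomologous (A \<triangle> V) {}" .
      then have "cohomologous A V" by (simp add: cohomologous_def)
      then show "\<exists>V\<in>\<U>. cohomologous A V" using V(1) by blast
    qed
  next
    assume finite_classes
    then obtain \<U> where U: "\<U> \<subseteq> clopens" "finite \<U>" "\<And>A. A \<in> clopens \<Longrightarrow> \<exists>V\<in>\<U>. cohomologous A V"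
      by (auto simp: finite_classes_def)
    have "carrier (tensor_product K0 (integer_mod_group 2)) \<subseteq> ?t ` \<U>"
      unfolding carrier_tensor
    proof
      fix y assume "y \<in> (\<lambda>c. relations #>\<^bsub>free_Abelian_group pairs\<^esub> c) ` carrier (free_Abelian_group pairs)"
      then obtain c where c: "Poly_Mapping.keys c \<subseteq> pairs" "y = relations #>\<^bsub>free_Abelian_group pairs\<^esub> c"
        unfolding image_iff Bex_def carrier_free_Abelian_group_iff by (elim exE conjE)
      obtain f where f: "f \<in> carrier int_functions" "c - frag_of (cls f, 1) \<in> relations" using tensor_element[OF c(1)] by blast
      obtain V where V: "V \<in> \<U>" "cohomologous (odd_set f) V" using U(3)[OF clopen_odd_set[OF f(1)]] by blast
      have VC: "V \<in> clopens" using V(1) U(1) by blast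
      have "c - frag_of (cls (ind V), 1) \<in> relations"
        using relations_add[OF f(2) tensor_cohomologous[OF f(1) VC V(2)]] by simp
      then have "y = ?t V" unfolding c(2) relations_coset_eq[OF c(1) key[OF ind_closed[OF VC]]] .
      then show "y \<in> ?t ` \<U>" by (rule image_eqI[OF _ V(1)])
    qed
    then show "finite (carrier (tensor_product K0 (integer_mod_group 2)))"
      using U(2) finite_subset by blast
  }
qed


subsection \<open>Subshifts and separating labellings\<close>

text \<open>The zeroth coordinate is the labelling: along an orbit it reads off all coordinates of
  the image sequence, and the conjugacy is injective.\<close>

lemma conjugate_imp_separating:
  assumes "conjugate_to_minimal_subshift X \<phi>" shows "\<exists>lab. separating lab"
proof -
  obtain A :: "nat set" and Y h where h: "homeomorphic_map X (subtopology (full_shift A) Y) h"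
    and eq: "\<And>x. x \<in> topspace X \<Longrightarrow> h (\<phi> x) = shift (h x)"
    using assms unfolding conjugate_to_minimal_subshift_def conjugate_systems_def by blast
  have coord: "h (iter k x) i = h x (i + k)" if x: "x \<in> topspace X" for k i x
  proof (induction k arbitrary: i rule: int_induct[where k=0])
    case base then show ?case by (simp add: iter_0)
  next
    case (step1 k)
    have "iter (k + 1) x = \<phi> (iter k x)" using iter_1[of "iter k x"] iter_add[of 1 k x] x by (simp add: add.commute)
    then have "h (iter (k + 1) x) i = h (iter k x) (i + 1)" using eq[of "iter k x"] x by (simp add: shift_def)
    then show ?case using step1(2)[of "i + 1"] by (simp add: algebra_simps)
  next
    case (step2 k)
    have "iter k x = \<phi> (iter (k - 1) x)" using iter_1[of "iter (k - 1) x"] iter_add[of 1 "k - 1" x] x by simp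
    then have "h (iter k x) (i - 1) = h (iter (k - 1) x) i" using eq[of "iter (k - 1) x"] x by (simp add: shift_def)
    then show ?case using step2(2)[of "i - 1"] by (simp add: algebra_simps)
  qed
  define lab where "lab x = h x 0" for x
  have "continuous_map X (full_shift A) h"
    using homeomorphic_imp_continuous_map[OF h] continuous_map_into_fulltopology by blast
  then have "continuous_map X (discrete_topology A) (\<lambda>x. h x 0)"
    unfolding full_shift_def continuous_map_componentwise_UNIV by blast
  then have "continuous_map X (subtopology (discrete_topology UNIV) A) (\<lambda>x. h x 0)"
    by (simp add: subtopology_discrete_topology)
  then have "continuous_map X (discrete_topology UNIV) lab"
    unfolding lab_def using continuous_map_into_fulltopology by blast
  then have "loc_const lab" by (simp add: loc_const_iff_continuous)
  moreover have "x = y" if x: "x \<in> topspace X" and y: "y \<in> topspace X"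
    and same: "\<forall>i. lab (iter i x) = lab (iter i y)" for x y
  proof -
    have "h x = h y" using same coord[OF x, of _ 0] coord[OF y, of _ 0] by (auto simp: lab_def fun_eq_iff)
    then show ?thesis using homeomorphic_imp_injective_map[OF h] x y by (auto dest: inj_onD)
  qed
  ultimately show ?thesis unfolding separating_def by blast
qed

text \<open>The itinerary map is a continuous injection from a compact space into a Hausdorff space,
  hence a homeomorphism onto its image. It turns \<open>\<phi>\<close> into the shift, and closed
  invariant sets are pulled back along it to inherit minimality.\<close>

lemma separating_imp_conjugate:
  assumes lab: "separating lab" shows "conjugate_to_minimal_subshift X \<phi>"
proof -
  have lc: "loc_const lab" and sep: "\<And>x y. x \<in> topspace X \<Longrightarrow> y \<in> topspace X \<Longrightarrow>
      (\<And>i. lab (iter i x) = lab (iter i y)) \<Longrightarrow> x = y"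
    using lab unfolding separating_def by blast+
  define A where "A = lab ` topspace X"
  define h where "h x = (\<lambda>i. lab (iter i x))" for x
  define Y where "Y = h ` topspace X"
  define Z where "Z = subtopology (full_shift A) Y"
  have A: "finite A" unfolding A_def by (rule loc_const_finite[OF lc])
  have "continuous_map X (discrete_topology A) (\<lambda>x. lab (iter i x))" for i
  proof -
    have "continuous_map X (discrete_topology UNIV) (\<lambda>x. lab (iter i x))"
      using loc_const_T[OF lc, of i] loc_const_iff_continuous[of "\<lambda>x. lab (iter i x)"] by blast
    then have "continuous_map X (subtopology (discrete_topology UNIV) A) (\<lambda>x. lab (iter i x))"
      by (rule continuous_map_into_subtopology) (auto simp: A_def)
    then show ?thesis by (simp add: subtopology_discrete_topology)
  qed
  then have cont: "continuous_map X (full_shift A) h"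
    unfolding full_shift_def continuous_map_componentwise_UNIV h_def by blast
  have Haus: "Hausdorff_space (full_shift A)"
    unfolding full_shift_def by (simp add: Hausdorff_space_product_topology Hausdorff_space_discrete_topology)
  have "compactin (full_shift A) Y"
    unfolding Y_def using compact_X cont by (intro image_compactin) (auto simp: compact_space_def)
  then have closed: "closedin (full_shift A) Y" by (rule compactin_imp_closedin[OF Haus])
  have topZ: "topspace Z = Y" unfolding Z_def using closedin_subset[OF closed] by auto
  have hom: "homeomorphic_map X Z h"
  proof (rule continuous_imp_homeomorphic_map[OF _ compact_X])
    show "continuous_map X Z h"
      unfolding Z_def by (rule continuous_map_into_subtopology[OF cont]) (auto simp: Y_def)
    show "Hausdorff_space Z" unfolding Z_def by (rule Hausdorff_space_subtopology[OF Haus])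
    show "h ` topspace X = topspace Z" by (simp add: topZ Y_def)
    show "inj_on h (topspace X)" by (rule inj_onI) (auto intro!: sep simp: h_def fun_eq_iff)
  qed
  have h_phi: "h (\<phi> x) = shift (h x)" if "x \<in> topspace X" for x
    using that iter_1[OF that, symmetric] by (simp add: h_def shift_def iter_add)
  have phi_S: "\<phi> ` topspace X = topspace X" by (rule homeomorphic_imp_surjective_map[OF homeomorphic_phi])
  have shift_h: "shift ` h ` B = h ` \<phi> ` B" if "B \<subseteq> topspace X" for B
    unfolding image_image using that h_phi by (intro image_cong refl) auto
  have shift_Y: "shift ` Y = Y" unfolding Y_def shift_h[OF order_refl] phi_S ..
  obtain k where k: "homeomorphic_maps X Z h k" using hom by (auto simp: homeomorphic_map_maps)
  have kh: "\<And>x. x \<in> topspace X \<Longrightarrow> k (h x) = x" and hk: "\<And>y. y \<in> topspace Z \<Longrightarrow> h (k y) = y"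
    using k by (auto simp: homeomorphic_maps_def)
  have "homeomorphic_map Z X k" using k homeomorphic_maps_sym homeomorphic_map_maps by blast
  then have "homeomorphic_map Z Z (h \<circ> (\<phi> \<circ> k))"
    by (intro homeomorphic_map_compose[OF homeomorphic_map_compose[OF _ homeomorphic_phi] hom])
  then have shift_hom: "homeomorphic_map Z Z shift"
  proof (rule homeomorphic_map_eq)
    fix y assume "y \<in> topspace Z"
    then obtain x where x: "x \<in> topspace X" "y = h x" unfolding topZ Y_def by blast
    then show "(h \<circ> (\<phi> \<circ> k)) y = shift y" using kh h_phi by simp
  qed
  have "C = {} \<or> C = topspace Z" if C: "closedin Z C" "shift ` C = C" for C
  proof -
    define D where "D = {x \<in> topspace X. h x \<in> C}"
    have D: "closedin X D"
      unfolding D_def by (rule closedin_continuous_map_preimage[OF homeomorphic_imp_continuous_map[OF hom] C(1)])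
    have DS: "D \<subseteq> topspace X" by (auto simp: D_def)
    have "C \<subseteq> Y" using closedin_subset[OF C(1)] topZ by simp
    then have hD: "h ` D = C" by (auto simp: D_def Y_def)
    have "h ` \<phi> ` D = h ` D" using shift_h[OF DS] hD C(2) by simp
    moreover have "\<phi> ` D \<subseteq> topspace X" using DS phi_S by blast
    ultimately have "\<phi> ` D = D"
      using inj_on_image_eq_iff[OF homeomorphic_imp_injective_map[OF hom], of "\<phi> ` D" D] DS by simp
    then have "D = {} \<or> D = topspace X"
      using D cantor_minimal by (simp add: Cantor_minimal_system_def minimal_homeomorphism_def)
    then show ?thesis using hD topZ Y_def by auto
  qed
  then have "minimal_homeomorphism Z shift" unfolding minimal_homeomorphism_def using shift_hom by blast
  moreover have "subshift A Y" unfolding subshift_def using A closed shift_Y by blast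
  moreover have "conjugate_systems X \<phi> Z shift" unfolding conjugate_systems_def using hom h_phi by blast
  ultimately show ?thesis unfolding conjugate_to_minimal_subshift_def Z_def by blast
qed

end

theorem corollary5p5:
  fixes X :: "'a topology" and \<phi> :: "'a \<Rightarrow> 'a"
  assumes "Cantor_minimal_system X \<phi>"
  shows "((conjugate_to_minimal_subshift X \<phi> \<and>
            finite (carrier (tensor_product (K0_group X \<phi>) (integer_mod_group 2))))
          \<longleftrightarrow> finitely_generated_group (topological_full_group_0 X \<phi>)) \<and>
         (finitely_generated_group (topological_full_group_0 X \<phi>)
          \<longleftrightarrow> finitely_generated_group (topological_full_group X \<phi>))"
proof -
  interpret cantor_minimal_system X \<phi> by unfold_locales (rule assms)
  have i_ii: "finitely_generated_group (topological_full_group_0 X \<phi>)"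
    if conj: "conjugate_to_minimal_subshift X \<phi>"
      and fin: "finite (carrier (tensor_product (K0_group X \<phi>) (integer_mod_group 2)))"
  proof -
    obtain lab where "separating lab" using conjugate_imp_separating[OF conj] by (elim exE)
    moreover have finite_classes using fin by (simp only: finite_tensor_iff_finite_classes)
    ultimately show ?thesis
      unfolding finitely_generated_topological_full_group_0 by (rule full_0_finitely_generated)
  qed
  have ii_iii: "finitely_generated_group (topological_full_group X \<phi>)"
    if fg: "finitely_generated_group (topological_full_group_0 X \<phi>)"
  proof -
    obtain F where F: "finite F" "F \<subseteq> full_0" "generated F = full_0"
      using fg unfolding finitely_generated_topological_full_group_0 by (elim exE conjE)
    show ?thesis
      unfolding finitely_generated_topological_full_group by (rule full_finitely_generated[OF F])
  qed
  have iii_i: "conjugate_to_minimal_subshift X \<phi>"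
    "finite (carrier (tensor_product (K0_group X \<phi>) (integer_mod_group 2)))"
    if fg: "finitely_generated_group (topological_full_group X \<phi>)"
  proof -
    obtain F where F: "finite F" "F \<subseteq> full" "generated F = full"
      using fg unfolding finitely_generated_topological_full_group by (elim exE conjE)
    obtain lab where "separating lab" using finitely_generated_imp_separating[OF F] by (elim exE)
    then show "conjugate_to_minimal_subshift X \<phi>" by (rule separating_imp_conjugate)
    show "finite (carrier (tensor_product (K0_group X \<phi>) (integer_mod_group 2)))"
      unfolding finite_tensor_iff_finite_classes by (rule finitely_generated_imp_finite_classes[OF F])
  qed
  show ?thesis
  proof (intro conjI iffI)
    assume fg: "finitely_generated_group (topological_full_group_0 X \<phi>)"
    show "conjugate_to_minimal_subshift X \<phi>" by (rule iii_i(1)[OF ii_iii[OF fg]])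
    show "finite (carrier (tensor_product (K0_group X \<phi>) (integer_mod_group 2)))"
      by (rule iii_i(2)[OF ii_iii[OF fg]])
  next
    assume fg: "finitely_generated_group (topological_full_group X \<phi>)"
    show "finitely_generated_group (topological_full_group_0 X \<phi>)"
      by (rule i_ii[OF iii_i(1)[OF fg] iii_i(2)[OF fg]])
  qed (elim conjE, fact i_ii, fact ii_iii)
qed

end
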